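(* Let $\Phi\colon\mathcal C\to\mathbf S$ be a bifibration in which each fiber category $\mathcal C^A$ has a class of weak equivalences, and suppose that it is bi-deformable. Then $\mathrm{Ho}\,\mathcal C\to\mathbf S$ is a bifibration as well. The fiber categories are canonically isomorphic to the homotopy categories of the fibers, $(\mathrm{Ho}\,\mathcal C)^A\cong\mathrm{Ho}(\mathcal C^A)$. Finally, each of the chosen homotopy Beck-Chevalley squares satisfies the Beck-Chevalley condition in $\mathrm{Ho}\,\mathcal C$.
   Context: A bifibration is a functor $\Phi\colon\mathcal C\to\mathbf S$ such that for each $f\colon A\to B$ in $\mathbf S$, each $X$ in the fiber category $\mathcal C^B=\Phi^{-1}(B)$ admits a cartesian arrow $f^*X\to X$ over $f$ (every arrow $Y\to X$ lying over a composite $\Phi(Y)\to A\xrightarrow{f}B$ factors uniquely through $f^*X\to X$ by an arrow over $\Phi(Y)\to A$), and dually each $X\in\mathcal C^A$ admits a co-cartesian arrow $X\to f_!X$ over $f$. This gives adjoint functors $f_!\dashv f^*$. For a commuting square in $\mathbf S$ with maps $g\colon A\to B$, $f\colon A\to C$, $p\colon B\to D$, $q\colon C\to D$, $pg=qf$, the Beck-Chevalley condition says that the canonical map $f_!g^*\to f_!g^*p^*p_!\cong f_!f^*q^*p_!\to q^*p_!$ is an isomorphism. Weak equivalences satisfy 2-out-of-3. $\mathrm{Ho}\,\mathcal C$ is formed by inverting the weak equivalences of every fiber category $\mathcal C^A$ (these lie over identity maps, so $\mathrm{Ho}\,\mathcal C$ maps to $\mathbf S$); $\mathrm{Ho}(\mathcal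 C^A)$ inverts those in the single category $\mathcal C^A$. $\mathcal C$ is bi-deformable if: (BF3) There is a simultaneous choice of cofibrant replacement $Q_A$ on each $\mathcal C^A$ (a functor with a natural weak equivalence $Q_AX\to X$, landing in a full subcategory of "cofibrant" objects) such that all pushforwards $f_!$ preserve cofibrant objects and weak equivalences between them. (BF4) There is a simultaneous choice of fibrant replacement $R_A$ on each $\mathcal C^A$ (natural weak equivalence $X\to R_AX$, landing in a full subcategory of "fibrant" objects) such that all pullbacks $f^*$ preserve fibrant objects and weak equivalences between them. (BF5) A class of "homotopy Beck-Chevalley" squares is chosen; each satisfies the Beck-Chevalley condition in $\mathcal C$, and the two lists of functors $(g^*,f_!)$ and $(p_!,q^* )$ form a coherently deformable pair. Here, derived functors are $\mathbb Lf_!=f_!Q$, $\mathbb Rf^*=f^*R$, denoted $\mathbb DF$ in general, with canonical comparison maps $\mathbb DF\leftrightarrow F$. A list $\mathbf C_0\xrightarrow{F_1}\cdots\xrightarrow{F_n}\mathbf C_n$ is coherently deformable if there are full subcategories $\mathbf A_{i-1}\subseteq\mathbf C_{i-1}$ ($1\le i\le n$), each containing the image of a composite of functors equipped with natural weak equivalences to or from the identity, such that $\mathbb DF_i\leftrightarrow F_i$ is an equivalence on $\mathbf A_{i-1}$ and $F_i(\mathbf A_{i-1})\subseteq\mathbf A_i$ for $i<n$. A pair of lists with common source is coherently deformable if both lists are, with the same $\mathbf A_0$. *)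

theory Defs
  imports Main
begin

section \<open>Categories, functors, natural transformations\<close>

record ('o, 'a) category =
  Obj :: "'o set"
  Arr :: "'a set"
  Dom :: "'a \<Rightarrow> 'o"
  Cod :: "'a \<Rightarrow> 'o"
  Idt :: "'o \<Rightarrow> 'a"
  Comp :: "'a \<Rightarrow> 'a \<Rightarrow> 'a"  (infixr \<open>\<cdot>\<index>\<close> 70)

definition hom :: "('o, 'a) category \<Rightarrow> 'o \<Rightarrow> 'o \<Rightarrow> 'a set" where
  "hom C X Y = {u \<in> Arr C. Dom C u = X \<and> Cod C u = Y}"

definition is_category :: "('o, 'a) category \<Rightarrow> bool" where
  "is_category C \<longleftrightarrow>
     (\<forall>u\<in>Arr C. Dom C u \<in> Obj C \<and> Cod C u \<in> Obj C) \<and>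
     (\<forall>X\<in>Obj C. Idt C X \<in> hom C X X) \<and>
     (\<forall>u\<in>Arr C. \<forall>v\<in>Arr C. Cod C u = Dom C v \<longrightarrow> v \<cdot>\<^bsub>C\<^esub> u \<in> hom C (Dom C u) (Cod C v)) \<and>
     (\<forall>u\<in>Arr C. u \<cdot>\<^bsub>C\<^esub> Idt C (Dom C u) = u \<and> Idt C (Cod C u) \<cdot>\<^bsub>C\<^esub> u = u) \<and>
     (\<forall>u\<in>Arr C. \<forall>v\<in>Arr C. \<forall>w\<in>Arr C. Cod C u = Dom C v \<longrightarrow> Cod C v = Dom C w \<longrightarrow>
        (w \<cdot>\<^bsub>C\<^esub> v) \<cdot>\<^bsub>C\<^esub> u = w \<cdot>\<^bsub>C\<^esub> (v \<cdot>\<^bsub>C\<^esub> u))"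

definition inverse_arrows :: "('o, 'a) category \<Rightarrow> 'a \<Rightarrow> 'a \<Rightarrow> bool" where
  "inverse_arrows C u v \<longleftrightarrow>
     u \<in> Arr C \<and> v \<in> hom C (Cod C u) (Dom C u) \<and>
     v \<cdot>\<^bsub>C\<^esub> u = Idt C (Dom C u) \<and> u \<cdot>\<^bsub>C\<^esub> v = Idt C (Cod C u)"

definition is_iso :: "('o, 'a) category \<Rightarrow> 'a \<Rightarrow> bool" where
  "is_iso C u \<longleftrightarrow> (\<exists>v. inverse_arrows C u v)"

definition inv_arrow :: "('o, 'a) category \<Rightarrow> 'a \<Rightarrow> 'a" where
  "inv_arrow C u = (THE v. inverse_arrows C u v)"

record ('o, 'a, 'p, 'b) fmap =
  FObj :: "'o \<Rightarrow> 'p"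
  FArr :: "'a \<Rightarrow> 'b"

definition is_functor ::
  "('o, 'a) category \<Rightarrow> ('p, 'b) category \<Rightarrow> ('o, 'a, 'p, 'b) fmap \<Rightarrow> bool" where
  "is_functor C D F \<longleftrightarrow>
     is_category C \<and> is_category D \<and>
     (\<forall>X\<in>Obj C. FObj F X \<in> Obj D \<and> FArr F (Idt C X) = Idt D (FObj F X)) \<and>
     (\<forall>u\<in>Arr C. FArr F u \<in> hom D (FObj F (Dom C u)) (FObj F (Cod C u))) \<and>
     (\<forall>u\<in>Arr C. \<forall>v\<in>Arr C. Cod C u = Dom C v \<longrightarrow>
        FArr F (v \<cdot>\<^bsub>C\<^esub> u) = FArr F v \<cdot>\<^bsub>D\<^esub> FArr F u)"

definition id_fmap :: "('o, 'a, 'o, 'a) fmap" where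
  "id_fmap = \<lparr>FObj = \<lambda>X. X, FArr = \<lambda>u. u\<rparr>"

definition comp_fmap ::
  "('p, 'b, 'q, 'c) fmap \<Rightarrow> ('o, 'a, 'p, 'b) fmap \<Rightarrow> ('o, 'a, 'q, 'c) fmap" where
  "comp_fmap G F = \<lparr>FObj = FObj G \<circ> FObj F, FArr = FArr G \<circ> FArr F\<rparr>"

definition nat_trans ::
  "('o, 'a) category \<Rightarrow> ('p, 'b) category \<Rightarrow> ('o, 'a, 'p, 'b) fmap \<Rightarrow> ('o, 'a, 'p, 'b) fmap
    \<Rightarrow> ('o \<Rightarrow> 'b) \<Rightarrow> bool" where
  "nat_trans C D F G \<tau> \<longleftrightarrow>
     is_functor C D F \<and> is_functor C D G \<and>
     (\<forall>X\<in>Obj C. \<tau> X \<in> hom D (FObj F X) (FObj G X)) \<and>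
     (\<forall>u\<in>Arr C. \<tau> (Cod C u) \<cdot>\<^bsub>D\<^esub> FArr F u = FArr G u \<cdot>\<^bsub>D\<^esub> \<tau> (Dom C u))"

definition nat_weq ::
  "('o, 'a) category \<Rightarrow> ('p, 'b) category \<Rightarrow> 'b set
    \<Rightarrow> ('o, 'a, 'p, 'b) fmap \<Rightarrow> ('o, 'a, 'p, 'b) fmap \<Rightarrow> ('o \<Rightarrow> 'b) \<Rightarrow> bool" where
  "nat_weq C D W F G \<tau> \<longleftrightarrow> nat_trans C D F G \<tau> \<and> (\<forall>X\<in>Obj C. \<tau> X \<in> W)"

definition cat_iso ::
  "('o, 'a) category \<Rightarrow> ('p, 'b) category \<Rightarrow> ('o, 'a, 'p, 'b) fmap \<Rightarrow> bool" where
  "cat_iso C D F \<longleftrightarrow>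
     is_functor C D F \<and> bij_betw (FObj F) (Obj C) (Obj D) \<and> bij_betw (FArr F) (Arr C) (Arr D)"


section \<open>The category obtained by inverting a class of arrows\<close>

text \<open>
  The localization of \<open>C\<close> at \<open>W\<close> has the objects of \<open>C\<close>; its arrows are zigzags of arrows of \<open>C\<close>
  and formally reversed arrows of \<open>W\<close>, modulo the least congruence that makes the
  map from \<open>C\<close> a functor and each \<open>Bwd w\<close> an inverse of \<open>Fwd w\<close>.
  A zigzag \<open>(X, us, Y)\<close> runs from \<open>X\<close> to \<open>Y\<close>; the head of \<open>us\<close> is traversed first.
\<close>

datatype 'a step = Fwd 'a | Bwd 'a

type_synonym ('o, 'a) zigzag = "'o \<times> 'a step list \<times> 'o"

fun step_ok :: "('o, 'a) category \<Rightarrow> 'a set \<Rightarrow> 'a step \<Rightarrow> bool" where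
  "step_ok C W (Fwd u) \<longleftrightarrow> u \<in> Arr C"
| "step_ok C W (Bwd u) \<longleftrightarrow> u \<in> Arr C \<and> u \<in> W"

fun step_src :: "('o, 'a) category \<Rightarrow> 'a step \<Rightarrow> 'o" where
  "step_src C (Fwd u) = Dom C u"
| "step_src C (Bwd u) = Cod C u"

fun step_tgt :: "('o, 'a) category \<Rightarrow> 'a step \<Rightarrow> 'o" where
  "step_tgt C (Fwd u) = Cod C u"
| "step_tgt C (Bwd u) = Dom C u"

fun is_zigzag :: "('o, 'a) category \<Rightarrow> 'a set \<Rightarrow> 'o \<Rightarrow> 'a step list \<Rightarrow> 'o \<Rightarrow> bool" where
  "is_zigzag C W X [] Y \<longleftrightarrow> X \<in> Obj C \<and> X = Y"
| "is_zigzag C W X (s # us) Y \<longleftrightarrow>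
     step_ok C W s \<and> step_src C s = X \<and> is_zigzag C W (step_tgt C s) us Y"

definition zigzags :: "('o, 'a) category \<Rightarrow> 'a set \<Rightarrow> ('o, 'a) zigzag set" where
  "zigzags C W = {(X, us, Y). is_zigzag C W X us Y}"

inductive zigzag_red ::
  "('o, 'a) category \<Rightarrow> 'a set \<Rightarrow> 'a step list \<Rightarrow> 'a step list \<Rightarrow> bool"
  for C W where
  red_id: "X \<in> Obj C \<Longrightarrow> zigzag_red C W [Fwd (Idt C X)] []"
| red_comp: "u \<in> Arr C \<Longrightarrow> v \<in> Arr C \<Longrightarrow> Cod C u = Dom C v \<Longrightarrow>
     zigzag_red C W [Fwd u, Fwd v] [Fwd (v \<cdot>\<^bsub>C\<^esub> u)]"
| red_fwd_bwd: "w \<in> Arr C \<Longrightarrow> w \<in> W \<Longrightarrow> zigzag_red C W [Fwd w, Bwd w] []"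
| red_bwd_fwd: "w \<in> Arr C \<Longrightarrow> w \<in> W \<Longrightarrow> zigzag_red C W [Bwd w, Fwd w] []"

inductive_set zigzag_eq ::
  "('o, 'a) category \<Rightarrow> 'a set \<Rightarrow> (('o, 'a) zigzag \<times> ('o, 'a) zigzag) set"
  for C W where
  zz_red: "zigzag_red C W us vs \<Longrightarrow>
     (X, as @ us @ bs, Y) \<in> zigzags C W \<Longrightarrow> (X, as @ vs @ bs, Y) \<in> zigzags C W \<Longrightarrow>
     ((X, as @ us @ bs, Y), (X, as @ vs @ bs, Y)) \<in> zigzag_eq C W"
| zz_refl: "z \<in> zigzags C W \<Longrightarrow> (z, z) \<in> zigzag_eq C W"
| zz_sym: "(z, z') \<in> zigzag_eq C W \<Longrightarrow> (z', z) \<in> zigzag_eq C W"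
| zz_trans: "(z, z') \<in> zigzag_eq C W \<Longrightarrow> (z', z'') \<in> zigzag_eq C W \<Longrightarrow> (z, z'') \<in> zigzag_eq C W"

definition Ho :: "('o, 'a) category \<Rightarrow> 'a set \<Rightarrow> ('o, ('o, 'a) zigzag set) category" where
  "Ho C W =
     \<lparr>Obj = Obj C,
      Arr = zigzags C W // zigzag_eq C W,
      Dom = \<lambda>K. THE X. \<exists>us Y. (X, us, Y) \<in> K,
      Cod = \<lambda>K. THE Y. \<exists>X us. (X, us, Y) \<in> K,
      Idt = \<lambda>X. zigzag_eq C W `` {(X, [], X)},
      Comp = \<lambda>L K. zigzag_eq C W ``
               {(X, us @ vs, Z) | X us Y vs Z. (X, us, Y) \<in> K \<and> (Y, vs, Z) \<in> L}\<rparr>"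

definition Ho_loc ::
  "('o, 'a) category \<Rightarrow> 'a set \<Rightarrow> ('o, 'a, 'o, ('o, 'a) zigzag set) fmap" where
  "Ho_loc C W =
     \<lparr>FObj = \<lambda>X. X, FArr = \<lambda>u. zigzag_eq C W `` {(Dom C u, [Fwd u], Cod C u)}\<rparr>"

text \<open>
  The functor on the localization of \<open>C\<close> at \<open>W\<close> induced by a functor \<open>F\<close> from \<open>C\<close> to \<open>D\<close> that sends
  the arrows of \<open>W\<close> to isomorphisms.
\<close>

fun eval_zigzag ::
  "('o, 'a) category \<Rightarrow> ('p, 'b) category \<Rightarrow> ('o, 'a, 'p, 'b) fmap \<Rightarrow> 'o \<Rightarrow> 'a step list \<Rightarrow> 'b" where
  "eval_zigzag C D F X [] = Idt D (FObj F X)"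
| "eval_zigzag C D F X (Fwd u # us) = eval_zigzag C D F (Cod C u) us \<cdot>\<^bsub>D\<^esub> FArr F u"
| "eval_zigzag C D F X (Bwd u # us) = eval_zigzag C D F (Dom C u) us \<cdot>\<^bsub>D\<^esub> inv_arrow D (FArr F u)"

definition Ho_lift ::
  "('o, 'a) category \<Rightarrow> ('p, 'b) category \<Rightarrow> ('o, 'a, 'p, 'b) fmap
    \<Rightarrow> ('o, ('o, 'a) zigzag set, 'p, 'b) fmap" where
  "Ho_lift C D F =
     \<lparr>FObj = FObj F,
      FArr = \<lambda>K. THE d. \<exists>X us Y. (X, us, Y) \<in> K \<and> d = eval_zigzag C D F X us\<rparr>"


section \<open>Bifibrations\<close>

definition fiber ::
  "('o, 'a) category \<Rightarrow> ('b, 's) category \<Rightarrow> ('o, 'a, 'b, 's) fmap \<Rightarrow> 'b \<Rightarrow> ('o, 'a) category" where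
  "fiber C S \<Phi> A =
     C\<lparr>Obj := {X \<in> Obj C. FObj \<Phi> X = A}, Arr := {u \<in> Arr C. FArr \<Phi> u = Idt S A}\<rparr>"

definition cartesian ::
  "('o, 'a) category \<Rightarrow> ('b, 's) category \<Rightarrow> ('o, 'a, 'b, 's) fmap \<Rightarrow> 'a \<Rightarrow> bool" where
  "cartesian C S \<Phi> u \<longleftrightarrow> u \<in> Arr C \<and>
     (\<forall>Y\<in>Obj C. \<forall>v\<in>hom C Y (Cod C u). \<forall>h\<in>hom S (FObj \<Phi> Y) (FObj \<Phi> (Dom C u)).
        FArr \<Phi> v = FArr \<Phi> u \<cdot>\<^bsub>S\<^esub> h \<longrightarrow>
        (\<exists>!w. w \<in> hom C Y (Dom C u) \<and> FArr \<Phi> w = h \<and> u \<cdot>\<^bsub>C\<^esub> w = v))"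

definition cocartesian ::
  "('o, 'a) category \<Rightarrow> ('b, 's) category \<Rightarrow> ('o, 'a, 'b, 's) fmap \<Rightarrow> 'a \<Rightarrow> bool" where
  "cocartesian C S \<Phi> u \<longleftrightarrow> u \<in> Arr C \<and>
     (\<forall>Y\<in>Obj C. \<forall>v\<in>hom C (Dom C u) Y. \<forall>h\<in>hom S (FObj \<Phi> (Cod C u)) (FObj \<Phi> Y).
        FArr \<Phi> v = h \<cdot>\<^bsub>S\<^esub> FArr \<Phi> u \<longrightarrow>
        (\<exists>!w. w \<in> hom C (Cod C u) Y \<and> FArr \<Phi> w = h \<and> w \<cdot>\<^bsub>C\<^esub> u = v))"

definition bifibration ::
  "('o, 'a) category \<Rightarrow> ('b, 's) category \<Rightarrow> ('o, 'a, 'b, 's) fmap \<Rightarrow> bool" where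
  "bifibration C S \<Phi> \<longleftrightarrow> is_functor C S \<Phi> \<and>
     (\<forall>f\<in>Arr S.
        (\<forall>X\<in>Obj C. FObj \<Phi> X = Cod S f \<longrightarrow>
           (\<exists>u. cartesian C S \<Phi> u \<and> Cod C u = X \<and> FArr \<Phi> u = f)) \<and>
        (\<forall>X\<in>Obj C. FObj \<Phi> X = Dom S f \<longrightarrow>
           (\<exists>u. cocartesian C S \<Phi> u \<and> Dom C u = X \<and> FArr \<Phi> u = f)))"

text \<open>
  A choice of the arrows \<open>f\<^sup>*X \<rightarrow> X\<close> (\<open>Cart f X\<close>) and \<open>X \<rightarrow> f\<^sub>!X\<close> (\<open>Cocart f X\<close>), through which the
  functors \<open>f\<^sup>*\<close> and \<open>f\<^sub>!\<close> are defined.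
\<close>

record ('o, 'a, 's) cleavage =
  Cart :: "'s \<Rightarrow> 'o \<Rightarrow> 'a"
  Cocart :: "'s \<Rightarrow> 'o \<Rightarrow> 'a"

definition is_cleavage ::
  "('o, 'a) category \<Rightarrow> ('b, 's) category \<Rightarrow> ('o, 'a, 'b, 's) fmap \<Rightarrow> ('o, 'a, 's) cleavage \<Rightarrow> bool" where
  "is_cleavage C S \<Phi> \<kappa> \<longleftrightarrow>
     (\<forall>f\<in>Arr S.
        (\<forall>X\<in>Obj C. FObj \<Phi> X = Cod S f \<longrightarrow>
           cartesian C S \<Phi> (Cart \<kappa> f X) \<and> Cod C (Cart \<kappa> f X) = X \<and> FArr \<Phi> (Cart \<kappa> f X) = f) \<and>
        (\<forall>X\<in>Obj C. FObj \<Phi> X = Dom S f \<longrightarrow>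
           cocartesian C S \<Phi> (Cocart \<kappa> f X) \<and> Dom C (Cocart \<kappa> f X) = X \<and>
           FArr \<Phi> (Cocart \<kappa> f X) = f))"

text \<open>
  The factorization over \<open>h\<close> of \<open>v\<close> through the cartesian (respectively cocartesian) arrow \<open>u\<close>.
\<close>

definition cart_factor ::
  "('o, 'a) category \<Rightarrow> ('o, 'a, 'b, 's) fmap \<Rightarrow> 'a \<Rightarrow> 's \<Rightarrow> 'a \<Rightarrow> 'a" where
  "cart_factor C \<Phi> u h v =
     (THE w. w \<in> hom C (Dom C v) (Dom C u) \<and> FArr \<Phi> w = h \<and> u \<cdot>\<^bsub>C\<^esub> w = v)"

definition cocart_factor ::
  "('o, 'a) category \<Rightarrow> ('o, 'a, 'b, 's) fmap \<Rightarrow> 'a \<Rightarrow> 's \<Rightarrow> 'a \<Rightarrow> 'a" where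
  "cocart_factor C \<Phi> u h v =
     (THE w. w \<in> hom C (Cod C u) (Cod C v) \<and> FArr \<Phi> w = h \<and> w \<cdot>\<^bsub>C\<^esub> u = v)"

text \<open>
  \<open>pull f\<close> is the functor \<open>f\<^sup>*\<close> from the fiber over \<open>Cod f\<close> to the fiber over \<open>Dom f\<close>;
  \<open>push f\<close> is \<open>f\<^sub>!\<close> in the other direction.
\<close>

definition pull ::
  "('o, 'a) category \<Rightarrow> ('b, 's) category \<Rightarrow> ('o, 'a, 'b, 's) fmap \<Rightarrow> ('o, 'a, 's) cleavage
    \<Rightarrow> 's \<Rightarrow> ('o, 'a, 'o, 'a) fmap" where
  "pull C S \<Phi> \<kappa> f =
     \<lparr>FObj = \<lambda>X. Dom C (Cart \<kappa> f X),
      FArr = \<lambda>u. cart_factor C \<Phi> (Cart \<kappa> f (Cod C u)) (Idt S (Dom S f))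
                   (u \<cdot>\<^bsub>C\<^esub> Cart \<kappa> f (Dom C u))\<rparr>"

definition push ::
  "('o, 'a) category \<Rightarrow> ('b, 's) category \<Rightarrow> ('o, 'a, 'b, 's) fmap \<Rightarrow> ('o, 'a, 's) cleavage
    \<Rightarrow> 's \<Rightarrow> ('o, 'a, 'o, 'a) fmap" where
  "push C S \<Phi> \<kappa> f =
     \<lparr>FObj = \<lambda>X. Cod C (Cocart \<kappa> f X),
      FArr = \<lambda>u. cocart_factor C \<Phi> (Cocart \<kappa> f (Dom C u)) (Idt S (Cod S f))
                   (Cocart \<kappa> f (Cod C u) \<cdot>\<^bsub>C\<^esub> u)\<rparr>"

text \<open>The unit \<open>X \<rightarrow> f\<^sup>*f\<^sub>!X\<close> and the counit \<open>f\<^sub>!f\<^sup>*X \<rightarrow> X\<close> of the adjunction between \<open>f\<^sub>!\<close> and \<open>f\<^sup>*\<close>.\<close>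

definition unit_arr ::
  "('o, 'a) category \<Rightarrow> ('b, 's) category \<Rightarrow> ('o, 'a, 'b, 's) fmap \<Rightarrow> ('o, 'a, 's) cleavage
    \<Rightarrow> 's \<Rightarrow> 'o \<Rightarrow> 'a" where
  "unit_arr C S \<Phi> \<kappa> f X =
     cart_factor C \<Phi> (Cart \<kappa> f (FObj (push C S \<Phi> \<kappa> f) X)) (Idt S (Dom S f)) (Cocart \<kappa> f X)"

definition counit_arr ::
  "('o, 'a) category \<Rightarrow> ('b, 's) category \<Rightarrow> ('o, 'a, 'b, 's) fmap \<Rightarrow> ('o, 'a, 's) cleavage
    \<Rightarrow> 's \<Rightarrow> 'o \<Rightarrow> 'a" where
  "counit_arr C S \<Phi> \<kappa> f X =
     cocart_factor C \<Phi> (Cocart \<kappa> f (FObj (pull C S \<Phi> \<kappa> f) X)) (Idt S (Cod S f)) (Cart \<kappa> f X)"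

text \<open>
  Squares are quadruples \<open>(g, f, p, q)\<close> with \<open>g : A \<rightarrow> B\<close>, \<open>f : A \<rightarrow> C\<close>, \<open>p : B \<rightarrow> D\<close>, \<open>q : C \<rightarrow> D\<close>.
\<close>

type_synonym 's square = "'s \<times> 's \<times> 's \<times> 's"

fun commuting_square :: "('b, 's) category \<Rightarrow> 's square \<Rightarrow> bool" where
  "commuting_square S (g, f, p, q) \<longleftrightarrow>
     g \<in> Arr S \<and> f \<in> Arr S \<and> p \<in> Arr S \<and> q \<in> Arr S \<and>
     Dom S g = Dom S f \<and> Cod S g = Dom S p \<and> Cod S f = Dom S q \<and> Cod S p = Cod S q \<and>
     p \<cdot>\<^bsub>S\<^esub> g = q \<cdot>\<^bsub>S\<^esub> f"

text \<open>
  The isomorphism \<open>g\<^sup>*p\<^sup>*Z \<cong> f\<^sup>*q\<^sup>*Z\<close>: both sides carry composite cartesian arrows to \<open>Z\<close> over \<open>pg = qf\<close>.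
\<close>

definition pull_pull_iso ::
  "('o, 'a) category \<Rightarrow> ('b, 's) category \<Rightarrow> ('o, 'a, 'b, 's) fmap \<Rightarrow> ('o, 'a, 's) cleavage
    \<Rightarrow> 's square \<Rightarrow> 'o \<Rightarrow> 'a" where
  "pull_pull_iso C S \<Phi> \<kappa> = (\<lambda>(g, f, p, q) Z.
     cart_factor C \<Phi>
       (Cart \<kappa> q Z \<cdot>\<^bsub>C\<^esub> Cart \<kappa> f (FObj (pull C S \<Phi> \<kappa> q) Z))
       (Idt S (Dom S f))
       (Cart \<kappa> p Z \<cdot>\<^bsub>C\<^esub> Cart \<kappa> g (FObj (pull C S \<Phi> \<kappa> p) Z)))"

text \<open>The composite \<open>f\<^sub>!g\<^sup>*X \<rightarrow> f\<^sub>!g\<^sup>*p\<^sup>*p\<^sub>!X \<cong> f\<^sub>!f\<^sup>*q\<^sup>*p\<^sub>!X \<rightarrow> q\<^sup>*p\<^sub>!X\<close>.\<close>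

definition beck_chevalley_map ::
  "('o, 'a) category \<Rightarrow> ('b, 's) category \<Rightarrow> ('o, 'a, 'b, 's) fmap \<Rightarrow> ('o, 'a, 's) cleavage
    \<Rightarrow> 's square \<Rightarrow> 'o \<Rightarrow> 'a" where
  "beck_chevalley_map C S \<Phi> \<kappa> = (\<lambda>(g, f, p, q) X.
     let Z = FObj (push C S \<Phi> \<kappa> p) X in
     counit_arr C S \<Phi> \<kappa> f (FObj (pull C S \<Phi> \<kappa> q) Z) \<cdot>\<^bsub>C\<^esub>
     FArr (push C S \<Phi> \<kappa> f) (pull_pull_iso C S \<Phi> \<kappa> (g, f, p, q) Z) \<cdot>\<^bsub>C\<^esub>
     FArr (push C S \<Phi> \<kappa> f) (FArr (pull C S \<Phi> \<kappa> g) (unit_arr C S \<Phi> \<kappa> p X)))"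

fun beck_chevalley ::
  "('o, 'a) category \<Rightarrow> ('b, 's) category \<Rightarrow> ('o, 'a, 'b, 's) fmap \<Rightarrow> ('o, 'a, 's) cleavage
    \<Rightarrow> 's square \<Rightarrow> bool" where
  "beck_chevalley C S \<Phi> \<kappa> (g, f, p, q) \<longleftrightarrow>
     (\<forall>X\<in>Obj (fiber C S \<Phi> (Cod S g)).
        is_iso (fiber C S \<Phi> (Cod S f)) (beck_chevalley_map C S \<Phi> \<kappa> (g, f, p, q) X))"


section \<open>Coherent deformability\<close>

text \<open>
  A functor between categories with weak equivalences together with the components of its
  comparison map with its derived functor \<open>DF\<close>. The component at \<open>X\<close> points from \<open>DF X\<close> to \<open>F X\<close> if
  \<open>DF\<close> is a left derived functor, and from \<open>F X\<close> to \<open>DF X\<close> if it is a right derived functor.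
\<close>

record ('o, 'a) derivable =
  Source :: "('o, 'a) category"
  SourceW :: "'a set"
  TargetW :: "'a set"
  Fun :: "('o, 'a, 'o, 'a) fmap"
  Comparison :: "'o \<Rightarrow> 'a"

inductive deformation :: "('o, 'a) category \<Rightarrow> 'a set \<Rightarrow> ('o, 'a, 'o, 'a) fmap \<Rightarrow> bool"
  for C W where
  to_id: "nat_weq C C W T id_fmap \<tau> \<Longrightarrow> deformation C W T"
| from_id: "nat_weq C C W id_fmap T \<tau> \<Longrightarrow> deformation C W T"
| composite: "deformation C W T \<Longrightarrow> deformation C W T' \<Longrightarrow> deformation C W (comp_fmap T' T)"

text \<open>Full subcategories are given by their sets of objects.\<close>

definition coherently_deformable_along :: "'o set list \<Rightarrow> ('o, 'a) derivable list \<Rightarrow> bool" where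
  "coherently_deformable_along As Fs \<longleftrightarrow>
     length As = length Fs \<and>
     (\<forall>i<length Fs.
        As ! i \<subseteq> Obj (Source (Fs ! i)) \<and>
        (\<exists>T. deformation (Source (Fs ! i)) (SourceW (Fs ! i)) T \<and>
             FObj T ` Obj (Source (Fs ! i)) \<subseteq> As ! i) \<and>
        (\<forall>X\<in>As ! i. Comparison (Fs ! i) X \<in> TargetW (Fs ! i)) \<and>
        (Suc i < length Fs \<longrightarrow> FObj (Fun (Fs ! i)) ` (As ! i) \<subseteq> As ! Suc i))"

definition coherently_deformable_pair ::
  "('o, 'a) derivable list \<Rightarrow> ('o, 'a) derivable list \<Rightarrow> bool" where
  "coherently_deformable_pair Fs Gs \<longleftrightarrow>
     (\<exists>As Bs. coherently_deformable_along As Fs \<and> coherently_deformable_along Bs Gs \<and>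
        As ! 0 = Bs ! 0)"


section \<open>Bi-deformable bifibrations\<close>

definition fiberwise_weqs ::
  "('o, 'a) category \<Rightarrow> ('b, 's) category \<Rightarrow> ('o, 'a, 'b, 's) fmap \<Rightarrow> ('b \<Rightarrow> 'a set) \<Rightarrow> bool" where
  "fiberwise_weqs C S \<Phi> W \<longleftrightarrow>
     (\<forall>A\<in>Obj S. W A \<subseteq> Arr (fiber C S \<Phi> A) \<and>
        (\<forall>u\<in>Arr (fiber C S \<Phi> A). \<forall>v\<in>Arr (fiber C S \<Phi> A). Cod C u = Dom C v \<longrightarrow>
           (u \<in> W A \<and> v \<in> W A \<longrightarrow> v \<cdot>\<^bsub>C\<^esub> u \<in> W A) \<and>
           (u \<in> W A \<and> v \<cdot>\<^bsub>C\<^esub> u \<in> W A \<longrightarrow> v \<in> W A) \<and>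
           (v \<in> W A \<and> v \<cdot>\<^bsub>C\<^esub> u \<in> W A \<longrightarrow> u \<in> W A)))"

definition preserves_weqs_between ::
  "('o, 'a) category \<Rightarrow> 'o set \<Rightarrow> 'a set \<Rightarrow> 'o set \<Rightarrow> 'a set \<Rightarrow> ('o, 'a, 'o, 'a) fmap \<Rightarrow> bool" where
  "preserves_weqs_between C A WA B WB F \<longleftrightarrow>
     FObj F ` A \<subseteq> B \<and> (\<forall>u\<in>WA. Dom C u \<in> A \<and> Cod C u \<in> A \<longrightarrow> FArr F u \<in> WB)"

definition cofibrant_replacement ::
  "('o, 'a) category \<Rightarrow> ('b, 's) category \<Rightarrow> ('o, 'a, 'b, 's) fmap \<Rightarrow> ('o, 'a, 's) cleavage
    \<Rightarrow> ('b \<Rightarrow> 'a set) \<Rightarrow> ('b \<Rightarrow> ('o, 'a, 'o, 'a) fmap) \<Rightarrow> ('b \<Rightarrow> 'o \<Rightarrow> 'a) \<Rightarrow> ('b \<Rightarrow> 'o set) \<Rightarrow> bool"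
where
  "cofibrant_replacement C S \<Phi> \<kappa> W Q \<theta> Cof \<longleftrightarrow>
     (\<forall>A\<in>Obj S. Cof A \<subseteq> Obj (fiber C S \<Phi> A) \<and>
        nat_weq (fiber C S \<Phi> A) (fiber C S \<Phi> A) (W A) (Q A) id_fmap (\<theta> A) \<and>
        FObj (Q A) ` Obj (fiber C S \<Phi> A) \<subseteq> Cof A) \<and>
     (\<forall>f\<in>Arr S. preserves_weqs_between C (Cof (Dom S f)) (W (Dom S f))
        (Cof (Cod S f)) (W (Cod S f)) (push C S \<Phi> \<kappa> f))"

definition fibrant_replacement ::
  "('o, 'a) category \<Rightarrow> ('b, 's) category \<Rightarrow> ('o, 'a, 'b, 's) fmap \<Rightarrow> ('o, 'a, 's) cleavage
    \<Rightarrow> ('b \<Rightarrow> 'a set) \<Rightarrow> ('b \<Rightarrow> ('o, 'a, 'o, 'a) fmap) \<Rightarrow> ('b \<Rightarrow> 'o \<Rightarrow> 'a) \<Rightarrow> ('b \<Rightarrow> 'o set) \<Rightarrow> bool"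
where
  "fibrant_replacement C S \<Phi> \<kappa> W R \<rho> Fib \<longleftrightarrow>
     (\<forall>A\<in>Obj S. Fib A \<subseteq> Obj (fiber C S \<Phi> A) \<and>
        nat_weq (fiber C S \<Phi> A) (fiber C S \<Phi> A) (W A) id_fmap (R A) (\<rho> A) \<and>
        FObj (R A) ` Obj (fiber C S \<Phi> A) \<subseteq> Fib A) \<and>
     (\<forall>f\<in>Arr S. preserves_weqs_between C (Fib (Cod S f)) (W (Cod S f))
        (Fib (Dom S f)) (W (Dom S f)) (pull C S \<Phi> \<kappa> f))"

text \<open>
  \<open>f\<^sub>!\<close> has the left derived functor \<open>f\<^sub>!Q\<close>, with comparison map \<open>f\<^sub>!\<theta> : f\<^sub>!Q X \<rightarrow> f\<^sub>!X\<close>;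
  \<open>f\<^sup>*\<close> has the right derived functor \<open>f\<^sup>*R\<close>, with comparison map \<open>f\<^sup>*\<rho> : f\<^sup>*X \<rightarrow> f\<^sup>*R X\<close>.
\<close>

definition derivable_push ::
  "('o, 'a) category \<Rightarrow> ('b, 's) category \<Rightarrow> ('o, 'a, 'b, 's) fmap \<Rightarrow> ('o, 'a, 's) cleavage
    \<Rightarrow> ('b \<Rightarrow> 'a set) \<Rightarrow> ('b \<Rightarrow> 'o \<Rightarrow> 'a) \<Rightarrow> 's \<Rightarrow> ('o, 'a) derivable" where
  "derivable_push C S \<Phi> \<kappa> W \<theta> f =
     \<lparr>Source = fiber C S \<Phi> (Dom S f), SourceW = W (Dom S f), TargetW = W (Cod S f),
      Fun = push C S \<Phi> \<kappa> f,
      Comparison = \<lambda>X. FArr (push C S \<Phi> \<kappa> f) (\<theta> (Dom S f) X)\<rparr>"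

definition derivable_pull ::
  "('o, 'a) category \<Rightarrow> ('b, 's) category \<Rightarrow> ('o, 'a, 'b, 's) fmap \<Rightarrow> ('o, 'a, 's) cleavage
    \<Rightarrow> ('b \<Rightarrow> 'a set) \<Rightarrow> ('b \<Rightarrow> 'o \<Rightarrow> 'a) \<Rightarrow> 's \<Rightarrow> ('o, 'a) derivable" where
  "derivable_pull C S \<Phi> \<kappa> W \<rho> f =
     \<lparr>Source = fiber C S \<Phi> (Cod S f), SourceW = W (Cod S f), TargetW = W (Dom S f),
      Fun = pull C S \<Phi> \<kappa> f,
      Comparison = \<lambda>X. FArr (pull C S \<Phi> \<kappa> f) (\<rho> (Cod S f) X)\<rparr>"

definition homotopy_beck_chevalley ::
  "('o, 'a) category \<Rightarrow> ('b, 's) category \<Rightarrow> ('o, 'a, 'b, 's) fmap \<Rightarrow> ('o, 'a, 's) cleavage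
    \<Rightarrow> ('b \<Rightarrow> 'a set) \<Rightarrow> ('b \<Rightarrow> 'o \<Rightarrow> 'a) \<Rightarrow> ('b \<Rightarrow> 'o \<Rightarrow> 'a) \<Rightarrow> 's square set \<Rightarrow> bool" where
  "homotopy_beck_chevalley C S \<Phi> \<kappa> W \<theta> \<rho> HBC \<longleftrightarrow>
     (\<forall>(g, f, p, q)\<in>HBC.
        commuting_square S (g, f, p, q) \<and>
        beck_chevalley C S \<Phi> \<kappa> (g, f, p, q) \<and>
        coherently_deformable_pair
          [derivable_pull C S \<Phi> \<kappa> W \<rho> g, derivable_push C S \<Phi> \<kappa> W \<theta> f]
          [derivable_push C S \<Phi> \<kappa> W \<theta> p, derivable_pull C S \<Phi> \<kappa> W \<rho> q])"

definition bi_deformable ::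
  "('o, 'a) category \<Rightarrow> ('b, 's) category \<Rightarrow> ('o, 'a, 'b, 's) fmap \<Rightarrow> ('o, 'a, 's) cleavage
    \<Rightarrow> ('b \<Rightarrow> 'a set) \<Rightarrow> 's square set \<Rightarrow> bool" where
  "bi_deformable C S \<Phi> \<kappa> W HBC \<longleftrightarrow>
     (\<exists>Q \<theta> Cof R \<rho> Fib.
        cofibrant_replacement C S \<Phi> \<kappa> W Q \<theta> Cof \<and>
        fibrant_replacement C S \<Phi> \<kappa> W R \<rho> Fib \<and>
        homotopy_beck_chevalley C S \<Phi> \<kappa> W \<theta> \<rho> HBC)"


section \<open>The homotopy category of a bifibration\<close>

definition all_weqs :: "('b, 's) category \<Rightarrow> ('b \<Rightarrow> 'a set) \<Rightarrow> 'a set" where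
  "all_weqs S W = (\<Union>A\<in>Obj S. W A)"

definition Ho_total ::
  "('o, 'a) category \<Rightarrow> ('b, 's) category \<Rightarrow> ('b \<Rightarrow> 'a set) \<Rightarrow> ('o, ('o, 'a) zigzag set) category"
where
  "Ho_total C S W = Ho C (all_weqs S W)"

definition Ho_proj ::
  "('o, 'a) category \<Rightarrow> ('b, 's) category \<Rightarrow> ('o, 'a, 'b, 's) fmap
    \<Rightarrow> ('o, ('o, 'a) zigzag set, 'b, 's) fmap" where
  "Ho_proj C S \<Phi> = Ho_lift C S \<Phi>"

text \<open>
  The functor from the homotopy category of the fiber over \<open>A\<close> to \<open>Ho_total\<close> induced by the
  inclusion of the fiber into \<open>C\<close> followed by the localization functor of \<open>C\<close>.
\<close>

definition Ho_fiber_comparison ::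
  "('o, 'a) category \<Rightarrow> ('b, 's) category \<Rightarrow> ('o, 'a, 'b, 's) fmap \<Rightarrow> ('b \<Rightarrow> 'a set) \<Rightarrow> 'b
    \<Rightarrow> ('o, ('o, 'a) zigzag set, 'o, ('o, 'a) zigzag set) fmap" where
  "Ho_fiber_comparison C S \<Phi> W A =
     Ho_lift (fiber C S \<Phi> A) (Ho_total C S W) (comp_fmap (Ho_loc C (all_weqs S W)) id_fmap)"

end

theory Submission
  imports Defs
begin

text \<open>
  Fix an object \<open>Z\<close> over \<open>D\<close>. The pairs of an arrow \<open>k : \<Phi> X \<rightarrow> D\<close> and an arrow
  \<open>k\<^sub>! Q X \<rightarrow> Z\<close> of \<open>Ho (\<C>\<^sup>D)\<close> form a presheaf in \<open>X \<in> \<C>\<close> that sends weak equivalences to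
  bijections, so it extends to \<open>Ho \<C>\<close>. The pair of the identity and the counit at \<open>Z\<close> is a universal element:
  every arrow \<open>X \<rightarrow> Z\<close> of \<open>Ho \<C>\<close> over \<open>k\<close> is, for a unique arrow \<open>g : k\<^sub>! Q X \<rightarrow> Z\<close> of
  \<open>Ho (\<C>\<^sup>D)\<close>, the composite \<open>X \<leftarrow> Q X \<rightarrow> k\<^sub>! Q X \<rightarrow> Z\<close>. For identities \<open>k\<close> this identifies the fibers,
  and in general it makes \<open>X \<leftarrow> Q X \<rightarrow> k\<^sub>! Q X\<close> cocartesian in \<open>Ho \<C>\<close>. Cartesian arrows are obtained by
  passing to opposite categories.

  The Beck-Chevalley map is the only arrow over an identity that completes a diagram of two
  cartesian and two cocartesian arrows, so up to isomorphism it does not depend on the choice of these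
  arrows. At an object of the subcategory \<open>\<A>\<^sub>0\<close> of a coherent deformation all four arrows may be taken
  from \<open>\<C>\<close>, where the map is invertible; and every object is isomorphic in \<open>Ho \<C>\<close> to one of \<open>\<A>\<^sub>0\<close>.
\<close>

section \<open>Categories and inverses\<close>

text \<open>Zigzags may be arbitrarily long and pass through many fibers, and no calculus of
  fractions is at hand. A presheaf avoids this: only single arrows have to act, and weak
  equivalences bijectively. The obstacle is an arrow \<open>u : X -> X'\<close> that is not
  vertical: \<open>Q\<close> is a functor on each fiber separately, so there is no arrow
  \<open>Q u\<close>. Instead \<open>Q X -> X -> X'\<close> is factored as
  \<open>Q X -> Y -> X'\<close> with \<open>Y\<close> the pushforward of \<open>Q X\<close> along
  \<Phi> u. The second arrow is vertical, so \<open>Q\<close> applies to it, but gives an arrow out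
  of \<open>Q Y\<close>. The gap closes because \<open>Y\<close> is again cofibrant:
  \<open>k_!\<close> keeps \<open>Q Y -> Y\<close> a weak equivalence, which may be inverted. This
  is why pushforwards have to preserve cofibrant objects as well as weak equivalences between them.
  The unit law of this action needs the two natural arrows \<open>Q Q X -> Q X\<close> to agree,
  which is shown only after pushing forward and localizing. Since the second components live in the
  homotopy category of a fiber, the presheaf also detects which arrows of that category become equal
  in the total one; hence the fiber comparison is injective on arrows.\<close>

lemma hom_iff [simp]: "u \<in> hom C X Y \<longleftrightarrow> u \<in> Arr C \<and> Dom C u = X \<and> Cod C u = Y"
  by (simp add: hom_def)

context
  fixes C :: "('o, 'a) category" (structure)
  assumes cat: "is_category C"
begin

lemma Dom_Obj [simp]: "u \<in> Arr C \<Longrightarrow> Dom C u \<in> Obj C"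
  and Cod_Obj [simp]: "u \<in> Arr C \<Longrightarrow> Cod C u \<in> Obj C"
  and Idt_Arr [simp]: "X \<in> Obj C \<Longrightarrow> Idt C X \<in> Arr C"
  and Dom_Idt [simp]: "X \<in> Obj C \<Longrightarrow> Dom C (Idt C X) = X"
  and Cod_Idt [simp]: "X \<in> Obj C \<Longrightarrow> Cod C (Idt C X) = X"
  and Comp_Arr [simp]: "u \<in> Arr C \<Longrightarrow> v \<in> Arr C \<Longrightarrow> Cod C u = Dom C v \<Longrightarrow> v \<cdot> u \<in> Arr C"
  and Dom_Comp [simp]: "u \<in> Arr C \<Longrightarrow> v \<in> Arr C \<Longrightarrow> Cod C u = Dom C v \<Longrightarrow> Dom C (v \<cdot> u) = Dom C u"
  and Cod_Comp [simp]: "u \<in> Arr C \<Longrightarrow> v \<in> Arr C \<Longrightarrow> Cod C u = Dom C v \<Longrightarrow> Cod C (v \<cdot> u) = Cod C v"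
  and Comp_Idt [simp]: "u \<in> Arr C \<Longrightarrow> Dom C u = X \<Longrightarrow> u \<cdot> Idt C X = u"
  and Idt_Comp [simp]: "u \<in> Arr C \<Longrightarrow> Cod C u = Y \<Longrightarrow> Idt C Y \<cdot> u = u"
  and Comp_assoc: "u \<in> Arr C \<Longrightarrow> v \<in> Arr C \<Longrightarrow> w \<in> Arr C \<Longrightarrow> Cod C u = Dom C v \<Longrightarrow> Cod C v = Dom C w \<Longrightarrow>
    (w \<cdot> v) \<cdot> u = w \<cdot> (v \<cdot> u)"
  using cat unfolding is_category_def by auto

lemma inverse_arrows_unique:
  assumes "inverse_arrows C u v" "inverse_arrows C u v'"
  shows "v = v'"
proof -
  have "(v \<cdot> u) \<cdot> v' = v \<cdot> (u \<cdot> v')"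
    using assms by (intro Comp_assoc) (auto simp: inverse_arrows_def)
  then show ?thesis
    using assms by (simp add: inverse_arrows_def)
qed

lemma inv_arrow_eq: "inverse_arrows C u v \<Longrightarrow> inv_arrow C u = v"
  unfolding inv_arrow_def using inverse_arrows_unique by blast

lemma inverse_inv_arrow: "is_iso C u \<Longrightarrow> inverse_arrows C u (inv_arrow C u)"
  unfolding is_iso_def using inv_arrow_eq by blast

lemma is_iso_Arr: "is_iso C u \<Longrightarrow> u \<in> Arr C"
  unfolding is_iso_def inverse_arrows_def by blast

lemma inv_Arr [simp]: "is_iso C u \<Longrightarrow> inv_arrow C u \<in> Arr C"
  and Dom_inv [simp]: "is_iso C u \<Longrightarrow> Dom C (inv_arrow C u) = Cod C u"
  and Cod_inv [simp]: "is_iso C u \<Longrightarrow> Cod C (inv_arrow C u) = Dom C u"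
  and Comp_inv [simp]: "is_iso C u \<Longrightarrow> u \<cdot> inv_arrow C u = Idt C (Cod C u)"
  and inv_Comp [simp]: "is_iso C u \<Longrightarrow> inv_arrow C u \<cdot> u = Idt C (Dom C u)"
  using inverse_inv_arrow[of u] unfolding inverse_arrows_def by auto

lemma Comp_inv_Comp [simp]:
  assumes "is_iso C u" "x \<in> Arr C" "Cod C x = Cod C u"
  shows "u \<cdot> (inv_arrow C u \<cdot> x) = x"
  using assms by (simp add: Comp_assoc[symmetric] is_iso_Arr)

lemma inv_Comp_Comp [simp]:
  assumes "is_iso C u" "x \<in> Arr C" "Cod C x = Dom C u"
  shows "inv_arrow C u \<cdot> (u \<cdot> x) = x"
  using assms by (simp add: Comp_assoc[symmetric] is_iso_Arr)

lemma inverse_arrows_iso: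
  "inverse_arrows C u v \<Longrightarrow> is_iso C u" "inverse_arrows C u v \<Longrightarrow> is_iso C v"
  unfolding is_iso_def inverse_arrows_def by auto

lemma is_iso_inv [simp]: "is_iso C u \<Longrightarrow> is_iso C (inv_arrow C u)"
  using inverse_inv_arrow inverse_arrows_iso by blast

lemma inverse_arrows_Idt: "X \<in> Obj C \<Longrightarrow> inverse_arrows C (Idt C X) (Idt C X)"
  by (auto simp: inverse_arrows_def)

lemma is_iso_Idt [simp]: "X \<in> Obj C \<Longrightarrow> is_iso C (Idt C X)"
  and inv_Idt [simp]: "X \<in> Obj C \<Longrightarrow> inv_arrow C (Idt C X) = Idt C X"
  using inverse_arrows_Idt inverse_arrows_iso inv_arrow_eq by blast+

lemma is_iso_Comp [simp]:
  assumes "is_iso C u" "is_iso C v" "Cod C u = Dom C v"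
  shows "is_iso C (v \<cdot> u)"
proof -
  have "inverse_arrows C (v \<cdot> u) (inv_arrow C u \<cdot> inv_arrow C v)"
    unfolding inverse_arrows_def using assms by (auto simp: is_iso_Arr Comp_assoc)
  then show ?thesis unfolding is_iso_def by blast
qed

lemma Comp_iso_cancel:
  assumes "x \<cdot> u = y \<cdot> u" "is_iso C u" "x \<in> Arr C" "y \<in> Arr C" "Dom C x = Cod C u" "Dom C y = Cod C u"
  shows "x = y"
proof -
  have "(x \<cdot> u) \<cdot> inv_arrow C u = (y \<cdot> u) \<cdot> inv_arrow C u" using assms(1) by simp
  then show ?thesis using assms(2-) by (simp add: is_iso_Arr Comp_assoc)
qed

lemma iso_Comp_cancel:
  assumes "u \<cdot> x = u \<cdot> y" "is_iso C u" "x \<in> Arr C" "y \<in> Arr C" "Cod C x = Dom C u" "Cod C y = Dom C u"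
  shows "x = y"
  using assms inv_Comp_Comp by metis

lemma iso_square:
  assumes eq: "a \<cdot> x = y \<cdot> b" and iso: "is_iso C a" "is_iso C b"
    and arr: "x \<in> Arr C" "y \<in> Arr C" "Dom C x = Dom C b" "Dom C y = Cod C b" "Cod C x = Dom C a" "Cod C y = Cod C a"
  shows "x \<cdot> inv_arrow C b = inv_arrow C a \<cdot> y"
proof -
  have "a \<cdot> (x \<cdot> inv_arrow C b) = (a \<cdot> x) \<cdot> inv_arrow C b"
    using iso arr by (simp add: is_iso_Arr Comp_assoc)
  also have "\<dots> = y"
    unfolding eq using iso arr by (simp add: is_iso_Arr Comp_assoc)
  finally show ?thesis
    using iso arr inv_Comp_Comp[of a "x \<cdot> inv_arrow C b"] by (simp add: is_iso_Arr)
qed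

lemma is_iso_if_Comp_iso:
  assumes eq: "b \<cdot> m = n" and iso: "is_iso C m" "is_iso C n"
    and arr: "b \<in> Arr C" "Dom C b = Cod C m"
  shows "is_iso C b"
proof -
  have "b = (b \<cdot> m) \<cdot> inv_arrow C m" using iso arr by (simp add: is_iso_Arr Comp_assoc)
  also have "\<dots> = n \<cdot> inv_arrow C m" by (simp add: eq)
  finally have "b = n \<cdot> inv_arrow C m" .
  moreover have "Dom C n = Dom C m" using eq iso arr by (metis Dom_Comp is_iso_Arr)
  ultimately show ?thesis using iso by simp
qed

end

context
  fixes C :: "('o, 'a) category" and D :: "('p, 'b) category" and F :: "('o, 'a, 'p, 'b) fmap"
  assumes F: "is_functor C D F"
begin

lemma functor_source: "is_category C" and functor_target: "is_category D"
  and functor_Obj: "X \<in> Obj C \<Longrightarrow> FObj F X \<in> Obj D"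
  and functor_Idt: "X \<in> Obj C \<Longrightarrow> FArr F (Idt C X) = Idt D (FObj F X)"
  and functor_Arr: "u \<in> Arr C \<Longrightarrow> FArr F u \<in> Arr D"
  and functor_Dom: "u \<in> Arr C \<Longrightarrow> Dom D (FArr F u) = FObj F (Dom C u)"
  and functor_Cod: "u \<in> Arr C \<Longrightarrow> Cod D (FArr F u) = FObj F (Cod C u)"
  and functor_Comp: "u \<in> Arr C \<Longrightarrow> v \<in> Arr C \<Longrightarrow> Cod C u = Dom C v \<Longrightarrow>
    FArr F (v \<cdot>\<^bsub>C\<^esub> u) = FArr F v \<cdot>\<^bsub>D\<^esub> FArr F u"
  using F unfolding is_functor_def by auto

lemmas functor_simps = functor_source functor_target functor_Obj functor_Idt functor_Arr
  functor_Dom functor_Cod functor_Comp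

lemma functor_inverse_arrows:
  assumes "inverse_arrows C u v"
  shows "inverse_arrows D (FArr F u) (FArr F v)"
  using assms functor_Comp[of u v] functor_Comp[of v u]
  by (auto simp: inverse_arrows_def functor_simps)

lemma functor_is_iso: "is_iso C u \<Longrightarrow> is_iso D (FArr F u)"
  using functor_inverse_arrows unfolding is_iso_def by blast

lemma functor_inv: "is_iso C u \<Longrightarrow> FArr F (inv_arrow C u) = inv_arrow D (FArr F u)"
  using functor_inverse_arrows inverse_inv_arrow inv_arrow_eq functor_source functor_target by metis

end


section \<open>Zigzag classes and the localization\<close>

definition zclass :: "('o, 'a) category \<Rightarrow> 'a set \<Rightarrow> 'o \<Rightarrow> 'a step list \<Rightarrow> 'o \<Rightarrow> ('o, 'a) zigzag set" where
  "zclass C W X us Y = zigzag_eq C W `` {(X, us, Y)}"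

abbreviation loc :: "('o, 'a) category \<Rightarrow> 'a set \<Rightarrow> 'a \<Rightarrow> ('o, 'a) zigzag set" where
  "loc C W u \<equiv> FArr (Ho_loc C W) u"

lemma zigzag_eq_zigzags: "(z, z') \<in> zigzag_eq C W \<Longrightarrow> z \<in> zigzags C W \<and> z' \<in> zigzags C W"
  by (induction rule: zigzag_eq.induct) auto

lemma zigzag_eq_ends: "(z, z') \<in> zigzag_eq C W \<Longrightarrow> fst z = fst z' \<and> snd (snd z) = snd (snd z')"
  by (induction rule: zigzag_eq.induct) auto

lemma equiv_zigzag_eq: "equiv (zigzags C W) (zigzag_eq C W)"
proof (rule equivI)
  show "zigzag_eq C W \<subseteq> zigzags C W \<times> zigzags C W" using zigzag_eq_zigzags by fastforce
  show "refl_on (zigzags C W) (zigzag_eq C W)" by (auto intro: refl_onI zz_refl)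
  show "sym (zigzag_eq C W)" by (auto intro: symI zz_sym)
  show "trans (zigzag_eq C W)" by (auto intro: transI zz_trans)
qed

lemma zclass_eqI: "((X, us, Y), (X', us', Y')) \<in> zigzag_eq C W \<Longrightarrow> zclass C W X us Y = zclass C W X' us' Y'"
  unfolding zclass_def using equiv_class_eq[OF equiv_zigzag_eq] by fast

lemma in_zclass: "is_zigzag C W X us Y \<Longrightarrow> (X, us, Y) \<in> zclass C W X us Y"
  unfolding zclass_def by (auto intro!: zz_refl simp: zigzags_def)

lemma in_zclassD:
  assumes "(X', us', Y') \<in> zclass C W X us Y"
  shows "((X, us, Y), (X', us', Y')) \<in> zigzag_eq C W" "X' = X" "Y' = Y" "is_zigzag C W X us' Y"
  using assms zigzag_eq_ends[of "(X, us, Y)" "(X', us', Y')"]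
    zigzag_eq_zigzags[of "(X, us, Y)" "(X', us', Y')"] unfolding zclass_def zigzags_def by auto

context
  fixes C :: "('o, 'a) category" and W :: "'a set"
  assumes cat: "is_category C"
begin

lemma is_zigzag_Obj: "is_zigzag C W X us Y \<Longrightarrow> X \<in> Obj C \<and> Y \<in> Obj C"
proof (induction us arbitrary: X)
  case (Cons s us)
  then show ?case using cat by (cases s) auto
qed auto

lemma is_zigzag_append:
  "is_zigzag C W X (us @ vs) Y \<longleftrightarrow> (\<exists>Z. is_zigzag C W X us Z \<and> is_zigzag C W Z vs Y)"
  by (induction us arbitrary: X) (use is_zigzag_Obj in auto)

lemma zigzag_eq_append_right:
  "(z, z') \<in> zigzag_eq C W \<Longrightarrow> is_zigzag C W (snd (snd z)) vs Z \<Longrightarrow>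
    ((fst z, fst (snd z) @ vs, Z), (fst z', fst (snd z') @ vs, Z)) \<in> zigzag_eq C W"
proof (induction rule: zigzag_eq.induct)
  case (zz_red us us' X as bs Y)
  then show ?case
    using zigzag_eq.zz_red[of C W us us' X as "bs @ vs" Z] is_zigzag_append[of X "as @ us @ bs" vs Z]
      is_zigzag_append[of X "as @ us' @ bs" vs Z]
    by (auto simp: zigzags_def)
next
  case (zz_refl z)
  then show ?case
    by (cases z) (auto intro!: zigzag_eq.zz_refl simp: zigzags_def is_zigzag_append)
next
  case (zz_sym z z')
  then show ?case using zigzag_eq_ends[OF zz_sym(1)] by (auto intro: zigzag_eq.zz_sym)
next
  case (zz_trans z z' z'')
  then show ?case using zigzag_eq_ends[OF zz_trans(1)] by (auto intro: zigzag_eq.zz_trans)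
qed

lemma zigzag_eq_append_left:
  "(z, z') \<in> zigzag_eq C W \<Longrightarrow> is_zigzag C W X vs (fst z) \<Longrightarrow>
    ((X, vs @ fst (snd z), snd (snd z)), (X, vs @ fst (snd z'), snd (snd z'))) \<in> zigzag_eq C W"
proof (induction rule: zigzag_eq.induct)
  case (zz_red us us' X' as bs Y)
  then show ?case
    using zigzag_eq.zz_red[of C W us us' X "vs @ as" bs Y] is_zigzag_append[of X vs "as @ us @ bs" Y]
      is_zigzag_append[of X vs "as @ us' @ bs" Y]
    by (auto simp: zigzags_def)
next
  case (zz_refl z)
  then show ?case
    by (cases z) (auto intro!: zigzag_eq.zz_refl simp: zigzags_def is_zigzag_append)
next
  case (zz_sym z z')
  then show ?case using zigzag_eq_ends[OF zz_sym(1)] by (auto intro: zigzag_eq.zz_sym)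
next
  case (zz_trans z z' z'')
  then show ?case using zigzag_eq_ends[OF zz_trans(1)] by (auto intro: zigzag_eq.zz_trans)
qed

lemma Ho_Arr_iff: "K \<in> Arr (Ho C W) \<longleftrightarrow> (\<exists>X us Y. is_zigzag C W X us Y \<and> K = zclass C W X us Y)"
  by (auto simp: Ho_def zclass_def quotient_def zigzags_def)

lemma Ho_Obj [simp]: "Obj (Ho C W) = Obj C"
  by (simp add: Ho_def)

lemma Idt_Ho: "Idt (Ho C W) X = zclass C W X [] X"
  by (simp add: Ho_def zclass_def)

context
  fixes X us Y assumes z: "is_zigzag C W X us Y"
begin

lemma zclass_Arr: "zclass C W X us Y \<in> Arr (Ho C W)"
  using z Ho_Arr_iff by blast

lemma Dom_zclass: "Dom (Ho C W) (zclass C W X us Y) = X"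
  unfolding Ho_def using in_zclass[OF z] in_zclassD(2) by (auto intro!: the_equality)

lemma Cod_zclass: "Cod (Ho C W) (zclass C W X us Y) = Y"
  unfolding Ho_def using in_zclass[OF z] in_zclassD(3) by (auto intro!: the_equality)

end

lemma Ho_ArrE:
  assumes "K \<in> Arr (Ho C W)"
  obtains X us Y where "is_zigzag C W X us Y" "K = zclass C W X us Y"
  using assms that unfolding Ho_Arr_iff by blast

lemma Ho_DomE:
  assumes "K \<in> Arr (Ho C W)" "Dom (Ho C W) K = X"
  obtains us Y where "is_zigzag C W X us Y" "K = zclass C W X us Y"
proof -
  obtain X' us Y where us: "is_zigzag C W X' us Y" and K: "K = zclass C W X' us Y"
    using assms(1) by (rule Ho_ArrE)
  then have "X' = X" using Dom_zclass[OF us] assms(2) by simp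
  then show ?thesis using us K that by simp
qed

text \<open>Composition in \<open>Ho\<close> collects the concatenations of all composable
  representatives. Replacing first the left and then the right factor shows that they lie in one
  class, so any two representatives compute the composite.\<close>

lemma Comp_zclass:
  assumes u: "is_zigzag C W X us Y" and v: "is_zigzag C W Y vs Z"
  shows "zclass C W Y vs Z \<cdot>\<^bsub>Ho C W\<^esub> zclass C W X us Y = zclass C W X (us @ vs) Z"
proof -
  let ?T = "{(X', us' @ vs', Z') | X' us' Y' vs' Z'.
    (X', us', Y') \<in> zclass C W X us Y \<and> (Y', vs', Z') \<in> zclass C W Y vs Z}"
  have eq: "(z, z') \<in> zigzag_eq C W" if "z \<in> ?T" "z' = (X, us @ vs, Z)" for z z'
  proof -
    from that(1) obtain X' us' Y' vs' Z' where "z = (X', us' @ vs', Z')"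
      "(X', us', Y') \<in> zclass C W X us Y" "(Y', vs', Z') \<in> zclass C W Y vs Z"
      by blast
    then have z: "z = (X, us' @ vs', Z)" and u': "(X, us', Y) \<in> zclass C W X us Y"
      and v': "(Y, vs', Z) \<in> zclass C W Y vs Z"
      using in_zclassD(2,3) by fast+
    have "((X, us @ vs, Z), (X, us' @ vs, Z)) \<in> zigzag_eq C W"
      using zigzag_eq_append_right[OF in_zclassD(1)[OF u']] v by simp
    moreover have "((X, us' @ vs, Z), (X, us' @ vs', Z)) \<in> zigzag_eq C W"
      using zigzag_eq_append_left[OF in_zclassD(1)[OF v'], of X us'] in_zclassD(4)[OF u'] by simp
    ultimately show ?thesis unfolding z that(2) by (rule zz_sym[OF zz_trans])
  qed
  have "(X, us @ vs, Z) \<in> ?T" using in_zclass[OF u] in_zclass[OF v] by blast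
  then have "zclass C W X (us @ vs) Z \<subseteq> zigzag_eq C W `` ?T"
    unfolding zclass_def by blast
  moreover have "zigzag_eq C W `` ?T \<subseteq> zclass C W X (us @ vs) Z"
  proof
    fix y assume "y \<in> zigzag_eq C W `` ?T"
    then obtain z where z: "z \<in> ?T" "(z, y) \<in> zigzag_eq C W" by (rule ImageE)
    have "((X, us @ vs, Z), y) \<in> zigzag_eq C W"
      using zz_trans[OF zz_sym[OF eq[OF z(1) refl]] z(2)] .
    then show "y \<in> zclass C W X (us @ vs) Z" unfolding zclass_def by simp
  qed
  ultimately have "zigzag_eq C W `` ?T = zclass C W X (us @ vs) Z" by (rule subset_antisym[rotated])
  then show ?thesis by (simp add: Ho_def)
qed

lemma is_category_Ho [simp]: "is_category (Ho C W)"
proof -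
  let ?H = "Ho C W"
  have arr: "Dom ?H K \<in> Obj C \<and> Cod ?H K \<in> Obj C" if "K \<in> Arr ?H" for K
    using that is_zigzag_Obj by (auto simp: Ho_Arr_iff Dom_zclass Cod_zclass)
  have idt: "Idt ?H X \<in> hom ?H X X" if "X \<in> Obj C" for X
    using that by (simp add: Idt_Ho zclass_Arr Dom_zclass Cod_zclass)
  have comp: "L \<cdot>\<^bsub>?H\<^esub> K \<in> hom ?H (Dom ?H K) (Cod ?H L)"
    if KL: "K \<in> Arr ?H" "L \<in> Arr ?H" "Cod ?H K = Dom ?H L" for K L
  proof -
    obtain X us Y where us: "is_zigzag C W X us Y" and K: "K = zclass C W X us Y"
      using KL(1) by (rule Ho_ArrE)
    have "Dom ?H L = Y" using KL(3) K Cod_zclass[OF us] by simp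
    with KL(2) obtain vs Z where vs: "is_zigzag C W Y vs Z" and L: "L = zclass C W Y vs Z"
      by (rule Ho_DomE)
    have "is_zigzag C W X (us @ vs) Z" using us vs is_zigzag_append by blast
    then show ?thesis
      using us vs by (simp add: K L Comp_zclass zclass_Arr Dom_zclass Cod_zclass)
  qed
  have unit: "K \<cdot>\<^bsub>?H\<^esub> Idt ?H (Dom ?H K) = K \<and> Idt ?H (Cod ?H K) \<cdot>\<^bsub>?H\<^esub> K = K" if "K \<in> Arr ?H" for K
  proof -
    obtain X us Y where us: "is_zigzag C W X us Y" and K: "K = zclass C W X us Y"
      by (rule Ho_ArrE[OF \<open>K \<in> Arr ?H\<close>])
    have "is_zigzag C W X [] X" "is_zigzag C W Y [] Y" using is_zigzag_Obj[OF us] by auto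
    then show ?thesis
      unfolding K Dom_zclass[OF us] Cod_zclass[OF us] Idt_Ho
      using Comp_zclass[OF _ us, of X "[]"] Comp_zclass[OF us, of "[]" Y] by auto
  qed
  have assoc: "(M \<cdot>\<^bsub>?H\<^esub> L) \<cdot>\<^bsub>?H\<^esub> K = M \<cdot>\<^bsub>?H\<^esub> (L \<cdot>\<^bsub>?H\<^esub> K)"
    if KLM: "K \<in> Arr ?H" "L \<in> Arr ?H" "M \<in> Arr ?H" "Cod ?H K = Dom ?H L" "Cod ?H L = Dom ?H M" for K L M
  proof -
    obtain X us Y where us: "is_zigzag C W X us Y" and K: "K = zclass C W X us Y"
      using KLM(1) by (rule Ho_ArrE)
    have "Dom ?H L = Y" using KLM(4) K Cod_zclass[OF us] by simp
    with KLM(2) obtain vs Z where vs: "is_zigzag C W Y vs Z" and L: "L = zclass C W Y vs Z"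
      by (rule Ho_DomE)
    have "Dom ?H M = Z" using KLM(5) L Cod_zclass[OF vs] by simp
    with KLM(3) obtain ws V where ws: "is_zigzag C W Z ws V" and M: "M = zclass C W Z ws V"
      by (rule Ho_DomE)
    have "is_zigzag C W X (us @ vs) Z" "is_zigzag C W Y (vs @ ws) V"
      using us vs ws is_zigzag_append by blast+
    then show ?thesis using us vs ws K L M by (simp add: Comp_zclass)
  qed
  show ?thesis unfolding is_category_def using arr idt comp unit assoc by auto
qed

lemma loc_eq: "loc C W u = zclass C W (Dom C u) [Fwd u] (Cod C u)"
  by (simp add: Ho_loc_def zclass_def)

lemma FObj_Ho_loc [simp]: "FObj (Ho_loc C W) X = X"
  by (simp add: Ho_loc_def)

lemma is_functor_Ho_loc: "is_functor C (Ho C W) (Ho_loc C W)"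
proof -
  have 1: "is_zigzag C W (Dom C u) [Fwd u] (Cod C u)" if "u \<in> Arr C" for u
    using that cat by simp
  have 2: "loc C W (Idt C X) = Idt (Ho C W) X" if "X \<in> Obj C" for X
    unfolding loc_eq Idt_Ho using that cat zigzag_eq.zz_red[OF red_id[OF that, of W], of X "[]" "[]" X]
    by (auto simp: zigzags_def intro!: zclass_eqI)
  have 3: "loc C W (v \<cdot>\<^bsub>C\<^esub> u) = loc C W v \<cdot>\<^bsub>Ho C W\<^esub> loc C W u"
    if "u \<in> Arr C" "v \<in> Arr C" "Cod C u = Dom C v" for u v
  proof -
    have "loc C W v \<cdot>\<^bsub>Ho C W\<^esub> loc C W u = zclass C W (Dom C u) [Fwd u, Fwd v] (Cod C v)"
      unfolding loc_eq using that 1 Comp_zclass[OF 1[OF that(1)], of "[Fwd v]" "Cod C v"] by simp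
    also have "\<dots> = loc C W (v \<cdot>\<^bsub>C\<^esub> u)"
      unfolding loc_eq
      using that cat zigzag_eq.zz_red[OF red_comp[OF that, of W], of "Dom C u" "[]" "[]" "Cod C v"]
      by (auto simp: zigzags_def intro!: zclass_eqI)
    finally show ?thesis by simp
  qed
  show ?thesis unfolding is_functor_def using cat 1 2 3
    by (auto simp: loc_eq zclass_Arr Dom_zclass Cod_zclass)
qed

lemmas loc_simps [simp] = functor_Arr[OF is_functor_Ho_loc]
  functor_Dom[OF is_functor_Ho_loc, simplified FObj_Ho_loc]
  functor_Cod[OF is_functor_Ho_loc, simplified FObj_Ho_loc]
  functor_Idt[OF is_functor_Ho_loc, simplified FObj_Ho_loc]
lemmas loc_Comp = functor_Comp[OF is_functor_Ho_loc]

lemma inverse_arrows_loc: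
  assumes w: "w \<in> Arr C" "w \<in> W"
  shows "inverse_arrows (Ho C W) (loc C W w) (zclass C W (Cod C w) [Bwd w] (Dom C w))"
proof -
  have z: "is_zigzag C W (Dom C w) [Fwd w] (Cod C w)" "is_zigzag C W (Cod C w) [Bwd w] (Dom C w)"
    using w cat by auto
  have "zclass C W (Cod C w) [Bwd w] (Dom C w) \<cdot>\<^bsub>Ho C W\<^esub> loc C W w = Idt (Ho C W) (Dom C w)"
    unfolding loc_eq Comp_zclass[OF z] Idt_Ho
    using w cat zigzag_eq.zz_red[OF red_fwd_bwd[OF w], of "Dom C w" "[]" "[]" "Dom C w"]
    by (auto simp: zigzags_def intro!: zclass_eqI)
  moreover have "loc C W w \<cdot>\<^bsub>Ho C W\<^esub> zclass C W (Cod C w) [Bwd w] (Dom C w) = Idt (Ho C W) (Cod C w)"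
    unfolding loc_eq Comp_zclass[OF z(2) z(1)] Idt_Ho
    using w cat zigzag_eq.zz_red[OF red_bwd_fwd[OF w], of "Cod C w" "[]" "[]" "Cod C w"]
    by (auto simp: zigzags_def intro!: zclass_eqI)
  ultimately show ?thesis
    using z w by (simp add: inverse_arrows_def zclass_Arr Dom_zclass Cod_zclass)
qed

lemma is_iso_loc: "w \<in> Arr C \<Longrightarrow> w \<in> W \<Longrightarrow> is_iso (Ho C W) (loc C W w)"
  using inverse_arrows_loc unfolding is_iso_def by blast

lemma zclass_Fwd:
  assumes "u \<in> Arr C" "is_zigzag C W (Cod C u) us Y"
  shows "zclass C W (Dom C u) (Fwd u # us) Y = zclass C W (Cod C u) us Y \<cdot>\<^bsub>Ho C W\<^esub> loc C W u"
  using assms cat Comp_zclass[of "Dom C u" "[Fwd u]" "Cod C u" us Y] by (simp add: loc_eq)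

lemma zclass_Bwd:
  assumes "w \<in> Arr C" "w \<in> W" "is_zigzag C W (Dom C w) us Y"
  shows "zclass C W (Cod C w) (Bwd w # us) Y =
    zclass C W (Dom C w) us Y \<cdot>\<^bsub>Ho C W\<^esub> inv_arrow (Ho C W) (loc C W w)"
  using assms cat Comp_zclass[of "Cod C w" "[Bwd w]" "Dom C w" us Y]
    inv_arrow_eq[OF is_category_Ho inverse_arrows_loc[of w]] by simp

text \<open>The zigzag is peeled at its source while the target \<open>Z\<close> stays fixed. This
  is the side on which a presheaf acts, so statements about arrows into \<open>Z\<close> can be
  proved step by step.\<close>

lemma Ho_induct [consumes 2, case_names Idt Fwd Bwd]:
  assumes K: "K \<in> Arr (Ho C W)" "Cod (Ho C W) K = Z"
    and Idt: "Z \<in> Obj C \<Longrightarrow> P (Idt (Ho C W) Z)"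
    and Fwd: "\<And>u K. u \<in> Arr C \<Longrightarrow> K \<in> Arr (Ho C W) \<Longrightarrow> Dom (Ho C W) K = Cod C u \<Longrightarrow> Cod (Ho C W) K = Z \<Longrightarrow>
      P K \<Longrightarrow> P (K \<cdot>\<^bsub>Ho C W\<^esub> loc C W u)"
    and Bwd: "\<And>w K. w \<in> Arr C \<Longrightarrow> w \<in> W \<Longrightarrow> K \<in> Arr (Ho C W) \<Longrightarrow> Dom (Ho C W) K = Dom C w \<Longrightarrow>
      Cod (Ho C W) K = Z \<Longrightarrow> P K \<Longrightarrow> P (K \<cdot>\<^bsub>Ho C W\<^esub> inv_arrow (Ho C W) (loc C W w))"
  shows "P K"
proof -
  have *: "is_zigzag C W X us Z \<Longrightarrow> P (zclass C W X us Z)" for X us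
  proof (induction us arbitrary: X)
    case Nil
    then show ?case using Idt by (auto simp: Idt_Ho)
  next
    case (Cons s us)
    show ?case
    proof (cases s)
      case (Fwd u)
      with Cons show ?thesis
        using assms(4)[of u "zclass C W (Cod C u) us Z"]
        by (auto simp: zclass_Fwd zclass_Arr Dom_zclass Cod_zclass)
    next
      case (Bwd u)
      with Cons show ?thesis
        using assms(5)[of u "zclass C W (Dom C u) us Z"]
        by (auto simp: zclass_Bwd zclass_Arr Dom_zclass Cod_zclass)
    qed
  qed
  obtain X us Y where us: "is_zigzag C W X us Y" and KX: "K = zclass C W X us Y"
    using K(1) by (rule Ho_ArrE)
  have "Y = Z" using K(2) KX Cod_zclass[OF us] by simp
  then show ?thesis using * us KX by simp
qed

end

section \<open>Functors and presheaves on the localization\<close>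

context
  fixes C :: "('o, 'a) category" and D :: "('p, 'b) category" and W :: "'a set"
    and F :: "('o, 'a, 'p, 'b) fmap"
  assumes F: "is_functor C D F" and inverts: "\<And>w. w \<in> Arr C \<Longrightarrow> w \<in> W \<Longrightarrow> is_iso D (FArr F w)"
begin

private lemmas [simp] = functor_simps[OF F] inverts

lemma eval_zigzag_hom:
  "is_zigzag C W X us Y \<Longrightarrow> eval_zigzag C D F X us \<in> hom D (FObj F X) (FObj F Y)"
proof (induction us arbitrary: X)
  case (Cons s us)
  then show ?case by (cases s) auto
qed auto

lemma eval_zigzag_append:
  "is_zigzag C W X us Y \<Longrightarrow> is_zigzag C W Y vs Z \<Longrightarrow>
    eval_zigzag C D F X (us @ vs) = eval_zigzag C D F Y vs \<cdot>\<^bsub>D\<^esub> eval_zigzag C D F X us"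
proof (induction us arbitrary: X)
  case Nil
  then show ?case using eval_zigzag_hom[of Y vs Z] by auto
next
  case (Cons s us)
  then show ?case
    using eval_zigzag_hom[of Y vs Z] eval_zigzag_hom[of "step_tgt C s" us Y]
    by (cases s) (auto simp: Comp_assoc)
qed

lemma eval_zigzag_red:
  assumes "zigzag_red C W us vs" "is_zigzag C W X us Y" "is_zigzag C W X vs Y"
  shows "eval_zigzag C D F X us = eval_zigzag C D F X vs"
  using assms
proof cases
  case (red_comp u v)
  with assms(2) show ?thesis by auto
next
  case (red_id X')
  with assms(2) show ?thesis by auto
next
  case (red_fwd_bwd w)
  with assms(2) show ?thesis by auto
next
  case (red_bwd_fwd w)
  with assms(2) show ?thesis by auto
qed

lemma eval_zigzag_eq:
  "(z, z') \<in> zigzag_eq C W \<Longrightarrow>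
    eval_zigzag C D F (fst z) (fst (snd z)) = eval_zigzag C D F (fst z') (fst (snd z'))"
proof (induction rule: zigzag_eq.induct)
  case (zz_red us vs X as bs Y)
  note app = is_zigzag_append[OF functor_source[OF F]]
  from zz_red(2) obtain Z V where z: "is_zigzag C W X as Z" "is_zigzag C W Z us V" "is_zigzag C W V bs Y"
    by (auto simp: zigzags_def app)
  from zz_red(3) obtain Z' V' where z': "is_zigzag C W X as Z'" "is_zigzag C W Z' vs V'" "is_zigzag C W V' bs Y"
    by (auto simp: zigzags_def app)
  \<comment> \<open>The two zigzags are split separately, each with its own intermediate objects. A
    start and a list of steps determine the end, and a reduction keeps both ends, so the two
    splittings agree.\<close>
  have uniq: "V1 = V2" if "is_zigzag C W U ws V1" "is_zigzag C W U ws V2" for U V1 V2 ws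
    using that by (induction ws arbitrary: U) auto
  have "Z' = Z" using uniq z(1) z'(1) by blast
  have "V' = V" using zz_red(1) z(2) z'(2) functor_source[OF F] unfolding \<open>Z' = Z\<close> by cases auto
  have "eval_zigzag C D F Z us = eval_zigzag C D F Z vs"
    using eval_zigzag_red zz_red(1) z(2) z'(2) \<open>Z' = Z\<close> \<open>V' = V\<close> by blast
  moreover have "is_zigzag C W Z (us @ bs) Y" "is_zigzag C W Z (vs @ bs) Y"
    using z z' \<open>Z' = Z\<close> \<open>V' = V\<close> app by blast+
  ultimately show ?case
    using z z' \<open>Z' = Z\<close> \<open>V' = V\<close> by (simp add: eval_zigzag_append)
qed auto

lemma FArr_Ho_lift_zclass:
  assumes "is_zigzag C W X us Y"
  shows "FArr (Ho_lift C D F) (zclass C W X us Y) = eval_zigzag C D F X us"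
proof -
  have "d = eval_zigzag C D F X us"
    if "\<exists>X' us' Y'. (X', us', Y') \<in> zclass C W X us Y \<and> d = eval_zigzag C D F X' us'" for d
    using that eval_zigzag_eq[OF in_zclassD(1)] by fastforce
  then show ?thesis
    unfolding Ho_lift_def using in_zclass[OF assms] by (auto intro!: the_equality)
qed

lemma FObj_Ho_lift [simp]: "FObj (Ho_lift C D F) = FObj F"
  by (simp add: Ho_lift_def)

lemma Ho_lift_loc:
  assumes "u \<in> Arr C"
  shows "FArr (Ho_lift C D F) (loc C W u) = FArr F u"
  using assms FArr_Ho_lift_zclass[of "Dom C u" "[Fwd u]" "Cod C u"] by (simp add: loc_eq)

lemma is_functor_Ho_lift: "is_functor (Ho C W) D (Ho_lift C D F)"
proof -
  note cat = functor_source[OF F]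
  let ?L = "Ho_lift C D F"
  have hom: "FArr ?L K \<in> hom D (FObj ?L (Dom (Ho C W) K)) (FObj ?L (Cod (Ho C W) K))"
    if "K \<in> Arr (Ho C W)" for K
    using that by (rule Ho_ArrE[OF cat])
      (use eval_zigzag_hom in \<open>auto simp: FArr_Ho_lift_zclass Dom_zclass Cod_zclass\<close>)
  have idt: "FArr ?L (Idt (Ho C W) X) = Idt D (FObj F X)" if "X \<in> Obj C" for X
    using that by (simp add: Idt_Ho FArr_Ho_lift_zclass)
  have comp: "FArr ?L (L \<cdot>\<^bsub>Ho C W\<^esub> K) = FArr ?L L \<cdot>\<^bsub>D\<^esub> FArr ?L K"
    if KL: "K \<in> Arr (Ho C W)" "L \<in> Arr (Ho C W)" "Cod (Ho C W) K = Dom (Ho C W) L" for K L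
  proof -
    obtain X us Y where us: "is_zigzag C W X us Y" and K: "K = zclass C W X us Y"
      using KL(1) by (rule Ho_ArrE[OF cat])
    have "Dom (Ho C W) L = Y" using KL(3) K Cod_zclass[OF cat us] by simp
    with KL(2) obtain vs Z where vs: "is_zigzag C W Y vs Z" and L: "L = zclass C W Y vs Z"
      by (rule Ho_DomE[OF cat])
    have "is_zigzag C W X (us @ vs) Z" using us vs is_zigzag_append[OF cat] by blast
    then show ?thesis
      using us vs cat by (simp add: K L Comp_zclass FArr_Ho_lift_zclass eval_zigzag_append)
  qed
  show ?thesis unfolding is_functor_def using hom idt comp cat by auto
qed

end

text \<open>An element over the target is carried back to the source, so the head of the list acts
  last. \<open>Bwd w\<close> runs from \<open>Cod C w\<close> to \<open>Dom C w\<close> and acts by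
  the inverse of \<open>act w\<close>.\<close>

fun zigzag_act :: "('o, 'a) category \<Rightarrow> ('o \<Rightarrow> 'x set) \<Rightarrow> ('a \<Rightarrow> 'x \<Rightarrow> 'x) \<Rightarrow> 'a step list \<Rightarrow> 'x \<Rightarrow> 'x" where
  "zigzag_act C M act [] m = m"
| "zigzag_act C M act (Fwd u # us) m = act u (zigzag_act C M act us m)"
| "zigzag_act C M act (Bwd w # us) m = inv_into (M (Cod C w)) (act w) (zigzag_act C M act us m)"

context
  fixes C :: "('o, 'a) category" and W :: "'a set" and M :: "'o \<Rightarrow> 'x set" and act :: "'a \<Rightarrow> 'x \<Rightarrow> 'x"
  assumes cat: "is_category C"
    and act_in: "\<And>u m. u \<in> Arr C \<Longrightarrow> m \<in> M (Cod C u) \<Longrightarrow> act u m \<in> M (Dom C u)"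
    and act_Idt: "\<And>X m. X \<in> Obj C \<Longrightarrow> m \<in> M X \<Longrightarrow> act (Idt C X) m = m"
    and act_Comp: "\<And>u v m. u \<in> Arr C \<Longrightarrow> v \<in> Arr C \<Longrightarrow> Cod C u = Dom C v \<Longrightarrow> m \<in> M (Cod C v) \<Longrightarrow>
      act (v \<cdot>\<^bsub>C\<^esub> u) m = act u (act v m)"
    and act_bij: "\<And>w. w \<in> Arr C \<Longrightarrow> w \<in> W \<Longrightarrow> bij_betw (act w) (M (Cod C w)) (M (Dom C w))"
begin

lemma zigzag_act_in: "is_zigzag C W X us Y \<Longrightarrow> m \<in> M Y \<Longrightarrow> zigzag_act C M act us m \<in> M X"
proof (induction us arbitrary: X)
  case (Cons s us)
  show ?case
  proof (cases s)
    case (Fwd u)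
    with Cons act_in show ?thesis by auto
  next
    case (Bwd w)
    then have "zigzag_act C M act us m \<in> M (Dom C w)" using Cons by simp
    then show ?thesis
      using Cons Bwd act_bij[of w] inv_into_into[of _ "act w" "M (Cod C w)"]
      by (auto simp: bij_betw_imp_surj_on)
  qed
qed auto

lemma act_inv_into:
  assumes "w \<in> Arr C" "w \<in> W" "m \<in> M (Dom C w)"
  shows "act w (inv_into (M (Cod C w)) (act w) m) = m"
  using assms act_bij[of w] by (simp add: bij_betw_inv_into_right)

lemma inv_into_act:
  assumes "w \<in> Arr C" "w \<in> W" "m \<in> M (Cod C w)"
  shows "inv_into (M (Cod C w)) (act w) (act w m) = m"
  using assms act_bij[of w] by (simp add: bij_betw_inv_into_left)

lemma zigzag_act_append: "zigzag_act C M act (us @ vs) m = zigzag_act C M act us (zigzag_act C M act vs m)"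
proof (induction us)
  case (Cons s us)
  then show ?case by (cases s) auto
qed auto

lemma zigzag_act_eq:
  "(z, z') \<in> zigzag_eq C W \<Longrightarrow> m \<in> M (snd (snd z)) \<Longrightarrow>
    zigzag_act C M act (fst (snd z)) m = zigzag_act C M act (fst (snd z')) m"
proof (induction rule: zigzag_eq.induct)
  case (zz_red us vs X as bs Y)
  from zz_red(2) obtain Z V where z: "is_zigzag C W Z us V" "is_zigzag C W V bs Y"
    by (auto simp: zigzags_def is_zigzag_append[OF cat])
  have "zigzag_act C M act bs m \<in> M V" using zigzag_act_in[OF z(2)] zz_red(4) by simp
  from zz_red(1) z(1) this have "zigzag_act C M act us (zigzag_act C M act bs m) = zigzag_act C M act vs (zigzag_act C M act bs m)"
    by cases (auto simp: cat act_Idt act_Comp act_inv_into inv_into_act)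
  then show ?case by (simp add: zigzag_act_append)
next
  case (zz_sym z z')
  then show ?case using zigzag_eq_ends[OF zz_sym(1)] by simp
next
  case (zz_trans z z' z'')
  then show ?case using zigzag_eq_ends[OF zz_trans(1)] by simp
qed auto

text \<open>The universal property of the localization, for presheaves of sets and on generators, in
  the form that \<open>Ho_induct\<close> can use. The value at an inverted arrow is described
  through \<open>act w\<close>, whose injectivity pins it down.\<close>

lemma presheaf_extends_to_Ho:
  obtains ext where
    "\<And>K m. K \<in> Arr (Ho C W) \<Longrightarrow> m \<in> M (Cod (Ho C W) K) \<Longrightarrow> ext K m \<in> M (Dom (Ho C W) K)"
    "\<And>Z m. Z \<in> Obj C \<Longrightarrow> m \<in> M Z \<Longrightarrow> ext (Idt (Ho C W) Z) m = m"
    "\<And>u K m. u \<in> Arr C \<Longrightarrow> K \<in> Arr (Ho C W) \<Longrightarrow> Dom (Ho C W) K = Cod C u \<Longrightarrow> m \<in> M (Cod (Ho C W) K) \<Longrightarrow>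
      ext (K \<cdot>\<^bsub>Ho C W\<^esub> loc C W u) m = act u (ext K m)"
    "\<And>w K m. w \<in> Arr C \<Longrightarrow> w \<in> W \<Longrightarrow> K \<in> Arr (Ho C W) \<Longrightarrow> Dom (Ho C W) K = Dom C w \<Longrightarrow>
      m \<in> M (Cod (Ho C W) K) \<Longrightarrow> act w (ext (K \<cdot>\<^bsub>Ho C W\<^esub> inv_arrow (Ho C W) (loc C W w)) m) = ext K m"
proof
  \<comment> \<open>Any list occurring in the class will do: its ends are fixed by the class, and
    \<open>zigzag_act_eq\<close> makes the result independent of the choice.\<close>
  define ext :: "('o, 'a) zigzag set \<Rightarrow> 'x \<Rightarrow> 'x" where "ext K = zigzag_act C M act (SOME us. \<exists>X Y. (X, us, Y) \<in> K)" for K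
  have ext: "ext (zclass C W X us Y) m = zigzag_act C M act us m" if "is_zigzag C W X us Y" "m \<in> M Y" for X us Y m
  proof -
    have "\<exists>us' X' Y'. (X', us', Y') \<in> zclass C W X us Y" using in_zclass[OF that(1)] by blast
    then obtain X' Y' where "(X', (SOME us'. \<exists>X' Y'. (X', us', Y') \<in> zclass C W X us Y), Y') \<in> zclass C W X us Y"
      using someI_ex[where P = "\<lambda>us'. \<exists>X' Y'. (X', us', Y') \<in> zclass C W X us Y"] by blast
    from zigzag_act_eq[OF in_zclassD(1)[OF this], of m] show ?thesis unfolding ext_def using that by simp
  qed
  show "ext K m \<in> M (Dom (Ho C W) K)" if "K \<in> Arr (Ho C W)" "m \<in> M (Cod (Ho C W) K)" for K m
    using that by (elim Ho_ArrE[OF cat]) (auto simp: ext Cod_zclass[OF cat] Dom_zclass[OF cat] zigzag_act_in)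
  show "ext (Idt (Ho C W) Z) m = m" if "Z \<in> Obj C" "m \<in> M Z" for Z m
    using that ext[of Z "[]" Z m] by (simp add: Idt_Ho[OF cat])
  show "ext (K \<cdot>\<^bsub>Ho C W\<^esub> loc C W u) m = act u (ext K m)"
    if h: "u \<in> Arr C" "K \<in> Arr (Ho C W)" "Dom (Ho C W) K = Cod C u" "m \<in> M (Cod (Ho C W) K)" for u K m
  proof -
    obtain us Y where us: "is_zigzag C W (Cod C u) us Y" and K: "K = zclass C W (Cod C u) us Y"
      using h(2,3) by (rule Ho_DomE[OF cat])
    then show ?thesis
      using h(1,4) ext[OF us, of m] ext[of "Dom C u" "Fwd u # us" Y m]
      by (simp add: zclass_Fwd[OF cat, symmetric] Cod_zclass[OF cat])
  qed
  show "act w (ext (K \<cdot>\<^bsub>Ho C W\<^esub> inv_arrow (Ho C W) (loc C W w)) m) = ext K m"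
    if h: "w \<in> Arr C" "w \<in> W" "K \<in> Arr (Ho C W)" "Dom (Ho C W) K = Dom C w" "m \<in> M (Cod (Ho C W) K)" for w K m
  proof -
    obtain us Y where us: "is_zigzag C W (Dom C w) us Y" and K: "K = zclass C W (Dom C w) us Y"
      using h(3,4) by (rule Ho_DomE[OF cat])
    then show ?thesis
      using h(1,2,5) ext[OF us, of m] ext[of "Cod C w" "Bwd w # us" Y m] zigzag_act_in[OF us]
      by (simp add: zclass_Bwd[OF cat, symmetric] Cod_zclass[OF cat] act_inv_into)
  qed
qed

end

section \<open>Cofibrantly deformable opfibrations\<close>

lemma fiber_simps [simp]:
  "X \<in> Obj (fiber C S \<Phi> A) \<longleftrightarrow> X \<in> Obj C \<and> FObj \<Phi> X = A"
  "u \<in> Arr (fiber C S \<Phi> A) \<longleftrightarrow> u \<in> Arr C \<and> FArr \<Phi> u = Idt S A"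
  "Dom (fiber C S \<Phi> A) = Dom C"
  "Cod (fiber C S \<Phi> A) = Cod C"
  "Idt (fiber C S \<Phi> A) = Idt C"
  "Comp (fiber C S \<Phi> A) = Comp C"
  by (auto simp: fiber_def)

lemma is_category_fiber:
  assumes "is_functor C S \<Phi>" "A \<in> Obj S"
  shows "is_category (fiber C S \<Phi> A)"
proof -
  note [simp] = functor_simps[OF assms(1)] assms(2)
  have "FObj \<Phi> (Dom C u) = A" "FObj \<Phi> (Cod C u) = A" if "u \<in> Arr C" "FArr \<Phi> u = Idt S A" for u
    using that functor_Dom[OF assms(1), of u] functor_Cod[OF assms(1), of u] by auto
  then show ?thesis unfolding is_category_def by (auto simp: Comp_assoc)
qed

section \<open>Homotopy categories of the fibers and of the total category, with the functors
  between them\<close>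

locale fibered_weqs =
  fixes C :: "('o, 'a) category" (structure) and S :: "('b, 's) category"
    and \<Phi> :: "('o, 'a, 'b, 's) fmap" and W :: "'b \<Rightarrow> 'a set"
  assumes \<Phi>: "is_functor C S \<Phi>"
    and W_fiber: "\<And>A. A \<in> Obj S \<Longrightarrow> W A \<subseteq> Arr (fiber C S \<Phi> A)"
begin

abbreviation "FO \<equiv> FObj \<Phi>"
abbreviation "FA \<equiv> FArr \<Phi>"
abbreviation "Fib A \<equiv> fiber C S \<Phi> A"
abbreviation "HF A \<equiv> Ho (fiber C S \<Phi> A) (W A)"
abbreviation "L A u \<equiv> loc (fiber C S \<Phi> A) (W A) u"
abbreviation "H \<equiv> Ho_total C S W"
abbreviation "N u \<equiv> loc C (all_weqs S W) u"
abbreviation "\<pi> \<equiv> Ho_proj C S \<Phi>"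
abbreviation "\<iota> A \<equiv> Ho_fiber_comparison C S \<Phi> W A"

lemma catC [simp]: "is_category C" and catS [simp]: "is_category S"
  using functor_source[OF \<Phi>] functor_target[OF \<Phi>] .

lemma catF [simp]: "A \<in> Obj S \<Longrightarrow> is_category (Fib A)"
  using is_category_fiber[OF \<Phi>] .

lemma catH [simp]: "is_category H"
  by (simp add: Ho_total_def)

lemma FO_Obj [simp]: "X \<in> Obj C \<Longrightarrow> FO X \<in> Obj S" and FA_Arr [simp]: "u \<in> Arr C \<Longrightarrow> FA u \<in> Arr S"
  and FA_Idt [simp]: "X \<in> Obj C \<Longrightarrow> FA (Idt C X) = Idt S (FO X)"
  and FO_Dom [simp]: "u \<in> Arr C \<Longrightarrow> FO (Dom C u) = Dom S (FA u)"
  and FO_Cod [simp]: "u \<in> Arr C \<Longrightarrow> FO (Cod C u) = Cod S (FA u)"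
  and FA_Comp [simp]: "u \<in> Arr C \<Longrightarrow> v \<in> Arr C \<Longrightarrow> Cod C u = Dom C v \<Longrightarrow> FA (v \<cdot> u) = FA v \<cdot>\<^bsub>S\<^esub> FA u"
  by (simp_all add: functor_simps[OF \<Phi>])

lemma W_D:
  assumes "A \<in> Obj S" "w \<in> W A"
  shows "w \<in> Arr C" "FA w = Idt S A"
  using assms W_fiber[OF assms(1)] by auto

lemma all_weqs_D:
  assumes "w \<in> all_weqs S W"
  obtains A where "A \<in> Obj S" "w \<in> W A"
  using assms by (auto simp: all_weqs_def)

lemma H_Obj [simp]: "Obj H = Obj C"
  by (simp add: Ho_total_def)

lemma N_simps [simp]:
  assumes "u \<in> Arr C"
  shows "N u \<in> Arr H" "Dom H (N u) = Dom C u" "Cod H (N u) = Cod C u"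
  using assms loc_simps(1-3)[of C u] by (simp_all add: Ho_total_def)

lemma N_Comp: "u \<in> Arr C \<Longrightarrow> v \<in> Arr C \<Longrightarrow> Cod C u = Dom C v \<Longrightarrow> N (v \<cdot> u) = N v \<cdot>\<^bsub>H\<^esub> N u"
  using loc_Comp[of C u v] by (simp add: Ho_total_def)

lemma N_iso: "A \<in> Obj S \<Longrightarrow> w \<in> W A \<Longrightarrow> is_iso H (N w)"
  unfolding Ho_total_def by (rule is_iso_loc) (auto simp: all_weqs_def dest: W_D)

lemma N_functor: "is_functor C H (Ho_loc C (all_weqs S W))"
  by (simp add: Ho_total_def is_functor_Ho_loc)

text \<open>Weak equivalences lie over identities. This is what lets \<Phi> descend to the
  localization.\<close>

lemma FArr_inverts:
  assumes "w \<in> Arr C" "w \<in> all_weqs S W"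
  shows "is_iso S (FA w)"
  using assms(2) by (rule all_weqs_D) (use assms W_D in auto)

lemma \<pi>_functor: "is_functor H S \<pi>"
  unfolding Ho_total_def Ho_proj_def using is_functor_Ho_lift[OF \<Phi> FArr_inverts] by blast

lemma FObj_\<pi> [simp]: "FObj \<pi> = FO"
  by (simp add: Ho_proj_def Ho_lift_def)

lemma \<pi>_N [simp]: "u \<in> Arr C \<Longrightarrow> FArr \<pi> (N u) = FA u"
  unfolding Ho_proj_def by (rule Ho_lift_loc[OF \<Phi> FArr_inverts])

lemmas \<pi>_simps [simp] = functor_Arr[OF \<pi>_functor]
lemmas \<pi>_Comp = functor_Comp[OF \<pi>_functor]
lemmas \<pi>_Dom = functor_Dom[OF \<pi>_functor, simplified FObj_\<pi>]
lemmas \<pi>_Cod = functor_Cod[OF \<pi>_functor, simplified FObj_\<pi>]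
lemmas \<pi>_Idt = functor_Idt[OF \<pi>_functor, simplified FObj_\<pi>]

context
  fixes A assumes A [simp]: "A \<in> Obj S"
begin

lemma fiber_N_functor:
  "is_functor (Fib A) H (comp_fmap (Ho_loc C (all_weqs S W)) id_fmap)"
  unfolding is_functor_def
  by (auto simp: comp_fmap_def id_fmap_def N_Comp Ho_total_def)

lemma fiber_N_inverts:
  assumes "w \<in> Arr (Fib A)" "w \<in> W A"
  shows "is_iso H (FArr (comp_fmap (Ho_loc C (all_weqs S W)) id_fmap) w)"
  using N_iso[OF A assms(2)] by (simp add: comp_fmap_def id_fmap_def)

lemma \<iota>_functor: "is_functor (HF A) H (\<iota> A)"
  unfolding Ho_fiber_comparison_def using is_functor_Ho_lift[OF fiber_N_functor fiber_N_inverts] by blast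

lemma FObj_\<iota> [simp]: "FObj (\<iota> A) X = X"
  by (simp add: Ho_fiber_comparison_def Ho_lift_def comp_fmap_def id_fmap_def)

lemma \<iota>_L [simp]: "u \<in> Arr C \<Longrightarrow> FA u = Idt S A \<Longrightarrow> FArr (\<iota> A) (L A u) = N u"
  unfolding Ho_fiber_comparison_def
  by (subst Ho_lift_loc[OF fiber_N_functor fiber_N_inverts]) (auto simp: comp_fmap_def id_fmap_def)

lemmas \<iota>_simps [simp] = functor_Arr[OF \<iota>_functor]
  functor_Dom[OF \<iota>_functor, unfolded FObj_\<iota>] functor_Cod[OF \<iota>_functor, unfolded FObj_\<iota>]
lemmas \<iota>_Comp = functor_Comp[OF \<iota>_functor]
lemmas \<iota>_Idt = functor_Idt[OF \<iota>_functor, unfolded FObj_\<iota>]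

lemma L_Comp:
  assumes "u \<in> Arr C" "v \<in> Arr C" "Cod C u = Dom C v" "FA u = Idt S A" "FA v = Idt S A"
  shows "L A (v \<cdot> u) = L A v \<cdot>\<^bsub>HF A\<^esub> L A u"
  using assms loc_Comp[of "Fib A" u v] by simp

lemma L_simps [simp]:
  assumes "u \<in> Arr C" "FA u = Idt S A"
  shows "L A u \<in> Arr (HF A)" "Dom (HF A) (L A u) = Dom C u" "Cod (HF A) (L A u) = Cod C u"
  using assms loc_simps(1-3)[of "Fib A" u] by simp_all

lemma L_iso: "w \<in> W A \<Longrightarrow> is_iso (HF A) (L A w)"
  using is_iso_loc[of "Fib A" w "W A"] W_D[of A w] by simp

lemma \<pi>_\<iota>:
  assumes "K \<in> Arr (HF A)"
  shows "FArr \<pi> (FArr (\<iota> A) K) = Idt S A"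
  using assms refl
proof (induction K rule: Ho_induct[OF catF[OF A], consumes 2, case_names Idt Fwd Bwd])
  case Idt
  then show ?case by (simp add: \<iota>_Idt \<pi>_Idt)
next
  case (Fwd u K)
  then show ?case by (simp add: \<iota>_Comp \<pi>_Comp)
next
  case (Bwd w K)
  have w: "w \<in> Arr C" "FA w = Idt S A" using Bwd(1) by simp_all
  have "FArr (\<iota> A) (inv_arrow (HF A) (L A w)) = inv_arrow H (N w)"
    using functor_inv[OF \<iota>_functor L_iso[OF Bwd(2)]] w by simp
  moreover have "FArr \<pi> (inv_arrow H (N w)) = Idt S A"
    using functor_inv[OF \<pi>_functor N_iso[OF A Bwd(2)]] w by simp
  ultimately show ?case
    using Bwd w L_iso[OF Bwd(2)] N_iso[OF A Bwd(2)] by (simp add: \<iota>_Comp \<pi>_Comp)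
qed

end

end

text \<open>Holds one half of the bi-deformable data. It is interpreted twice: with cocartesian
  arrows over \<open>S\<close>, and with cartesian arrows over \<open>op S\<close>. As only the
  arrows \<open>c\<close> are given and no cleavage, \<open>push_W\<close> describes
  \<open>f_! w\<close> by its defining property.\<close>

locale cofibrant_opfibration = fibered_weqs C S \<Phi> W
  for C :: "('o, 'a) category" (structure) and S :: "('b, 's) category"
    and \<Phi> :: "('o, 'a, 'b, 's) fmap" and W :: "'b \<Rightarrow> 'a set" +
  fixes c :: "'s \<Rightarrow> 'o \<Rightarrow> 'a"
    and Q :: "'b \<Rightarrow> ('o, 'a, 'o, 'a) fmap" and \<theta> :: "'b \<Rightarrow> 'o \<Rightarrow> 'a" and Cof :: "'b \<Rightarrow> 'o set"
  assumes W_Comp: "\<And>A u v. A \<in> Obj S \<Longrightarrow> u \<in> W A \<Longrightarrow> v \<in> W A \<Longrightarrow> Cod C u = Dom C v \<Longrightarrow> v \<cdot> u \<in> W A"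
    and W_cancel: "\<And>A u v. A \<in> Obj S \<Longrightarrow> u \<in> Arr (fiber C S \<Phi> A) \<Longrightarrow> v \<in> W A \<Longrightarrow> Cod C u = Dom C v \<Longrightarrow>
      v \<cdot> u \<in> W A \<Longrightarrow> u \<in> W A"
    and cocart: "\<And>f X. f \<in> Arr S \<Longrightarrow> X \<in> Obj C \<Longrightarrow> FObj \<Phi> X = Dom S f \<Longrightarrow> cocartesian C S \<Phi> (c f X)"
    and Dom_c [simp]: "\<And>f X. f \<in> Arr S \<Longrightarrow> X \<in> Obj C \<Longrightarrow> FObj \<Phi> X = Dom S f \<Longrightarrow> Dom C (c f X) = X"
    and FArr_c [simp]: "\<And>f X. f \<in> Arr S \<Longrightarrow> X \<in> Obj C \<Longrightarrow> FObj \<Phi> X = Dom S f \<Longrightarrow> FArr \<Phi> (c f X) = f"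
    and Cof_Obj: "\<And>A. A \<in> Obj S \<Longrightarrow> Cof A \<subseteq> Obj (fiber C S \<Phi> A)"
    and \<theta>: "\<And>A. A \<in> Obj S \<Longrightarrow> nat_weq (fiber C S \<Phi> A) (fiber C S \<Phi> A) (W A) (Q A) id_fmap (\<theta> A)"
    and Q_Cof: "\<And>A. A \<in> Obj S \<Longrightarrow> FObj (Q A) ` Obj (fiber C S \<Phi> A) \<subseteq> Cof A"
    and push_Cof: "\<And>f X. f \<in> Arr S \<Longrightarrow> X \<in> Cof (Dom S f) \<Longrightarrow> Cod C (c f X) \<in> Cof (Cod S f)"
    and push_W: "\<And>f w p. f \<in> Arr S \<Longrightarrow> w \<in> W (Dom S f) \<Longrightarrow> Dom C w \<in> Cof (Dom S f) \<Longrightarrow>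
      Cod C w \<in> Cof (Dom S f) \<Longrightarrow> p \<in> hom C (Cod C (c f (Dom C w))) (Cod C (c f (Cod C w))) \<Longrightarrow>
      FArr \<Phi> p = Idt S (Cod S f) \<Longrightarrow> p \<cdot> c f (Dom C w) = c f (Cod C w) \<cdot> w \<Longrightarrow> p \<in> W (Cod S f)"
begin

section \<open>Vertical factors and pushforward of arrows\<close>

lemma c_Arr [simp]: "f \<in> Arr S \<Longrightarrow> X \<in> Obj C \<Longrightarrow> FO X = Dom S f \<Longrightarrow> c f X \<in> Arr C"
  using cocart unfolding cocartesian_def by blast

lemma Cof_D:
  assumes "A \<in> Obj S" "X \<in> Cof A"
  shows "X \<in> Obj C" "FO X = A"
  using assms Cof_Obj[OF assms(1)] by auto

text \<open>
  The vertical factor of \<open>m : M \<rightarrow> X\<close> through the cocartesian arrow \<open>M \<rightarrow> (\<Phi> m)\<^sub>! M\<close>.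
\<close>

definition bar :: "'a \<Rightarrow> 'a" where
  "bar m = cocart_factor C \<Phi> (c (FA m) (Dom C m)) (Idt S (FO (Cod C m))) m"

context
  fixes m assumes m: "m \<in> Arr C"
begin

lemma bar_ex1: "\<exists>!w. w \<in> hom C (Cod C (c (FA m) (Dom C m))) (Cod C m) \<and>
    FA w = Idt S (FO (Cod C m)) \<and> w \<cdot> c (FA m) (Dom C m) = m"
  using m cocart[of "FA m" "Dom C m"] unfolding cocartesian_def by auto

lemma bar: "bar m \<in> hom C (Cod C (c (FA m) (Dom C m))) (Cod C m) \<and>
    FA (bar m) = Idt S (FO (Cod C m)) \<and> bar m \<cdot> c (FA m) (Dom C m) = m"
  unfolding bar_def cocart_factor_def using theI'[OF bar_ex1] .

lemma bar_simps [simp]: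
  "bar m \<in> Arr C" "Dom C (bar m) = Cod C (c (FA m) (Dom C m))" "Cod C (bar m) = Cod C m"
  "FA (bar m) = Idt S (Cod S (FA m))" "bar m \<cdot> c (FA m) (Dom C m) = m"
  using bar m by auto

lemma bar_eqI:
  assumes "b \<in> Arr C" "Dom C b = Cod C (c (FA m) (Dom C m))" "Cod C b = Cod C m"
    "FA b = Idt S (Cod S (FA m))" "b \<cdot> c (FA m) (Dom C m) = m"
  shows "bar m = b"
  unfolding bar_def cocart_factor_def by (rule the1_equality[OF bar_ex1]) (use assms m in simp)

end

text \<open>For vertical \<open>n\<close> this is the functor \<open>k_!\<close> on arrows. For
  \<open>n\<close> over \<open>j\<close> it also contains the comparison from the pushforward along
  the composite of \<open>k\<close> and \<open>j\<close> to \<open>k_! j_!\<close>, which therefore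
  never has to be treated separately.\<close>

definition p :: "'s \<Rightarrow> 'a \<Rightarrow> 'a" where
  "p k n = bar (c k (Cod C n) \<cdot> n)"

lemma p_simps [simp]:
  assumes "n \<in> Arr C" "k \<in> Arr S" "Dom S k = Cod S (FA n)"
  shows "p k n \<in> Arr C" "Dom C (p k n) = Cod C (c (k \<cdot>\<^bsub>S\<^esub> FA n) (Dom C n))"
    "Cod C (p k n) = Cod C (c k (Cod C n))" "FA (p k n) = Idt S (Cod S k)"
  using assms by (auto simp: p_def)

lemma p_c:
  assumes "n \<in> Arr C" "k \<in> Arr S" "Dom S k = Cod S (FA n)"
  shows "p k n \<cdot> c (k \<cdot>\<^bsub>S\<^esub> FA n) (Dom C n) = c k (Cod C n) \<cdot> n"
  using assms bar_simps(5)[of "c k (Cod C n) \<cdot> n"] by (simp add: p_def)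

lemma bar_Comp:
  assumes "m \<in> Arr C" "n \<in> Arr C" "Cod C n = Dom C m"
  shows "bar (m \<cdot> n) = bar m \<cdot> p (FA m) n"
proof (rule bar_eqI)
  have FO: "Cod S (FA n) = Dom S (FA m)" using assms FO_Cod[of n] by simp
  show "(bar m \<cdot> p (FA m) n) \<cdot> c (FA (m \<cdot> n)) (Dom C (m \<cdot> n)) = m \<cdot> n" (is "?l = _")
  proof -
    have "?l = bar m \<cdot> c (FA m) (Cod C n) \<cdot> n"
      using assms FO p_c[of n "FA m"] by (simp add: Comp_assoc)
    also have "\<dots> = m \<cdot> n"
      using assms FO Comp_assoc[of C n "c (FA m) (Dom C m)" "bar m"] by simp
    finally show ?thesis .
  qed
qed (use assms FO_Cod[of n] in auto)

lemma bar_vertical: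
  assumes "m \<in> Arr C" "u \<in> Arr C" "Cod C m = Dom C u" "FA u = Idt S (Cod S (FA m))"
  shows "bar (u \<cdot> m) = u \<cdot> bar m"
proof (rule bar_eqI)
  have "Cod S (FA u) = Cod S (FA m)" "Dom S (FA u) = Cod S (FA m)" using assms by simp_all
  then show "u \<cdot> m \<in> Arr C" "u \<cdot> bar m \<in> Arr C"
    "Dom C (u \<cdot> bar m) = Cod C (c (FA (u \<cdot> m)) (Dom C (u \<cdot> m)))"
    "Cod C (u \<cdot> bar m) = Cod C (u \<cdot> m)" "FA (u \<cdot> bar m) = Idt S (Cod S (FA (u \<cdot> m)))"
    using assms by simp_all
  show "(u \<cdot> bar m) \<cdot> c (FA (u \<cdot> m)) (Dom C (u \<cdot> m)) = u \<cdot> m"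
    using assms Comp_assoc[of C "c (FA m) (Dom C m)" "bar m" u] by simp
qed

lemma bar_c:
  assumes "k \<in> Arr S" "X \<in> Obj C" "FO X = Dom S k"
  shows "bar (c k X) = Idt C (Cod C (c k X))"
  by (rule bar_eqI) (use assms in auto)

text \<open>Pushforwards compose only up to isomorphism, yet this law is strict: the index of each
  factor is the composite in the base, so both sides factor the same arrow through the same
  cocartesian arrow.\<close>

lemma p_Comp:
  assumes "m \<in> Arr C" "n \<in> Arr C" "Cod C n = Dom C m" "k \<in> Arr S" "Dom S k = Cod S (FA m)"
  shows "p k (m \<cdot> n) = p k m \<cdot> p (k \<cdot>\<^bsub>S\<^esub> FA m) n"
proof -
  have "Cod S (FA n) = Dom S (FA m)" using assms FO_Cod[of n] by simp
  then show ?thesis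
    using assms bar_Comp[of "c k (Cod C m) \<cdot> m" n] by (simp add: p_def Comp_assoc)
qed

lemma p_weq:
  assumes "k \<in> Arr S" "w \<in> W (Dom S k)" "Dom C w \<in> Cof (Dom S k)" "Cod C w \<in> Cof (Dom S k)"
  shows "p k w \<in> W (Cod S k)"
proof -
  have w: "w \<in> Arr C" "FA w = Idt S (Dom S k)" using W_D[of "Dom S k" w] assms by simp_all
  then show ?thesis
    using assms p_c[of w k] by (intro push_W[of k w]) auto
qed

section \<open>Derived pushforwards and their functoriality\<close>

text \<open>\<open>q\<close>, \<open>t\<close> and \<open>qa\<close> are \<open>Q\<close> on objects, \<open>\<theta>\<close> and \<open>Q\<close> on arrows, with the fiber left implicit.\<close>

definition q :: "'o \<Rightarrow> 'o" where "q X = FObj (Q (FO X)) X"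
definition t :: "'o \<Rightarrow> 'a" where "t X = \<theta> (FO X) X"
definition qa :: "'a \<Rightarrow> 'a" where "qa u = FArr (Q (FO (Dom C u))) u"

context
  fixes X assumes X: "X \<in> Obj C"
begin

lemma q_simps [simp]: "q X \<in> Obj C" "FO (q X) = FO X" and q_Cof: "q X \<in> Cof (FO X)"
proof -
  show "q X \<in> Cof (FO X)" using Q_Cof[of "FO X"] X unfolding q_def by (simp add: image_subset_iff)
  then show "q X \<in> Obj C" "FO (q X) = FO X" using Cof_D[of "FO X" "q X"] X by simp_all
qed

lemma t_simps [simp]: "t X \<in> Arr C" "Dom C (t X) = q X" "Cod C (t X) = X" "FA (t X) = Idt S (FO X)"
  and t_weq: "t X \<in> W (FO X)"
  using X \<theta>[of "FO X"] unfolding nat_weq_def nat_trans_def q_def t_def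
  by (auto simp: id_fmap_def)

end

context
  fixes u A assumes u: "u \<in> Arr C" "A \<in> Obj S" "FA u = Idt S A"
begin

private lemma ends: "FO (Dom C u) = A" "FO (Cod C u) = A"
  using u by auto

lemma qa_simps: "qa u \<in> Arr C" "Dom C (qa u) = q (Dom C u)" "Cod C (qa u) = q (Cod C u)"
    "FA (qa u) = Idt S A"
  and t_natural: "t (Cod C u) \<cdot> qa u = u \<cdot> t (Dom C u)"
proof -
  have nt: "nat_trans (Fib A) (Fib A) (Q A) id_fmap (\<theta> A)" using \<theta>[OF u(2)] by (simp add: nat_weq_def)
  then have "is_functor (Fib A) (Fib A) (Q A)" by (simp add: nat_trans_def)
  from functor_Arr[OF this, of u] functor_Dom[OF this, of u] functor_Cod[OF this, of u]
  show "qa u \<in> Arr C" "Dom C (qa u) = q (Dom C u)" "Cod C (qa u) = q (Cod C u)" "FA (qa u) = Idt S A"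
    using u ends unfolding qa_def q_def by (auto simp del: FO_Dom FO_Cod)
  show "t (Cod C u) \<cdot> qa u = u \<cdot> t (Dom C u)"
    using nt u ends unfolding nat_trans_def qa_def t_def by (auto simp: id_fmap_def simp del: FO_Dom FO_Cod)
qed

lemma qa_Comp:
  assumes "v \<in> Arr C" "FA v = Idt S A" "Cod C u = Dom C v"
  shows "qa (v \<cdot> u) = qa v \<cdot> qa u"
proof -
  have "is_functor (Fib A) (Fib A) (Q A)" using \<theta>[OF u(2)] by (simp add: nat_weq_def nat_trans_def)
  from functor_Comp[OF this, of u v] show ?thesis
    using u ends assms unfolding qa_def by (auto simp del: FO_Dom FO_Cod)
qed

text \<open>Two-out-of-three in the naturality square of \<open>t\<close>.\<close>

lemma qa_weq:
  assumes "u \<in> W A"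
  shows "qa u \<in> W A"
proof (rule W_cancel[OF u(2)])
  show "t (Cod C u) \<in> W A" using t_weq[of "Cod C u"] ends u by simp
  show "t (Cod C u) \<cdot> qa u \<in> W A"
    unfolding t_natural using assms t_weq[of "Dom C u"] ends u by (intro W_Comp) auto
qed (use u qa_simps in auto)

end

text \<open>\<^term>\<open>E k n\<close> is the arrow \<open>(k \<circ> \<Phi> n)\<^sub>! M \<rightarrow> k\<^sub>! N\<close> that an arrow \<open>n : M \<rightarrow> N\<close> induces in the
  homotopy category of the fiber over the codomain of \<open>k\<close>.\<close>

definition E :: "'s \<Rightarrow> 'a \<Rightarrow> ('o, 'a) zigzag set" where
  "E k n = L (Cod S k) (p k n)"

lemma E_simps [simp]:
  assumes "n \<in> Arr C" "k \<in> Arr S" "Dom S k = Cod S (FA n)"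
  shows "E k n \<in> Arr (HF (Cod S k))" "Dom (HF (Cod S k)) (E k n) = Cod C (c (k \<cdot>\<^bsub>S\<^esub> FA n) (Dom C n))"
    "Cod (HF (Cod S k)) (E k n) = Cod C (c k (Cod C n))"
  using assms by (simp_all add: E_def)

lemma E_Comp:
  assumes "m \<in> Arr C" "n \<in> Arr C" "Cod C n = Dom C m" "k \<in> Arr S" "Dom S k = Cod S (FA m)"
  shows "E k (m \<cdot> n) = E k m \<cdot>\<^bsub>HF (Cod S k)\<^esub> E (k \<cdot>\<^bsub>S\<^esub> FA m) n"
proof -
  have "Cod S (FA n) = Dom S (FA m)" using assms FO_Cod[of n] by simp
  then show ?thesis using assms by (simp add: E_def p_Comp L_Comp)
qed

lemma E_iso:
  assumes "k \<in> Arr S" "w \<in> W (Dom S k)" "Dom C w \<in> Cof (Dom S k)" "Cod C w \<in> Cof (Dom S k)"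
  shows "is_iso (HF (Cod S k)) (E k w)"
  unfolding E_def using assms L_iso p_weq by simp

lemma E_t_iso:
  assumes "k \<in> Arr S" "X \<in> Cof (Dom S k)"
  shows "is_iso (HF (Cod S k)) (E k (t X))"
proof -
  have "X \<in> Obj C" "FO X = Dom S k" using Cof_D[of "Dom S k" X] assms by auto
  then show ?thesis using assms t_weq[of X] q_Cof[of X] by (intro E_iso) auto
qed

lemma qa_bar_simps [simp]:
  assumes "m \<in> Arr C"
  shows "qa (bar m) \<in> Arr C" "Dom C (qa (bar m)) = q (Cod C (c (FA m) (Dom C m)))"
    "Cod C (qa (bar m)) = q (Cod C m)" "FA (qa (bar m)) = Idt S (Cod S (FA m))"
  using assms qa_simps[of "bar m" "Cod S (FA m)"] by simp_all

text \<open>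
  An arrow \<open>m : M \<rightarrow> X\<close> out of a cofibrant object acts on derived pushforwards along the zigzag
  \<open>M \<rightarrow> Y \<leftarrow> q Y \<rightarrow> q X\<close>, where \<open>Y\<close> is the pushforward of \<open>M\<close> along \<open>\<Phi> m\<close>.
\<close>

definition lift :: "'s \<Rightarrow> 'a \<Rightarrow> ('o, 'a) zigzag set" where
  "lift k m = E k (qa (bar m)) \<cdot>\<^bsub>HF (Cod S k)\<^esub>
     inv_arrow (HF (Cod S k)) (E k (t (Cod C (c (FA m) (Dom C m))))) \<cdot>\<^bsub>HF (Cod S k)\<^esub>
     E k (c (FA m) (Dom C m))"

definition cofibrant_source :: "'a \<Rightarrow> bool" where
  "cofibrant_source m \<longleftrightarrow> m \<in> Arr C \<and> Dom C m \<in> Cof (Dom S (FA m))"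

lemma cofibrant_source_Arr: "cofibrant_source m \<Longrightarrow> m \<in> Arr C"
  by (simp add: cofibrant_source_def)

lemma cofibrant_push: "cofibrant_source m \<Longrightarrow> Cod C (c (FA m) (Dom C m)) \<in> Cof (Cod S (FA m))"
  unfolding cofibrant_source_def using push_Cof[of "FA m"] by simp

text \<open>Justifies the inverse in \<open>lift\<close>: the pushforward \<open>Y\<close> of a
  cofibrant object is cofibrant, so \<open>t Y\<close> is a weak equivalence between cofibrant
  objects and \<open>k_!\<close> keeps it one.\<close>

lemma lift_iso:
  assumes "cofibrant_source m" "k \<in> Arr S" "Dom S k = Cod S (FA m)"
  shows "is_iso (HF (Cod S k)) (E k (t (Cod C (c (FA m) (Dom C m)))))"
  using assms cofibrant_push[OF assms(1)] by (intro E_t_iso) simp_all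

lemma lift_simps [simp]:
  assumes "cofibrant_source m" "k \<in> Arr S" "Dom S k = Cod S (FA m)"
  shows "lift k m \<in> Arr (HF (Cod S k))"
    "Dom (HF (Cod S k)) (lift k m) = Cod C (c (k \<cdot>\<^bsub>S\<^esub> FA m) (Dom C m))"
    "Cod (HF (Cod S k)) (lift k m) = Cod C (c k (q (Cod C m)))"
  using assms lift_iso[OF assms] cofibrant_source_Arr[OF assms(1)] by (simp_all add: lift_def)

text \<open>When both sources are cofibrant, precomposing with \<open>n\<close> needs no
  replacement. The vertical arrow \<open>r : Y' -> Y\<close> between the two pushforwards slides
  through the zigzag: equation 1 is functoriality of \<open>Q\<close>, equation 2 naturality of
  \<open>t\<close> at \<open>r\<close>, equation 3 the square defining \<open>r\<close>.\<close>

lemma lift_Comp_cofibrant: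
  assumes m: "cofibrant_source m" and n: "cofibrant_source n" "Cod C n = Dom C m"
    and k: "k \<in> Arr S" "Dom S k = Cod S (FA m)"
  shows "lift k (m \<cdot> n) = lift k m \<cdot>\<^bsub>HF (Cod S k)\<^esub> E (k \<cdot>\<^bsub>S\<^esub> FA m) n"
proof -
  define D j i where "D = Cod S k" and "j = FA m" and "i = FA n"
  define Y Y' where "Y = Cod C (c j (Dom C m))" and "Y' = Cod C (c (j \<cdot>\<^bsub>S\<^esub> i) (Dom C n))"
  define r where "r = p j n"
  have arr: "m \<in> Arr C" "n \<in> Arr C" using m n cofibrant_source_Arr by auto
  have FAn: "Cod S i = Dom S j" using arr n(2) FO_Cod[of n] by (simp add: i_def j_def)
  have j: "FA m = j" "FA n = i" "Dom S k = Cod S j" by (simp_all add: j_def i_def k)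
  have jA [simp]: "j \<in> Arr S" "i \<in> Arr S" using arr by (simp_all add: j_def i_def)
  have FOD: "FO (Dom C m) = Dom S j" "FO (Dom C n) = Dom S i" using arr by (simp_all add: j)
  have mn: "cofibrant_source (m \<cdot> n)"
    using m n arr FAn by (simp add: cofibrant_source_def j)
  have D [simp]: "D \<in> Obj S" using k by (simp add: D_def)
  have r [simp]: "r \<in> Arr C" "Dom C r = Y'" "Cod C r = Y" "FA r = Idt S (Cod S j)"
    using arr n(2) FAn by (simp_all add: r_def Y_def Y'_def j)
  have Y [simp]: "Y \<in> Obj C" "Y' \<in> Obj C" "FO Y = Cod S j" "FO Y' = Cod S j"
    using arr FAn n(2) FOD by (simp_all add: Y_def Y'_def)
  have iso: "is_iso (HF D) (E k (t Y))" "is_iso (HF D) (E k (t Y'))"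
    using lift_iso[OF m k] lift_iso[OF mn k(1)] k arr n(2) FAn by (simp_all add: D_def Y_def Y'_def j)
  have qr [simp]: "qa r \<in> Arr C" "Dom C (qa r) = q Y'" "Cod C (qa r) = q Y" "FA (qa r) = Idt S (Cod S j)"
    using qa_simps[of r "Cod S j"] by simp_all
  have E1: "E k (u \<cdot> v) = E k u \<cdot>\<^bsub>HF D\<^esub> E k v"
    if "u \<in> Arr C" "v \<in> Arr C" "Cod C v = Dom C u" "FA u = Idt S (Cod S j)" for u v
    using that k E_Comp[of u v k] by (simp add: D_def j)
  have bar: "bar (m \<cdot> n) = bar m \<cdot> r"
    using arr n(2) by (simp add: bar_Comp r_def j)
  have 1: "E k (qa (bar (m \<cdot> n))) = E k (qa (bar m)) \<cdot>\<^bsub>HF D\<^esub> E k (qa r)"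
    unfolding bar using arr k by (subst qa_Comp[of r "Cod S j"]) (simp_all add: E1 j Y_def)
  have "t Y \<cdot> qa r = r \<cdot> t Y'" using t_natural[of r "Cod S j"] by simp
  then have "E k (t Y) \<cdot>\<^bsub>HF D\<^esub> E k (qa r) = E k r \<cdot>\<^bsub>HF D\<^esub> E k (t Y')"
    using E1[of "t Y" "qa r"] E1[of r "t Y'"] by simp
  then have 2: "E k (qa r) \<cdot>\<^bsub>HF D\<^esub> inv_arrow (HF D) (E k (t Y')) = inv_arrow (HF D) (E k (t Y)) \<cdot>\<^bsub>HF D\<^esub> E k r"
    using iso k by (intro iso_square) (simp_all add: D_def j)
  have "r \<cdot> c (j \<cdot>\<^bsub>S\<^esub> i) (Dom C n) = c j (Dom C m) \<cdot> n"
    using p_c[of n j] arr n(2) FAn by (simp add: r_def j)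
  then have 3: "E k r \<cdot>\<^bsub>HF D\<^esub> E k (c (j \<cdot>\<^bsub>S\<^esub> i) (Dom C n)) = E k (c j (Dom C m)) \<cdot>\<^bsub>HF D\<^esub> E (k \<cdot>\<^bsub>S\<^esub> j) n"
    using E1[of r "c (j \<cdot>\<^bsub>S\<^esub> i) (Dom C n)"] E_Comp[of "c j (Dom C m)" n k] arr n(2) FAn FOD k
    by (simp add: Y'_def D_def j)
  define a b e d c' where "a = E k (qa (bar m))" and "b = E k (qa r)" and "e = E k r"
    and "d = E k (c (j \<cdot>\<^bsub>S\<^esub> i) (Dom C n))" and "c' = E k (c j (Dom C m))"
  have arrs: "a \<in> Arr (HF D)" "Dom (HF D) a = Cod C (c k (q Y))"
    "b \<in> Arr (HF D)" "Dom (HF D) b = Cod C (c k (q Y'))" "Cod (HF D) b = Cod C (c k (q Y))"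
    "e \<in> Arr (HF D)" "Dom (HF D) e = Cod C (c k Y')" "Cod (HF D) e = Cod C (c k Y)"
    "d \<in> Arr (HF D)" "Cod (HF D) d = Cod C (c k Y')"
    "c' \<in> Arr (HF D)" "Dom (HF D) c' = Cod C (c (k \<cdot>\<^bsub>S\<^esub> j) (Dom C m))" "Cod (HF D) c' = Cod C (c k Y)"
    "Cod (HF D) (E k (t Y)) = Cod C (c k Y)" "Dom (HF D) (E k (t Y)) = Cod C (c k (q Y))"
    "Cod (HF D) (E k (t Y')) = Cod C (c k Y')" "Dom (HF D) (E k (t Y')) = Cod C (c k (q Y'))"
    "E (k \<cdot>\<^bsub>S\<^esub> j) n \<in> Arr (HF D)" "Cod (HF D) (E (k \<cdot>\<^bsub>S\<^esub> j) n) = Cod C (c (k \<cdot>\<^bsub>S\<^esub> j) (Dom C m))"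
    unfolding a_def b_def e_def d_def c'_def using arr k FAn FOD n(2) E_simps[of n "k \<cdot>\<^bsub>S\<^esub> j"]
    by (simp_all add: D_def j Y_def[symmetric] Y'_def[symmetric])
  have "lift k (m \<cdot> n) = (a \<cdot>\<^bsub>HF D\<^esub> b) \<cdot>\<^bsub>HF D\<^esub> inv_arrow (HF D) (E k (t Y')) \<cdot>\<^bsub>HF D\<^esub> d"
    unfolding lift_def D_def[symmetric] 1 a_def b_def d_def using arr n(2) by (simp add: Y'_def j)
  also have "\<dots> = a \<cdot>\<^bsub>HF D\<^esub> (b \<cdot>\<^bsub>HF D\<^esub> inv_arrow (HF D) (E k (t Y'))) \<cdot>\<^bsub>HF D\<^esub> d"
    using iso arrs by (simp add: Comp_assoc is_iso_Arr)
  also have "\<dots> = a \<cdot>\<^bsub>HF D\<^esub> inv_arrow (HF D) (E k (t Y)) \<cdot>\<^bsub>HF D\<^esub> (e \<cdot>\<^bsub>HF D\<^esub> d)"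
    using iso arrs by (simp add: 2[folded b_def e_def] Comp_assoc is_iso_Arr)
  also have "\<dots> = (a \<cdot>\<^bsub>HF D\<^esub> inv_arrow (HF D) (E k (t Y)) \<cdot>\<^bsub>HF D\<^esub> c') \<cdot>\<^bsub>HF D\<^esub> E (k \<cdot>\<^bsub>S\<^esub> j) n"
    using iso arrs by (simp add: 3[folded d_def e_def c'_def] Comp_assoc is_iso_Arr)
  finally show ?thesis
    unfolding lift_def a_def c'_def by (simp add: D_def j Y_def)
qed

lemma cofibrant_source_t: "X \<in> Obj C \<Longrightarrow> cofibrant_source (t X)"
  using q_Cof[of X] by (simp add: cofibrant_source_def)

lemma cofibrant_source_Comp:
  assumes "cofibrant_source m" "v \<in> Arr C" "Cod C m = Dom C v"
  shows "cofibrant_source (v \<cdot> m)"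
proof -
  have "Cod S (FA m) = Dom S (FA v)" using assms cofibrant_source_Arr FO_Cod[of m] by simp
  then show ?thesis using assms by (simp add: cofibrant_source_def)
qed

text \<open>Functoriality of the action along arbitrary arrows. Write \<open>m\<close> as
  \<open>b\<close> after a cocartesian arrow \<open>M -> Y\<close>. Both
  \<open>v \<cdot> t (Dom C v) \<cdot> qa b\<close> and \<open>v \<cdot> b \<cdot> t Y\<close> are
  the same arrow, and each is handled by \<open>lift_Comp_cofibrant\<close>; inverting
  \<open>E k' (t Y)\<close> gives the claim.\<close>

lemma lift_Comp:
  assumes m: "cofibrant_source m" and v: "v \<in> Arr C" "Cod C m = Dom C v"
    and k: "k \<in> Arr S" "Dom S k = Cod S (FA v)"
  shows "lift k (v \<cdot> m) = lift k (v \<cdot> t (Dom C v)) \<cdot>\<^bsub>HF (Cod S k)\<^esub> lift (k \<cdot>\<^bsub>S\<^esub> FA v) m"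
proof -
  define D j k' where "D = Cod S k" and "j = FA m" and "k' = k \<cdot>\<^bsub>S\<^esub> FA v"
  define Y where "Y = Cod C (c j (Dom C m))"
  define b where "b = bar m"
  have marr: "m \<in> Arr C" using m cofibrant_source_Arr by simp
  have X: "Cod S j = Dom S (FA v)" using v marr FO_Cod[of m] by (simp add: j_def)
  have k' [simp]: "k' \<in> Arr S" "Dom S k' = Dom S (FA v)" "Cod S k' = D" using v k by (simp_all add: k'_def D_def)
  have YC: "Y \<in> Cof (Dom S (FA v))" using cofibrant_push[OF m] X by (simp add: Y_def j_def)
  then have Y [simp]: "Y \<in> Obj C" "FO Y = Dom S (FA v)" using Cof_D[of "Dom S (FA v)" Y] v by simp_all
  have b [simp]: "b \<in> Arr C" "Dom C b = Y" "Cod C b = Dom C v" "FA b = Idt S (Dom S (FA v))"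
    "qa b \<in> Arr C" "Dom C (qa b) = q Y" "Cod C (qa b) = q (Dom C v)" "FA (qa b) = Idt S (Dom S (FA v))"
    using marr v X by (simp_all add: b_def Y_def j_def)
  have cY [simp]: "c j (Dom C m) \<in> Arr C" "Dom C (c j (Dom C m)) = Dom C m" "Cod C (c j (Dom C m)) = Y"
    "FA (c j (Dom C m)) = j"
    using marr by (simp_all add: Y_def j_def)
  have cof: "cofibrant_source (v \<cdot> t (Dom C v))" "cofibrant_source (v \<cdot> b)" "cofibrant_source (qa b)"
      "cofibrant_source (t Y)" "cofibrant_source (c j (Dom C m))"
    subgoal using v cofibrant_source_t by (intro cofibrant_source_Comp) auto
    subgoal using v YC by (simp add: cofibrant_source_def)
    subgoal using q_Cof[of Y] v by (simp add: cofibrant_source_def)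
    subgoal using cofibrant_source_t by simp
    subgoal using m marr by (simp add: cofibrant_source_def j_def)
    done
  have iso: "is_iso (HF D) (E k' (t Y))" using E_t_iso[of k' Y] YC by simp
  have tb: "t (Dom C v) \<cdot> qa b = b \<cdot> t Y" using t_natural[of b "Dom S (FA v)"] v by simp
  have "lift k (v \<cdot> t (Dom C v)) \<cdot>\<^bsub>HF D\<^esub> E k' (qa b) = lift k ((v \<cdot> t (Dom C v)) \<cdot> qa b)"
    using lift_Comp_cofibrant[OF cof(1,3), of k] v k by (simp add: D_def k'_def)
  also have "\<dots> = lift k ((v \<cdot> b) \<cdot> t Y)"
    using v tb by (simp add: Comp_assoc)
  also have "\<dots> = lift k (v \<cdot> b) \<cdot>\<^bsub>HF D\<^esub> E k' (t Y)"
    using lift_Comp_cofibrant[OF cof(2,4), of k] v k by (simp add: D_def k'_def)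
  finally have 1: "lift k (v \<cdot> t (Dom C v)) \<cdot>\<^bsub>HF D\<^esub> E k' (qa b) = lift k (v \<cdot> b) \<cdot>\<^bsub>HF D\<^esub> E k' (t Y)" .
  have "v \<cdot> m = (v \<cdot> b) \<cdot> c j (Dom C m)"
    using v marr bar_simps(5)[OF marr] by (simp add: Comp_assoc b_def j_def)
  then have 2: "lift k (v \<cdot> m) = lift k (v \<cdot> b) \<cdot>\<^bsub>HF D\<^esub> E k' (c j (Dom C m))"
    using lift_Comp_cofibrant[OF cof(2,5), of k] v k by (simp add: D_def k'_def)
  have arrs: "D \<in> Obj S" "lift k (v \<cdot> t (Dom C v)) \<in> Arr (HF D)" "lift k (v \<cdot> b) \<in> Arr (HF D)"
    "Dom (HF D) (lift k (v \<cdot> t (Dom C v))) = Cod C (c k' (q (Dom C v)))"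
    "Dom (HF D) (lift k (v \<cdot> b)) = Cod C (c k' Y)"
    "E k' (qa b) \<in> Arr (HF D)" "Dom (HF D) (E k' (qa b)) = Cod C (c k' (q Y))"
      "Cod (HF D) (E k' (qa b)) = Cod C (c k' (q (Dom C v)))"
    "E k' (c j (Dom C m)) \<in> Arr (HF D)" "Cod (HF D) (E k' (c j (Dom C m))) = Cod C (c k' Y)"
    "Cod (HF D) (E k' (t Y)) = Cod C (c k' Y)" "Dom (HF D) (E k' (t Y)) = Cod C (c k' (q Y))"
    using cof v k X lift_simps[OF cof(1), of k] lift_simps[OF cof(2), of k] E_simps[of "qa b" k']
      E_simps[of "c j (Dom C m)" k'] E_simps[of "t Y" k'] by (simp_all add: D_def k'_def)
  have "lift k (v \<cdot> t (Dom C v)) \<cdot>\<^bsub>HF D\<^esub> lift k' m =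
      (lift k (v \<cdot> t (Dom C v)) \<cdot>\<^bsub>HF D\<^esub> E k' (qa b)) \<cdot>\<^bsub>HF D\<^esub> inv_arrow (HF D) (E k' (t Y)) \<cdot>\<^bsub>HF D\<^esub>
      E k' (c j (Dom C m))"
    using iso arrs unfolding lift_def[of k' m] by (simp add: Comp_assoc is_iso_Arr b_def[symmetric] j_def[symmetric])
  also have "\<dots> = lift k (v \<cdot> m)"
    unfolding 1 2 using iso arrs by (simp add: Comp_assoc is_iso_Arr)
  finally show ?thesis by (simp add: D_def k'_def)
qed

text \<open>The two arrows from \<open>q (q X)\<close> to \<open>q X\<close> need not agree in
  \<open>C\<close>. Here \<open>a\<close> is \<open>Q\<close> applied to \<open>t X\<close> and
  \<open>b\<close> is \<open>t\<close> at \<open>q X\<close>. Naturality gives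
  \<open>t X \<cdot> a = t X \<cdot> b\<close>, but \<open>t X\<close> cannot be cancelled, since
  \<open>X\<close> may fail to be cofibrant. Applying \<open>Q\<close> once more moves the equation
  to cofibrant objects, where \<open>E k\<close> turns weak equivalences into isomorphisms.\<close>

lemma E_qa_t:
  assumes X: "X \<in> Obj C" and k: "k \<in> Arr S" "Dom S k = FO X"
  shows "E k (qa (t X)) = E k (t (q X))"
proof -
  define D where "D = Cod S k"
  define a b t' where "a = qa (t X)" and "b = t (q X)" and "t' = t (q (q X))"
  have D [simp]: "D \<in> Obj S" using k by (simp add: D_def)
  have qa [simp]: "qa u \<in> Arr C" "Dom C (qa u) = q (Dom C u)" "Cod C (qa u) = q (Cod C u)"
    "FA (qa u) = Idt S (FO X)" if "u \<in> Arr C" "FA u = Idt S (FO X)" for u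
    using qa_simps[of u "FO X"] that X by simp_all
  have simps [simp]: "a \<in> Arr C" "b \<in> Arr C" "t' \<in> Arr C" "Dom C a = q (q X)" "Dom C b = q (q X)"
    "Cod C a = q X" "Cod C b = q X" "Dom C t' = q (q (q X))" "Cod C t' = q (q X)"
    "FA a = Idt S (FO X)" "FA b = Idt S (FO X)" "FA t' = Idt S (FO X)"
    using X by (simp_all add: a_def b_def t'_def)
  have cof: "q X \<in> Cof (FO X)" "q (q X) \<in> Cof (FO X)" "q (q (q X)) \<in> Cof (FO X)"
    using X q_Cof[of X] q_Cof[of "q X"] q_Cof[of "q (q X)"] by simp_all
  have W: "a \<in> W (FO X)" "b \<in> W (FO X)" "t' \<in> W (FO X)" "qa a \<in> W (FO X)"
    using X t_weq[of X] t_weq[of "q X"] t_weq[of "q (q X)"] qa_weq[of "t X" "FO X"] qa_weq[of a "FO X"]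
    by (simp_all add: a_def b_def t'_def)
  have E1: "E k (u \<cdot> v) = E k u \<cdot>\<^bsub>HF D\<^esub> E k v"
    if "u \<in> Arr C" "v \<in> Arr C" "Cod C v = Dom C u" "FA u = Idt S (FO X)" for u v
    using that X k E_Comp[of u v k] by (simp add: D_def)
  have Earr [simp]: "E k u \<in> Arr (HF D)" "Dom (HF D) (E k u) = Cod C (c k (Dom C u))"
    "Cod (HF D) (E k u) = Cod C (c k (Cod C u))" if "u \<in> Arr C" "FA u = Idt S (FO X)" for u
    using that X k E_simps[of u k] by (simp_all add: D_def)
  have iso: "is_iso (HF D) (E k u)" if "u \<in> W (FO X)" "Dom C u \<in> Cof (FO X)" "Cod C u \<in> Cof (FO X)" for u
    using that E_iso[of k u] k by (simp add: D_def)
  have ab: "t X \<cdot> a = t X \<cdot> b" using t_natural[of "t X" "FO X"] X by (simp add: a_def b_def)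
  \<comment> \<open>The image under \<open>Q\<close> of
    \<open>t X \<cdot> a = t X \<cdot> b\<close>; the arrow in front is now \<open>a\<close>, which
    \<open>E k\<close> inverts.\<close>
  have "a \<cdot> qa a = a \<cdot> qa b"
  proof -
    have "a \<cdot> qa u = qa (t X \<cdot> u)" if "u \<in> Arr C" "FA u = Idt S (FO X)" "Cod C u = q X" for u
      unfolding a_def using that X by (subst qa_Comp[of u "FO X" "t X"]) auto
    then show ?thesis using ab by simp
  qed
  then have "E k a \<cdot>\<^bsub>HF D\<^esub> E k (qa a) = E k a \<cdot>\<^bsub>HF D\<^esub> E k (qa b)"
    using E1[of a "qa a"] E1[of a "qa b"] by simp
  then have 1: "E k (qa a) = E k (qa b)"
    by (rule iso_Comp_cancel[rotated]) (use iso[of a] W cof in auto)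
  have nat: "b \<cdot> qa a = a \<cdot> t'" "b \<cdot> qa b = b \<cdot> t'"
    using t_natural[of a "FO X"] t_natural[of b "FO X"] X by (simp_all add: b_def t'_def a_def)
  then have "E k b \<cdot>\<^bsub>HF D\<^esub> E k (qa b) = E k b \<cdot>\<^bsub>HF D\<^esub> E k t'"
    using E1[of b "qa b"] E1[of b t'] by simp
  then have 2: "E k (qa b) = E k t'"
    by (rule iso_Comp_cancel[rotated]) (use iso[of b] W cof in auto)
  \<comment> \<open>All of \<open>qa a\<close>, \<open>qa b\<close> and \<open>t'\<close> have been
    identified, so naturality of \<open>t\<close> at \<open>a\<close> compares \<open>a\<close> with
    \<open>b\<close> after the invertible \<open>t'\<close>.\<close>
  have "E k a \<cdot>\<^bsub>HF D\<^esub> E k t' = E k b \<cdot>\<^bsub>HF D\<^esub> E k t'"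
    using nat(1) E1[of b "qa a"] E1[of a t'] 1 2 by simp
  then have "E k a = E k b"
    by (rule Comp_iso_cancel[rotated]) (use iso[of t'] W cof in auto)
  then show ?thesis by (simp add: a_def b_def)
qed

text \<open>The unit law. Naturality of \<open>t\<close> at the cocartesian arrow \<open>d\<close>
  moves the inverse to the right end; what remains in front is \<open>E k (qa (t X))\<close>, which
  cancels by \<open>E_qa_t\<close>.\<close>

lemma lift_t:
  assumes X: "X \<in> Obj C" and k: "k \<in> Arr S" "Dom S k = FO X"
  shows "lift k (t X) = Idt (HF (Cod S k)) (Cod C (c k (q X)))"
proof -
  define D where "D = Cod S k"
  define Y d b where "Y = Cod C (c (Idt S (FO X)) (q X))" and "d = c (Idt S (FO X)) (q X)" and "b = bar (t X)"
  have D [simp]: "D \<in> Obj S" using k by (simp add: D_def)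
  have d [simp]: "d \<in> Arr C" "Dom C d = q X" "Cod C d = Y" "FA d = Idt S (FO X)"
    using X by (simp_all add: d_def Y_def)
  have Y [simp]: "Y \<in> Obj C" "FO Y = FO X" using X by (simp_all add: Y_def)
  have YC: "Y \<in> Cof (FO X)" using cofibrant_push[OF cofibrant_source_t[OF X]] X by (simp add: Y_def)
  have b [simp]: "b \<in> Arr C" "Dom C b = Y" "Cod C b = X" "FA b = Idt S (FO X)"
    using X by (simp_all add: b_def Y_def)
  have bd: "b \<cdot> d = t X" using bar_simps(5)[of "t X"] X by (simp add: b_def d_def)
  have qa [simp]: "qa u \<in> Arr C" "Dom C (qa u) = q (Dom C u)" "Cod C (qa u) = q (Cod C u)"
    "FA (qa u) = Idt S (FO X)" if "u \<in> Arr C" "FA u = Idt S (FO X)" for u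
    using qa_simps[of u "FO X"] that X by simp_all
  have E1: "E k (u \<cdot> v) = E k u \<cdot>\<^bsub>HF D\<^esub> E k v"
    if "u \<in> Arr C" "v \<in> Arr C" "Cod C v = Dom C u" "FA u = Idt S (FO X)" for u v
    using that X k E_Comp[of u v k] by (simp add: D_def)
  have Earr [simp]: "E k u \<in> Arr (HF D)" "Dom (HF D) (E k u) = Cod C (c k (Dom C u))"
    "Cod (HF D) (E k u) = Cod C (c k (Cod C u))" if "u \<in> Arr C" "FA u = Idt S (FO X)" for u
    using that X k E_simps[of u k] by (simp_all add: D_def)
  have iso: "is_iso (HF D) (E k (t Y))" "is_iso (HF D) (E k (t (q X)))"
    using E_t_iso[of k Y] E_t_iso[of k "q X"] q_Cof[OF X] YC k by (simp_all add: D_def)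
  have [simp]: "t Y \<in> Arr C" "t (q X) \<in> Arr C" using X by simp_all
  have "t Y \<cdot> qa d = d \<cdot> t (q X)" using t_natural[of d "FO X"] X by simp
  then have "E k (t Y) \<cdot>\<^bsub>HF D\<^esub> E k (qa d) = E k d \<cdot>\<^bsub>HF D\<^esub> E k (t (q X))"
    using E1[of "t Y" "qa d"] E1[of d "t (q X)"] X by simp
  then have sq: "E k (qa d) \<cdot>\<^bsub>HF D\<^esub> inv_arrow (HF D) (E k (t (q X))) = inv_arrow (HF D) (E k (t Y)) \<cdot>\<^bsub>HF D\<^esub> E k d"
    using iso X by (intro iso_square) simp_all
  have "lift k (t X) = E k (qa b) \<cdot>\<^bsub>HF D\<^esub> inv_arrow (HF D) (E k (t Y)) \<cdot>\<^bsub>HF D\<^esub> E k d"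
    using X by (simp add: lift_def D_def Y_def d_def b_def)
  also have "\<dots> = (E k (qa b) \<cdot>\<^bsub>HF D\<^esub> E k (qa d)) \<cdot>\<^bsub>HF D\<^esub> inv_arrow (HF D) (E k (t (q X)))"
    unfolding sq[symmetric] using iso X by (simp add: Comp_assoc is_iso_Arr)
  also have "E k (qa b) \<cdot>\<^bsub>HF D\<^esub> E k (qa d) = E k (qa (b \<cdot> d))"
    using E1[of "qa b" "qa d"] qa_Comp[of d "FO X" b] X by simp
  also have "\<dots> = E k (t (q X))" using bd E_qa_t[OF X k] by simp
  finally have "lift k (t X) = Idt (HF D) (Cod C (c k (q X)))" using iso X by simp
  then show ?thesis by (simp add: D_def)
qed

text \<open>The chosen pushforward along an identity need not be the identity functor, so the counit
  starts at the pushforward of \<open>q Z\<close> along the identity and not at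
  \<open>q Z\<close>.\<close>

definition counit :: "'o \<Rightarrow> ('o, 'a) zigzag set" where
  "counit Z = L (FO Z) (bar (t Z))"

text \<open>After the counit the zigzag in \<open>lift\<close> collapses: naturality of
  \<open>t\<close> at \<open>b\<close> replaces its last leg by \<open>t Y\<close>, which cancels
  against the inverse, and the vertical factors compose by \<open>bar_Comp\<close>.\<close>

lemma counit_lift:
  assumes m: "cofibrant_source m" "Cod C m = Z"
  shows "counit Z \<cdot>\<^bsub>HF (FO Z)\<^esub> lift (Idt S (FO Z)) m = L (FO Z) (bar m)"
proof -
  define D Y b d where "D = FO Z" and "Y = Cod C (c (FA m) (Dom C m))" and "b = bar m" and "d = c (FA m) (Dom C m)"
  have marr: "m \<in> Arr C" using m cofibrant_source_Arr by simp
  have Z [simp]: "Z \<in> Obj C" "FO Z = D" "D \<in> Obj S" using m(2) marr by (auto simp: D_def)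
  have DD: "Cod S (FA m) = D" using m(2) marr FO_Cod[of m] by simp
  have Y [simp]: "Y \<in> Obj C" "FO Y = D" using marr DD by (simp_all add: Y_def)
  have d [simp]: "d \<in> Arr C" "Dom C d = Dom C m" "Cod C d = Y" "FA d = FA m"
    using marr by (simp_all add: d_def Y_def)
  have b [simp]: "b \<in> Arr C" "Dom C b = Y" "Cod C b = Z" "FA b = Idt S D"
    using marr DD m(2) by (simp_all add: b_def Y_def)
  have bd: "b \<cdot> d = m" using bar_simps(5)[OF marr] by (simp add: b_def d_def)
  have qb [simp]: "qa b \<in> Arr C" "Dom C (qa b) = q Y" "Cod C (qa b) = q Z" "FA (qa b) = Idt S D"
    using qa_simps[of b D] by simp_all
  have iso: "is_iso (HF D) (E (Idt S D) (t Y))"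
    using lift_iso[OF m(1), of "Idt S D"] marr DD by (simp add: Y_def)
  have barp: "L D (bar u) \<cdot>\<^bsub>HF D\<^esub> E (Idt S D) v = L D (bar (u \<cdot> v))"
    if "u \<in> Arr C" "v \<in> Arr C" "Cod C v = Dom C u" "FA u = Idt S D" "Cod S (FA v) = D" for u v
    using that by (simp add: E_def L_Comp bar_Comp)
  have 1: "counit Z \<cdot>\<^bsub>HF D\<^esub> E (Idt S D) (qa b) = L D (bar b) \<cdot>\<^bsub>HF D\<^esub> E (Idt S D) (t Y)"
    using barp[of "t Z" "qa b"] barp[of b "t Y"] t_natural[of b D] by (simp add: counit_def)
  have Earr: "E (Idt S D) (qa b) \<in> Arr (HF D)" "Cod (HF D) (E (Idt S D) (qa b)) = Cod C (c (Idt S D) (q Z))"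
    "Dom (HF D) (E (Idt S D) (qa b)) = Cod C (c (Idt S D) (q Y))"
    "E (Idt S D) d \<in> Arr (HF D)" "Cod (HF D) (E (Idt S D) d) = Cod C (c (Idt S D) Y)"
    "E (Idt S D) (t Y) \<in> Arr (HF D)" "Cod (HF D) (E (Idt S D) (t Y)) = Cod C (c (Idt S D) Y)"
    "Dom (HF D) (E (Idt S D) (t Y)) = Cod C (c (Idt S D) (q Y))"
    using E_simps[of "qa b" "Idt S D"] E_simps[of d "Idt S D"] E_simps[of "t Y" "Idt S D"] DD marr by simp_all
  have "counit Z \<cdot>\<^bsub>HF D\<^esub> lift (Idt S D) m =
      (counit Z \<cdot>\<^bsub>HF D\<^esub> E (Idt S D) (qa b)) \<cdot>\<^bsub>HF D\<^esub> inv_arrow (HF D) (E (Idt S D) (t Y)) \<cdot>\<^bsub>HF D\<^esub> E (Idt S D) d"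
    unfolding lift_def counit_def using iso Earr
    by (simp add: Comp_assoc is_iso_Arr b_def[symmetric] d_def[symmetric])
  also have "\<dots> = L D (bar b) \<cdot>\<^bsub>HF D\<^esub> E (Idt S D) d"
    unfolding 1 using iso Earr by (simp add: Comp_assoc is_iso_Arr)
  also have "\<dots> = L D (bar m)"
    using barp[of b d] DD bd by simp
  finally show ?thesis by simp
qed

lemma N_square:
  assumes "u \<in> Arr C" "v \<in> Arr C" "u' \<in> Arr C" "v' \<in> Arr C" "Cod C u = Dom C v" "Cod C u' = Dom C v'"
    "v \<cdot> u = v' \<cdot> u'"
  shows "N v \<cdot>\<^bsub>H\<^esub> N u = N v' \<cdot>\<^bsub>H\<^esub> N u'"
  using assms N_Comp[of u v] N_Comp[of u' v'] by simp

lemma \<iota>_E: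
  assumes "n \<in> Arr C" "k \<in> Arr S" "Dom S k = Cod S (FA n)"
  shows "FArr (\<iota> (Cod S k)) (E k n) = N (p k n)"
  using assms by (simp add: E_def)

text \<open>Identifies \<open>lift k m\<close> in the total homotopy category: it is compatible with
  the canonical arrows from the replacements to their pushforwards. Squares 1, 2 and 3 treat the
  three legs of the zigzag, and 4 is naturality of \<open>t\<close>.\<close>

lemma \<iota>_lift:
  assumes m: "cofibrant_source m" and k: "k \<in> Arr S" "Dom S k = Cod S (FA m)"
  shows "FArr (\<iota> (Cod S k)) (lift k m) \<cdot>\<^bsub>H\<^esub> N (c (k \<cdot>\<^bsub>S\<^esub> FA m) (Dom C m)) =
    N (c k (q (Cod C m))) \<cdot>\<^bsub>H\<^esub> inv_arrow H (N (t (Cod C m))) \<cdot>\<^bsub>H\<^esub> N m"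
proof -
  define D X j d b where "D = Cod S k" and "X = Cod C m" and "j = FA m" and "d = c j (Dom C m)" and "b = bar m"
  define Y where "Y = Cod C d"
  have marr: "m \<in> Arr C" using m cofibrant_source_Arr by simp
  have j [simp]: "j \<in> Arr S" "FA m = j" "Dom S k = Cod S j" "FO X = Cod S j" "X \<in> Obj C"
    using marr k by (simp_all add: j_def X_def)
  have d [simp]: "d \<in> Arr C" "Dom C d = Dom C m" "Cod C d = Y" "FA d = j"
    using marr by (simp_all add: d_def Y_def)
  have Y [simp]: "Y \<in> Obj C" "FO Y = Cod S j" using FO_Cod[of d] by (auto simp: Y_def simp del: FO_Cod d(3))
  have b [simp]: "b \<in> Arr C" "Dom C b = Y" "Cod C b = X" "FA b = Idt S (Cod S j)" "b \<cdot> d = m"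
    using marr bar_simps[OF marr] by (simp_all add: b_def d_def X_def Y_def)
  have qb [simp]: "qa b \<in> Arr C" "Dom C (qa b) = q Y" "Cod C (qa b) = q X" "FA (qa b) = Idt S (Cod S j)"
    using qa_simps[of b "Cod S j"] by simp_all
  have D [simp]: "D \<in> Obj S" "Cod S k = D" "k \<in> Arr S" using k by (simp_all add: D_def)
  have iso: "is_iso H (N (t Y))" "is_iso H (N (t X))"
    using N_iso[OF _ t_weq] by simp_all
  have YC: "Y \<in> Cof (Dom S k)" using cofibrant_push[OF m] by (simp add: Y_def d_def)
  have "p k (t Y) \<in> W D" using p_weq[of k "t Y"] t_weq[of Y] q_Cof[of Y] YC by simp
  then have isop: "is_iso H (N (p k (t Y)))" using N_iso[of D] by simp
  have isoE: "is_iso (HF D) (E k (t Y))" using E_t_iso[of k Y] YC by simp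
  have [simp]: "Dom C m \<in> Obj C" using marr by simp
  have arr: "p k (qa b) \<in> Arr C" "Dom C (p k (qa b)) = Cod C (c k (q Y))" "Cod C (p k (qa b)) = Cod C (c k (q X))"
    "FA (p k (qa b)) = Idt S D"
    "p k (t Y) \<in> Arr C" "Dom C (p k (t Y)) = Cod C (c k (q Y))" "Cod C (p k (t Y)) = Cod C (c k Y)"
    "FA (p k (t Y)) = Idt S D"
    "p k d \<in> Arr C" "Dom C (p k d) = Cod C (c (k \<cdot>\<^bsub>S\<^esub> j) (Dom C m))" "Cod C (p k d) = Cod C (c k Y)"
    "FA (p k d) = Idt S D"
    using p_simps[of "qa b" k] p_simps[of "t Y" k] p_simps[of d k] by simp_all
  have carr: "c (k \<cdot>\<^bsub>S\<^esub> j) (Dom C m) \<in> Arr C" "Dom C (c (k \<cdot>\<^bsub>S\<^esub> j) (Dom C m)) = Dom C m"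
    using marr by (simp_all)
  have "N (p k d) \<cdot>\<^bsub>H\<^esub> N (c (k \<cdot>\<^bsub>S\<^esub> j) (Dom C m)) = N (c k Y) \<cdot>\<^bsub>H\<^esub> N d"
    using p_c[of d k] arr carr by (intro N_square) simp_all
  note 1 = this
  have "N (p k (t Y)) \<cdot>\<^bsub>H\<^esub> N (c k (q Y)) = N (c k Y) \<cdot>\<^bsub>H\<^esub> N (t Y)"
    using p_c[of "t Y" k] arr by (intro N_square) simp_all
  then have "N (c k (q Y)) \<cdot>\<^bsub>H\<^esub> inv_arrow H (N (t Y)) = inv_arrow H (N (p k (t Y))) \<cdot>\<^bsub>H\<^esub> N (c k Y)"
    using iso isop arr by (intro iso_square) simp_all
  note 2 = this
  have 3: "N (p k (qa b)) \<cdot>\<^bsub>H\<^esub> N (c k (q Y)) = N (c k (q X)) \<cdot>\<^bsub>H\<^esub> N (qa b)"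
    using p_c[of "qa b" k] arr by (intro N_square) simp_all
  have "N (t X) \<cdot>\<^bsub>H\<^esub> N (qa b) = N b \<cdot>\<^bsub>H\<^esub> N (t Y)"
    using t_natural[of b "Cod S j"] by (intro N_square) simp_all
  then have 4: "N (qa b) \<cdot>\<^bsub>H\<^esub> inv_arrow H (N (t Y)) = inv_arrow H (N (t X)) \<cdot>\<^bsub>H\<^esub> N b"
    using iso by (intro iso_square) simp_all
  have "FArr (\<iota> D) (lift k m) = N (p k (qa b)) \<cdot>\<^bsub>H\<^esub> inv_arrow H (N (p k (t Y))) \<cdot>\<^bsub>H\<^esub> N (p k d)"
  proof -
    have e: "E k (qa b) \<in> Arr (HF D)" "Dom (HF D) (E k (qa b)) = Cod C (c k (q Y))"
      "E k d \<in> Arr (HF D)" "Cod (HF D) (E k d) = Cod C (c k Y)"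
      "E k (t Y) \<in> Arr (HF D)" "Dom (HF D) (E k (t Y)) = Cod C (c k (q Y))" "Cod (HF D) (E k (t Y)) = Cod C (c k Y)"
      using E_simps[of "qa b" k] E_simps[of d k] E_simps[of "t Y" k] by simp_all
    have "lift k m = E k (qa b) \<cdot>\<^bsub>HF D\<^esub> inv_arrow (HF D) (E k (t Y)) \<cdot>\<^bsub>HF D\<^esub> E k d"
      using marr by (simp add: lift_def b_def d_def Y_def)
    then show ?thesis
      using e isoE \<iota>_E[of "qa b" k] \<iota>_E[of "t Y" k] \<iota>_E[of d k]
      by (simp add: \<iota>_Comp functor_inv[OF \<iota>_functor])
  qed
  then have "FArr (\<iota> D) (lift k m) \<cdot>\<^bsub>H\<^esub> N (c (k \<cdot>\<^bsub>S\<^esub> j) (Dom C m)) =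
      N (p k (qa b)) \<cdot>\<^bsub>H\<^esub> inv_arrow H (N (p k (t Y))) \<cdot>\<^bsub>H\<^esub> (N (p k d) \<cdot>\<^bsub>H\<^esub> N (c (k \<cdot>\<^bsub>S\<^esub> j) (Dom C m)))"
    using arr carr isop by (simp add: Comp_assoc)
  also have "\<dots> = N (p k (qa b)) \<cdot>\<^bsub>H\<^esub> (inv_arrow H (N (p k (t Y))) \<cdot>\<^bsub>H\<^esub> N (c k Y)) \<cdot>\<^bsub>H\<^esub> N d"
    unfolding 1 using arr isop by (simp add: Comp_assoc)
  also have "\<dots> = (N (p k (qa b)) \<cdot>\<^bsub>H\<^esub> N (c k (q Y))) \<cdot>\<^bsub>H\<^esub> inv_arrow H (N (t Y)) \<cdot>\<^bsub>H\<^esub> N d"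
    unfolding 2[symmetric] using arr iso by (simp add: Comp_assoc)
  also have "\<dots> = N (c k (q X)) \<cdot>\<^bsub>H\<^esub> (N (qa b) \<cdot>\<^bsub>H\<^esub> inv_arrow H (N (t Y))) \<cdot>\<^bsub>H\<^esub> N d"
    unfolding 3 using arr iso by (simp add: Comp_assoc)
  also have "\<dots> = N (c k (q X)) \<cdot>\<^bsub>H\<^esub> inv_arrow H (N (t X)) \<cdot>\<^bsub>H\<^esub> (N b \<cdot>\<^bsub>H\<^esub> N d)"
    unfolding 4 using arr iso by (simp add: Comp_assoc)
  also have "N b \<cdot>\<^bsub>H\<^esub> N d = N m"
    using N_Comp[of d b] by simp
  finally show ?thesis by (simp add: X_def)
qed

section \<open>The presheaf of derived factorizations\<close>

text \<open>The elements over \<^term>\<open>X\<close> of the presheaf represented by \<^term>\<open>Z\<close>.\<close>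

definition elems :: "'o \<Rightarrow> 'o \<Rightarrow> ('s \<times> ('o, 'a) zigzag set) set" where
  "elems Z X = {(k, g). k \<in> hom S (FO X) (FO Z) \<and> g \<in> hom (HF (FO Z)) (Cod C (c k (q X))) Z}"

definition pullback_elem :: "'o \<Rightarrow> 'a \<Rightarrow> 's \<times> ('o, 'a) zigzag set \<Rightarrow> 's \<times> ('o, 'a) zigzag set" where
  "pullback_elem Z u = (\<lambda>(k, g). (k \<cdot>\<^bsub>S\<^esub> FA u, g \<cdot>\<^bsub>HF (FO Z)\<^esub> lift k (u \<cdot> t (Dom C u))))"

lemma cofibrant_source_Comp_t: "u \<in> Arr C \<Longrightarrow> cofibrant_source (u \<cdot> t (Dom C u))"
  using cofibrant_source_Comp[OF cofibrant_source_t, of "Dom C u" u] by simp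

lemma lift_Comp_t_simps:
  assumes "u \<in> Arr C" "k \<in> Arr S" "Dom S k = Cod S (FA u)"
  shows "lift k (u \<cdot> t (Dom C u)) \<in> Arr (HF (Cod S k))"
    "Dom (HF (Cod S k)) (lift k (u \<cdot> t (Dom C u))) = Cod C (c (k \<cdot>\<^bsub>S\<^esub> FA u) (q (Dom C u)))"
    "Cod (HF (Cod S k)) (lift k (u \<cdot> t (Dom C u))) = Cod C (c k (q (Cod C u)))"
  using assms lift_simps[OF cofibrant_source_Comp_t, of u k] by simp_all

text \<open>Naturality of \<open>t\<close> and the unit law reduce this to
  \<open>E k (qa w)\<close>, and \<open>qa w\<close> is a weak equivalence between cofibrant
  objects.\<close>

lemma lift_weq_iso:
  assumes "A \<in> Obj S" "w \<in> W A" "k \<in> Arr S" "Dom S k = A"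
  shows "is_iso (HF (Cod S k)) (lift k (w \<cdot> t (Dom C w)))"
proof -
  have w: "w \<in> Arr C" "FA w = Idt S A" using W_D assms(1,2) by simp_all
  have FO: "FO (Dom C w) = A" "FO (Cod C w) = A" using w assms(1) by simp_all
  have qw: "qa w \<in> Arr C" "Dom C (qa w) = q (Dom C w)" "Cod C (qa w) = q (Cod C w)" "FA (qa w) = Idt S A"
    using qa_simps[of w A] w assms(1) by simp_all
  have "w \<cdot> t (Dom C w) = t (Cod C w) \<cdot> qa w" using t_natural[of w A] w assms(1) by simp
  then have "lift k (w \<cdot> t (Dom C w)) = lift k (t (Cod C w)) \<cdot>\<^bsub>HF (Cod S k)\<^esub> E k (qa w)"
    using lift_Comp_cofibrant[of "t (Cod C w)" "qa w" k] qw w assms FO cofibrant_source_t[of "Cod C w"]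
      q_Cof[of "Dom C w"] by (simp add: cofibrant_source_def)
  also have "\<dots> = E k (qa w)"
    using lift_t[of "Cod C w" k] w assms FO qw E_simps[of "qa w" k] by simp
  finally show ?thesis
    using E_iso[of k "qa w"] qa_weq[of w A] w assms qw FO q_Cof[of "Dom C w"] q_Cof[of "Cod C w"] by simp
qed

context
  fixes Z assumes Z [simp]: "Z \<in> Obj C"
begin

lemma pullback_elem_in:
  assumes "u \<in> Arr C" "x \<in> elems Z (Cod C u)"
  shows "pullback_elem Z u x \<in> elems Z (Dom C u)"
proof -
  obtain k g where x: "x = (k, g)" "k \<in> Arr S" "Dom S k = Cod S (FA u)" "Cod S k = FO Z"
    "g \<in> hom (HF (FO Z)) (Cod C (c k (q (Cod C u)))) Z"
    using assms by (auto simp: elems_def)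
  then show ?thesis
    using assms(1) lift_Comp_t_simps[of u k] by (simp add: elems_def pullback_elem_def)
qed

lemma pullback_elem_Idt:
  assumes "X \<in> Obj C" "x \<in> elems Z X"
  shows "pullback_elem Z (Idt C X) x = x"
  using assms lift_t[of X] by (auto simp: elems_def pullback_elem_def)

lemma pullback_elem_Comp:
  assumes u: "u \<in> Arr C" and v: "v \<in> Arr C" "Cod C u = Dom C v" and x: "x \<in> elems Z (Cod C v)"
  shows "pullback_elem Z (v \<cdot> u) x = pullback_elem Z u (pullback_elem Z v x)"
proof -
  obtain k g where x: "x = (k, g)" "k \<in> Arr S" "Dom S k = Cod S (FA v)" "Cod S k = FO Z"
    "g \<in> hom (HF (FO Z)) (Cod C (c k (q (Cod C v)))) Z"
    using x v by (auto simp: elems_def)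
  have uv: "Cod S (FA u) = Dom S (FA v)" using u v FO_Cod[of u] by simp
  have "lift k ((v \<cdot> u) \<cdot> t (Dom C u)) =
      lift k (v \<cdot> t (Dom C v)) \<cdot>\<^bsub>HF (FO Z)\<^esub> lift (k \<cdot>\<^bsub>S\<^esub> FA v) (u \<cdot> t (Dom C u))"
    using lift_Comp[of "u \<cdot> t (Dom C u)" v k] cofibrant_source_Comp_t[OF u] u v x
    by (simp add: Comp_assoc)
  moreover have "lift (k \<cdot>\<^bsub>S\<^esub> FA v) (u \<cdot> t (Dom C u)) \<in> hom (HF (FO Z))
      (Cod C (c ((k \<cdot>\<^bsub>S\<^esub> FA v) \<cdot>\<^bsub>S\<^esub> FA u) (q (Dom C u)))) (Cod C (c (k \<cdot>\<^bsub>S\<^esub> FA v) (q (Dom C v))))"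
    using lift_Comp_t_simps[of u "k \<cdot>\<^bsub>S\<^esub> FA v"] u v x uv by simp
  ultimately show ?thesis
    using u v x uv lift_Comp_t_simps[of v k] by (simp add: pullback_elem_def Comp_assoc)
qed

text \<open>The first component is unchanged because \<open>w\<close> lies over an identity, and the
  second is composed with the isomorphism of \<open>lift_weq_iso\<close>. This is the condition
  under which the presheaf extends to the localization.\<close>

lemma pullback_elem_bij:
  assumes "w \<in> Arr C" "w \<in> all_weqs S W"
  shows "bij_betw (pullback_elem Z w) (elems Z (Cod C w)) (elems Z (Dom C w))"
proof -
  obtain A where A: "A \<in> Obj S" "w \<in> W A" using assms(2) by (rule all_weqs_D)
  then have w: "w \<in> Arr C" "FA w = Idt S A" using W_D by simp_all
  have FO: "FO (Dom C w) = A" "FO (Cod C w) = A" using w A(1) by simp_all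
  let ?l = "\<lambda>k. lift k (w \<cdot> t (Dom C w))"
  have l: "is_iso (HF (FO Z)) (?l k)" "?l k \<in> Arr (HF (FO Z))"
     "Dom (HF (FO Z)) (?l k) = Cod C (c k (q (Dom C w)))" "Cod (HF (FO Z)) (?l k) = Cod C (c k (q (Cod C w)))"
    if "k \<in> Arr S" "Dom S k = A" "Cod S k = FO Z" for k
    using lift_weq_iso[OF A, of k] lift_Comp_t_simps[of w k] that w A by simp_all
  have dom: "k \<in> Arr S \<and> Dom S k = A \<and> Cod S k = FO Z \<and> g \<in> Arr (HF (FO Z)) \<and>
      Dom (HF (FO Z)) g = Cod C (c k (q X)) \<and> Cod (HF (FO Z)) g = Z"
    if "(k, g) \<in> elems Z X" "FO X = A" for k g X
    using that by (auto simp: elems_def)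
  show ?thesis
  proof (rule bij_betw_imageI)
    show "inj_on (pullback_elem Z w) (elems Z (Cod C w))"
    proof (rule inj_onI, clarify)
      fix k g k' g'
      assume kg: "(k, g) \<in> elems Z (Cod C w)" "(k', g') \<in> elems Z (Cod C w)"
        and eq: "pullback_elem Z w (k, g) = pullback_elem Z w (k', g')"
      note kg = dom[OF kg(1) FO(2)] dom[OF kg(2) FO(2)]
      have "k' = k" using kg eq w A(1) by (simp add: pullback_elem_def)
      moreover have "g = g'"
        by (rule Comp_iso_cancel[of "HF (FO Z)" _ "?l k"])
          (use kg eq l[of k] \<open>k' = k\<close> in \<open>auto simp: pullback_elem_def\<close>)
      ultimately show "k = k' \<and> g = g'" by simp
    qed
    show "pullback_elem Z w ` elems Z (Cod C w) = elems Z (Dom C w)"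
    proof (intro equalityI subsetI)
      fix x assume "x \<in> pullback_elem Z w ` elems Z (Cod C w)"
      then show "x \<in> elems Z (Dom C w)" using pullback_elem_in[OF w(1)] by auto
    next
      fix x assume x: "x \<in> elems Z (Dom C w)"
      obtain k g where xk: "x = (k, g)" by (cases x)
      note kg = dom[OF x[unfolded xk] FO(1)]
      have "(k, g \<cdot>\<^bsub>HF (FO Z)\<^esub> inv_arrow (HF (FO Z)) (?l k)) \<in> elems Z (Cod C w)"
        using kg l[of k] w A by (simp add: elems_def)
      moreover have "pullback_elem Z w (k, g \<cdot>\<^bsub>HF (FO Z)\<^esub> inv_arrow (HF (FO Z)) (?l k)) = x"
        using kg l[of k] w A by (simp add: pullback_elem_def xk Comp_assoc)
      ultimately show "x \<in> pullback_elem Z w ` elems Z (Cod C w)" by (metis imageI)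
    qed
  qed
qed

end

lemma N_t_iso [simp]: "X \<in> Obj C \<Longrightarrow> is_iso H (N (t X))"
  using N_iso[OF _ t_weq] by simp

section \<open>Comparison with the arrows into \<open>Z\<close> in the total homotopy
  category\<close>

context
  fixes Z assumes Z [simp]: "Z \<in> Obj C"
begin

lemma counit_simps [simp]:
  "counit Z \<in> Arr (HF (FO Z))" "Dom (HF (FO Z)) (counit Z) = Cod C (c (Idt S (FO Z)) (q Z))"
  "Cod (HF (FO Z)) (counit Z) = Z"
  by (simp_all add: counit_def)

lemma counit_elem: "(Idt S (FO Z), counit Z) \<in> elems Z Z"
  by (simp add: elems_def)

lemma counit_natural:
  assumes "u \<in> Arr C" "FA u = Idt S (FO Z)"
  shows "counit (Cod C u) \<cdot>\<^bsub>HF (FO Z)\<^esub> lift (Idt S (FO Z)) (u \<cdot> t (Dom C u)) =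
    L (FO Z) u \<cdot>\<^bsub>HF (FO Z)\<^esub> counit (Dom C u)"
proof -
  have FO: "FO (Dom C u) = FO Z" "FO (Cod C u) = FO Z" using assms by simp_all
  have "bar (u \<cdot> t (Dom C u)) = u \<cdot> bar (t (Dom C u))"
    using assms by (intro bar_vertical) simp_all
  then have "L (FO Z) (bar (u \<cdot> t (Dom C u))) = L (FO Z) u \<cdot>\<^bsub>HF (FO Z)\<^esub> counit (Dom C u)"
    using assms FO by (simp add: counit_def L_Comp)
  then show ?thesis
    using counit_lift[OF cofibrant_source_Comp_t[OF assms(1)], of "Cod C u"] assms FO by simp
qed

text \<open>The arrow \<open>X \<rightarrow> Z\<close> of the homotopy category that corresponds to an element of the presheaf.\<close>

definition realize :: "'o \<Rightarrow> 's \<times> ('o, 'a) zigzag set \<Rightarrow> ('o, 'a) zigzag set" where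
  "realize X = (\<lambda>(k, g). FArr (\<iota> (FO Z)) g \<cdot>\<^bsub>H\<^esub> N (c k (q X)) \<cdot>\<^bsub>H\<^esub> inv_arrow H (N (t X)))"

lemma realize_simps:
  assumes "(k, g) \<in> elems Z X" "X \<in> Obj C"
  shows "realize X (k, g) \<in> Arr H" "Dom H (realize X (k, g)) = X" "Cod H (realize X (k, g)) = Z"
    "FArr \<pi> (realize X (k, g)) = k"
proof -
  have kg: "k \<in> Arr S" "Dom S k = FO X" "Cod S k = FO Z" "g \<in> Arr (HF (FO Z))"
    "Dom (HF (FO Z)) g = Cod C (c k (q X))" "Cod (HF (FO Z)) g = Z"
    using assms by (auto simp: elems_def)
  have inv: "FArr \<pi> (inv_arrow H (N (t X))) = Idt S (FO X)"
    using functor_inv[OF \<pi>_functor, of "N (t X)"] assms(2) by simp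
  show "realize X (k, g) \<in> Arr H" "Dom H (realize X (k, g)) = X" "Cod H (realize X (k, g)) = Z"
    "FArr \<pi> (realize X (k, g)) = k"
    using kg assms(2) inv by (simp_all add: realize_def \<pi>_Comp \<pi>_\<iota>)
qed

text \<open>By \<open>\<iota>_lift\<close>, \<open>realize\<close> commutes with restriction along
  arrows of \<open>C\<close>: it is a map of presheaves from \<open>elems Z\<close> to the arrows
  into \<open>Z\<close>.\<close>

lemma realize_pullback_elem:
  assumes "u \<in> Arr C" "x \<in> elems Z (Cod C u)"
  shows "realize (Dom C u) (pullback_elem Z u x) = realize (Cod C u) x \<cdot>\<^bsub>H\<^esub> N u"
proof -
  obtain k g where x: "x = (k, g)" "k \<in> Arr S" "Dom S k = Cod S (FA u)" "Cod S k = FO Z"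
    "g \<in> Arr (HF (FO Z))" "Dom (HF (FO Z)) g = Cod C (c k (q (Cod C u)))" "Cod (HF (FO Z)) g = Z"
    using assms by (auto simp: elems_def)
  let ?X = "Dom C u"
  let ?l = "lift k (u \<cdot> t ?X)"
  have l: "?l \<in> Arr (HF (FO Z))" "Dom (HF (FO Z)) ?l = Cod C (c (k \<cdot>\<^bsub>S\<^esub> FA u) (q ?X))"
     "Cod (HF (FO Z)) ?l = Cod C (c k (q (Cod C u)))"
    using lift_Comp_t_simps[of u k] assms(1) x by simp_all
  have "FArr (\<iota> (FO Z)) ?l \<cdot>\<^bsub>H\<^esub> N (c (k \<cdot>\<^bsub>S\<^esub> FA u) (q ?X)) =
     N (c k (q (Cod C u))) \<cdot>\<^bsub>H\<^esub> inv_arrow H (N (t (Cod C u))) \<cdot>\<^bsub>H\<^esub> N (u \<cdot> t ?X)"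
    using \<iota>_lift[OF cofibrant_source_Comp_t, of u k] assms(1) x by simp
  then have eq: "FArr (\<iota> (FO Z)) ?l \<cdot>\<^bsub>H\<^esub> N (c (k \<cdot>\<^bsub>S\<^esub> FA u) (q ?X)) =
     N (c k (q (Cod C u))) \<cdot>\<^bsub>H\<^esub> inv_arrow H (N (t (Cod C u))) \<cdot>\<^bsub>H\<^esub> (N u \<cdot>\<^bsub>H\<^esub> N (t ?X))"
    using assms(1) by (simp add: N_Comp)
  have "realize ?X (pullback_elem Z u x) = FArr (\<iota> (FO Z)) g \<cdot>\<^bsub>H\<^esub>
      (FArr (\<iota> (FO Z)) ?l \<cdot>\<^bsub>H\<^esub> N (c (k \<cdot>\<^bsub>S\<^esub> FA u) (q ?X))) \<cdot>\<^bsub>H\<^esub> inv_arrow H (N (t ?X))"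
    unfolding x(1) pullback_elem_def realize_def prod.case using l x assms(1)
    by (simp add: \<iota>_Comp Comp_assoc)
  also have "\<dots> = realize (Cod C u) x \<cdot>\<^bsub>H\<^esub> N u"
    unfolding eq x(1) realize_def prod.case using x assms(1) by (simp add: Comp_assoc)
  finally show ?thesis .
qed

lemma realize_counit: "realize Z (Idt S (FO Z), counit Z) = Idt H Z"
proof -
  let ?c = "c (Idt S (FO Z)) (q Z)"
  have "N (bar (t Z)) \<cdot>\<^bsub>H\<^esub> N ?c = N (t Z)"
    using N_Comp[of ?c "bar (t Z)"] bar_simps[of "t Z"] by simp
  then have "(N (bar (t Z)) \<cdot>\<^bsub>H\<^esub> N ?c) \<cdot>\<^bsub>H\<^esub> inv_arrow H (N (t Z)) = Idt H Z"
    by simp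
  then show ?thesis
    by (simp add: realize_def counit_def Comp_assoc)
qed

text \<open>The Yoneda map of the element given by the identity and the counit:
  \<open>\<Psi> K\<close> is its restriction along \<open>K\<close>.\<close>

lemma Ho_presheaf:
  obtains \<Psi> where
    "\<And>K. K \<in> Arr H \<Longrightarrow> Cod H K = Z \<Longrightarrow> \<Psi> K \<in> elems Z (Dom H K)"
    "\<Psi> (Idt H Z) = (Idt S (FO Z), counit Z)"
    "\<And>u K. u \<in> Arr C \<Longrightarrow> K \<in> Arr H \<Longrightarrow> Dom H K = Cod C u \<Longrightarrow> Cod H K = Z \<Longrightarrow>
      \<Psi> (K \<cdot>\<^bsub>H\<^esub> N u) = pullback_elem Z u (\<Psi> K)"
    "\<And>w K. w \<in> Arr C \<Longrightarrow> w \<in> all_weqs S W \<Longrightarrow> K \<in> Arr H \<Longrightarrow> Dom H K = Dom C w \<Longrightarrow> Cod H K = Z \<Longrightarrow>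
      pullback_elem Z w (\<Psi> (K \<cdot>\<^bsub>H\<^esub> inv_arrow H (N w))) = \<Psi> K"
  apply (rule presheaf_extends_to_Ho[of C "elems Z" "pullback_elem Z" "all_weqs S W"])
       apply (simp_all add: pullback_elem_in pullback_elem_Idt pullback_elem_Comp pullback_elem_bij)
  subgoal premises prems for ext
    by (rule prems(1)[of "\<lambda>K. ext K (Idt S (FO Z), counit Z)"]; unfold Ho_total_def)
      (use prems(2-) counit_elem in simp_all)
  done

text \<open>\<open>realize\<close> after \<open>\<Psi>\<close> is the identity, by induction on the
  zigzag starting from \<open>realize_counit\<close>. Thus the second component of
  \<open>\<Psi> K\<close> is the required \<open>g\<close>.\<close>

lemma Ho_factor:
  assumes K: "K \<in> Arr H" "Dom H K = X" "Cod H K = Z"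
  obtains g where "g \<in> hom (HF (FO Z)) (Cod C (c (FArr \<pi> K) (q X))) Z"
    "K = FArr (\<iota> (FO Z)) g \<cdot>\<^bsub>H\<^esub> N (c (FArr \<pi> K) (q X)) \<cdot>\<^bsub>H\<^esub> inv_arrow H (N (t X))"
proof -
  obtain \<Psi> where \<Psi>: "\<And>K. K \<in> Arr H \<Longrightarrow> Cod H K = Z \<Longrightarrow> \<Psi> K \<in> elems Z (Dom H K)"
    "\<Psi> (Idt H Z) = (Idt S (FO Z), counit Z)"
    "\<And>u K. u \<in> Arr C \<Longrightarrow> K \<in> Arr H \<Longrightarrow> Dom H K = Cod C u \<Longrightarrow> Cod H K = Z \<Longrightarrow>
      \<Psi> (K \<cdot>\<^bsub>H\<^esub> N u) = pullback_elem Z u (\<Psi> K)"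
    "\<And>w K. w \<in> Arr C \<Longrightarrow> w \<in> all_weqs S W \<Longrightarrow> K \<in> Arr H \<Longrightarrow> Dom H K = Dom C w \<Longrightarrow> Cod H K = Z \<Longrightarrow>
      pullback_elem Z w (\<Psi> (K \<cdot>\<^bsub>H\<^esub> inv_arrow H (N w))) = \<Psi> K"
    by (rule Ho_presheaf) (rule that)
  from K(1,3) have "realize (Dom H K) (\<Psi> K) = K"
  proof (induction K rule: Ho_induct[OF catC, where W = "all_weqs S W", folded Ho_total_def, consumes 2, case_names Idt Fwd Bwd])
    case Idt
    then show ?case by (simp add: \<Psi>(2) realize_counit)
  next
    case (Fwd u K)
    then show ?case using realize_pullback_elem[of u "\<Psi> K"] \<Psi>(1)[of K] by (simp add: \<Psi>(3))
  next
    case (Bwd w K)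
    obtain A where A: "A \<in> Obj S" "w \<in> W A" using Bwd(2) by (rule all_weqs_D)
    have iso: "is_iso H (N w)" using N_iso[OF A] .
    let ?K = "K \<cdot>\<^bsub>H\<^esub> inv_arrow H (N w)"
    have K': "?K \<in> Arr H" "Dom H ?K = Cod C w" "Cod H ?K = Z" using Bwd iso by simp_all
    have in_elems: "\<Psi> ?K \<in> elems Z (Cod C w)" using \<Psi>(1)[OF K'(1,3)] K'(2) by simp
    obtain k g where kg: "\<Psi> ?K = (k, g)" by (cases "\<Psi> ?K")
    have arr: "realize (Cod C w) (\<Psi> ?K) \<in> Arr H" "Dom H (realize (Cod C w) (\<Psi> ?K)) = Cod C w"
      using realize_simps(1,2)[of k g "Cod C w"] in_elems Bwd(1) by (simp_all add: kg)
    \<comment> \<open>The extension is known at an inverted arrow only after restriction along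
      \<open>w\<close>, so the two sides are compared after composing with the isomorphism
      \<open>N w\<close>.\<close>
    have "realize (Cod C w) (\<Psi> ?K) \<cdot>\<^bsub>H\<^esub> N w = realize (Dom C w) (\<Psi> K)"
      using realize_pullback_elem[OF Bwd(1) in_elems] \<Psi>(4)[of w K] Bwd by simp
    also have "\<dots> = ?K \<cdot>\<^bsub>H\<^esub> N w" using Bwd iso by (simp add: Comp_assoc)
    finally have "realize (Cod C w) (\<Psi> ?K) = ?K"
      by (rule Comp_iso_cancel[OF catH]) (use iso arr K' Bwd(1) in simp_all)
    then show ?case using K' by simp
  qed
  moreover have "\<Psi> K \<in> elems Z X" using \<Psi>(1)[OF K(1,3)] K(2) by simp
  moreover obtain k g where "\<Psi> K = (k, g)" by (cases "\<Psi> K")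
  moreover have "X \<in> Obj C" using K Dom_Obj[OF catH K(1)] by simp
  ultimately have "realize X (k, g) = K" "(k, g) \<in> elems Z X" "FArr \<pi> (realize X (k, g)) = k"
    using K realize_simps(4)[of k g X] by simp_all
  then show ?thesis using that[of g] by (simp add: realize_def elems_def)
qed

text \<open>Since \<open>\<Psi>\<close> depends only on the arrow of \<open>H\<close>, it suffices
  to recover \<open>g\<close> from it. The computation uses that \<open>\<Psi>\<close> acts on
  arrows coming from the fiber by composition with the counit.\<close>

lemma Ho_factor_unique:
  assumes X: "X \<in> Obj C" and k: "k \<in> Arr S" "Dom S k = FO X" "Cod S k = FO Z"
    and g: "g \<in> hom (HF (FO Z)) (Cod C (c k (q X))) Z"
    and g': "g' \<in> hom (HF (FO Z)) (Cod C (c k (q X))) Z"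
    and eq: "FArr (\<iota> (FO Z)) g \<cdot>\<^bsub>H\<^esub> N (c k (q X)) = FArr (\<iota> (FO Z)) g' \<cdot>\<^bsub>H\<^esub> N (c k (q X))"
  shows "g = g'"
proof -
  let ?D = "FO Z"
  obtain \<Psi> where \<Psi>: "\<And>K. K \<in> Arr H \<Longrightarrow> Cod H K = Z \<Longrightarrow> \<Psi> K \<in> elems Z (Dom H K)"
    "\<Psi> (Idt H Z) = (Idt S (FO Z), counit Z)"
    "\<And>u K. u \<in> Arr C \<Longrightarrow> K \<in> Arr H \<Longrightarrow> Dom H K = Cod C u \<Longrightarrow> Cod H K = Z \<Longrightarrow>
      \<Psi> (K \<cdot>\<^bsub>H\<^esub> N u) = pullback_elem Z u (\<Psi> K)"
    "\<And>w K. w \<in> Arr C \<Longrightarrow> w \<in> all_weqs S W \<Longrightarrow> K \<in> Arr H \<Longrightarrow> Dom H K = Dom C w \<Longrightarrow> Cod H K = Z \<Longrightarrow>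
      pullback_elem Z w (\<Psi> (K \<cdot>\<^bsub>H\<^esub> inv_arrow H (N w))) = \<Psi> K"
    by (rule Ho_presheaf) (rule that)
  have D [simp]: "?D \<in> Obj S" by simp
  \<comment> \<open>Both sides agree on generators of the fiber's homotopy category: for forward
    arrows this is \<open>counit_natural\<close>, for inverted ones a cancellation.\<close>
  have fib: "\<Psi> (FArr (\<iota> ?D) K) = (Idt S ?D, K \<cdot>\<^bsub>HF ?D\<^esub> counit (Dom (HF ?D) K))"
    if "K \<in> Arr (HF ?D)" "Cod (HF ?D) K = Z" for K
    using that
  proof (induction K rule: Ho_induct[OF catF[OF D], consumes 2, case_names Idt Fwd Bwd])
    case Idt
    then show ?case by (simp add: \<iota>_Idt \<Psi>(2))
  next
    case (Fwd u K)
    have u: "u \<in> Arr C" "FA u = Idt S ?D" using Fwd(1) by simp_all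
    have FO: "FO (Dom C u) = ?D" "FO (Cod C u) = ?D" using u by simp_all
    have cs: "counit V \<in> Arr (HF ?D)" "Cod (HF ?D) (counit V) = V"
      "Dom (HF ?D) (counit V) = Cod C (c (Idt S ?D) (q V))" if "V \<in> Obj C" "FO V = ?D" for V
      using that by (simp_all add: counit_def)
    note l = lift_Comp_t_simps[of u "Idt S ?D"]
    have "\<Psi> (FArr (\<iota> ?D) (K \<cdot>\<^bsub>HF ?D\<^esub> L ?D u)) = pullback_elem Z u (\<Psi> (FArr (\<iota> ?D) K))"
      using Fwd u by (simp add: \<iota>_Comp \<Psi>(3))
    also have "\<dots> = (Idt S ?D, K \<cdot>\<^bsub>HF ?D\<^esub> counit (Cod C u) \<cdot>\<^bsub>HF ?D\<^esub> lift (Idt S ?D) (u \<cdot> t (Dom C u)))"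
      using Fwd u FO cs[of "Cod C u"] l by (simp add: pullback_elem_def Comp_assoc del: FO_Dom FO_Cod)
    also have "\<dots> = (Idt S ?D, (K \<cdot>\<^bsub>HF ?D\<^esub> L ?D u) \<cdot>\<^bsub>HF ?D\<^esub> counit (Dom C u))"
      using Fwd u FO cs[of "Dom C u"] by (simp add: counit_natural Comp_assoc del: FO_Dom FO_Cod)
    finally show ?case using Fwd u by simp
  next
    case (Bwd w K)
    have w: "w \<in> Arr C" "FA w = Idt S ?D" "w \<in> all_weqs S W" using Bwd(1,2) by (auto simp: all_weqs_def)
    have FO: "FO (Dom C w) = ?D" "FO (Cod C w) = ?D" using w by simp_all
    have cs: "counit V \<in> Arr (HF ?D)" "Cod (HF ?D) (counit V) = V"
      "Dom (HF ?D) (counit V) = Cod C (c (Idt S ?D) (q V))" if "V \<in> Obj C" "FO V = ?D" for V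
      using that by (simp_all add: counit_def)
    note l = lift_Comp_t_simps[of w "Idt S ?D"]
    have iso: "is_iso (HF ?D) (L ?D w)" "is_iso H (N w)"
      using L_iso[OF D Bwd(2)] N_iso[OF D Bwd(2)] by simp_all
    have \<iota>inv: "FArr (\<iota> ?D) (inv_arrow (HF ?D) (L ?D w)) = inv_arrow H (N w)"
      using functor_inv[OF \<iota>_functor iso(1)] w by simp
    define K' where "K' = K \<cdot>\<^bsub>HF ?D\<^esub> inv_arrow (HF ?D) (L ?D w)"
    have K': "K' \<in> Arr (HF ?D)" "Dom (HF ?D) K' = Cod C w" "Cod (HF ?D) K' = Z"
      using Bwd w iso by (simp_all add: K'_def)
    \<comment> \<open>Two elements over \<open>Cod C w\<close> are shown to have the same
      restriction along \<open>w\<close>; restriction along a weak equivalence is injective.\<close>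
    have "\<Psi> (FArr (\<iota> ?D) K') \<in> elems Z (Cod C w)"
      using \<Psi>(1)[of "FArr (\<iota> ?D) K'"] K' by simp
    moreover have "(Idt S ?D, K' \<cdot>\<^bsub>HF ?D\<^esub> counit (Cod C w)) \<in> elems Z (Cod C w)"
      using K' cs[of "Cod C w"] FO w by (simp add: elems_def del: FO_Dom FO_Cod)
    moreover have "pullback_elem Z w (\<Psi> (FArr (\<iota> ?D) K')) =
        pullback_elem Z w (Idt S ?D, K' \<cdot>\<^bsub>HF ?D\<^esub> counit (Cod C w))"
    proof -
      have "pullback_elem Z w (\<Psi> (FArr (\<iota> ?D) K')) = \<Psi> (FArr (\<iota> ?D) K)"
        using Bwd w iso \<Psi>(4)[of w "FArr (\<iota> ?D) K"] by (simp add: K'_def \<iota>_Comp \<iota>inv)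
      also have "\<dots> = (Idt S ?D, K \<cdot>\<^bsub>HF ?D\<^esub> counit (Dom C w))"
        using Bwd by simp
      also have "\<dots> = (Idt S ?D, K' \<cdot>\<^bsub>HF ?D\<^esub> L ?D w \<cdot>\<^bsub>HF ?D\<^esub> counit (Dom C w))"
        using Bwd w iso cs[of "Dom C w"] FO by (simp add: K'_def Comp_assoc del: FO_Dom FO_Cod)
      also have "\<dots> = (Idt S ?D, K' \<cdot>\<^bsub>HF ?D\<^esub> counit (Cod C w) \<cdot>\<^bsub>HF ?D\<^esub> lift (Idt S ?D) (w \<cdot> t (Dom C w)))"
        using counit_natural[OF w(1,2)] by simp
      also have "\<dots> = pullback_elem Z w (Idt S ?D, K' \<cdot>\<^bsub>HF ?D\<^esub> counit (Cod C w))"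
        using K' w FO cs[of "Cod C w"] l by (simp add: pullback_elem_def Comp_assoc del: FO_Dom FO_Cod)
      finally show ?thesis .
    qed
    ultimately have "\<Psi> (FArr (\<iota> ?D) K') = (Idt S ?D, K' \<cdot>\<^bsub>HF ?D\<^esub> counit (Cod C w))"
      using pullback_elem_bij[OF Z w(1,3)] by (meson bij_betw_imp_inj_on inj_onD)
    then show ?case using K'(2) by (simp add: K'_def)
  qed
  let ?Y = "Cod C (c k (q X))"
  have c: "c k (q X) \<in> Arr C" "FA (c k (q X)) = k" "Dom C (c k (q X)) = q X" using X k by simp_all
  have csY: "counit ?Y \<in> Arr (HF ?D)" "Cod (HF ?D) (counit ?Y) = ?Y"
      "Dom (HF ?D) (counit ?Y) = Cod C (c (Idt S ?D) (q ?Y))"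
    using X k by (simp_all add: counit_def)
  \<comment> \<open>Restriction along \<open>c k (q X)\<close>, collapsed by
    \<open>counit_lift\<close>, leaves \<open>h\<close> composed with \<open>E k (t (q X))\<close>.
    This factor is an isomorphism because \<open>q X\<close> is cofibrant, so \<open>h\<close> can
    be read off.\<close>
  have \<Psi>g: "\<Psi> (FArr (\<iota> ?D) h \<cdot>\<^bsub>H\<^esub> N (c k (q X))) = (k, h \<cdot>\<^bsub>HF ?D\<^esub> E k (t (q X)))"
    if h: "h \<in> hom (HF ?D) ?Y Z" for h
  proof -
    have l: "lift (Idt S ?D) (c k (q X) \<cdot> t (q X)) \<in> hom (HF ?D) (Cod C (c k (q (q X)))) (Cod C (c (Idt S ?D) (q ?Y)))"
      using lift_Comp_t_simps[of "c k (q X)" "Idt S ?D"] c X k by simp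
    have "\<Psi> (FArr (\<iota> ?D) h \<cdot>\<^bsub>H\<^esub> N (c k (q X))) = pullback_elem Z (c k (q X)) (Idt S ?D, h \<cdot>\<^bsub>HF ?D\<^esub> counit ?Y)"
      using h c X k fib[of h] by (simp add: \<Psi>(3))
    also have "\<dots> = (k, h \<cdot>\<^bsub>HF ?D\<^esub> counit ?Y \<cdot>\<^bsub>HF ?D\<^esub> lift (Idt S ?D) (c k (q X) \<cdot> t (q X)))"
      using h l c X k csY by (simp add: pullback_elem_def Comp_assoc)
    also have "counit ?Y \<cdot>\<^bsub>HF ?D\<^esub> lift (Idt S ?D) (c k (q X) \<cdot> t (q X)) = L ?D (bar (c k (q X) \<cdot> t (q X)))"
      using counit_lift[OF cofibrant_source_Comp_t[OF c(1)], of ?Y] c X k by simp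
    also have "\<dots> = E k (t (q X))"
      using X k by (simp add: E_def p_def)
    finally show ?thesis .
  qed
  have "g \<cdot>\<^bsub>HF ?D\<^esub> E k (t (q X)) = g' \<cdot>\<^bsub>HF ?D\<^esub> E k (t (q X))"
    using \<Psi>g[OF g] \<Psi>g[OF g'] eq by simp
  then show ?thesis
    by (rule Comp_iso_cancel[rotated])
      (use E_t_iso[of k "q X"] q_Cof[OF X] g g' X k E_simps[of "t (q X)" k] in simp_all)
qed

end

end

section \<open>Cocartesian arrows of the localization\<close>

context
  fixes C :: "('o, 'a) category" (structure) and S :: "('b, 's) category"
    and \<Phi> :: "('o, 'a, 'b, 's) fmap"
  assumes \<Phi>: "is_functor C S \<Phi>"
begin

lemma cocartesian_factor:
  assumes "cocartesian C S \<Phi> u" "v \<in> Arr C" "Dom C v = Dom C u"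
    "h \<in> Arr S" "Dom S h = FObj \<Phi> (Cod C u)" "Cod S h = FObj \<Phi> (Cod C v)" "FArr \<Phi> v = h \<cdot>\<^bsub>S\<^esub> FArr \<Phi> u"
  obtains w where "w \<in> hom C (Cod C u) (Cod C v)" "FArr \<Phi> w = h" "w \<cdot> u = v"
proof -
  have "Cod C v \<in> Obj C" using assms(2) functor_source[OF \<Phi>] by simp
  then have "\<exists>!w. w \<in> hom C (Cod C u) (Cod C v) \<and> FArr \<Phi> w = h \<and> w \<cdot> u = v"
    using assms(1)[unfolded cocartesian_def, THEN conjunct2, rule_format, of "Cod C v" v h] assms(2-)
    by simp
  then show ?thesis using that by blast
qed

lemma cocartesian_cancel:
  assumes u: "cocartesian C S \<Phi> u" and a: "a \<in> Arr C" "Dom C a = Cod C u"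
    and b: "b \<in> Arr C" "Dom C b = Cod C u" "Cod C b = Cod C a"
    and eq: "FArr \<Phi> a = FArr \<Phi> b" "a \<cdot> u = b \<cdot> u"
  shows "a = b"
proof -
  note [simp] = functor_simps[OF \<Phi>]
  have uA: "u \<in> Arr C" using u unfolding cocartesian_def by blast
  have "\<exists>!w. w \<in> hom C (Cod C u) (Cod C a) \<and> FArr \<Phi> w = FArr \<Phi> a \<and> w \<cdot> u = a \<cdot> u"
    using u[unfolded cocartesian_def, THEN conjunct2, rule_format, of "Cod C a" "a \<cdot> u" "FArr \<Phi> a"] a uA
    by simp
  then show ?thesis using a b eq by auto
qed

lemma cocartesian_Arr: "cocartesian C S \<Phi> u \<Longrightarrow> u \<in> Arr C"
  unfolding cocartesian_def by blast

lemma iso_Comp_cocartesian: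
  assumes u: "cocartesian C S \<Phi> u" and a: "is_iso C a" "Dom C a = Cod C u" "FArr \<Phi> a = Idt S A" "A \<in> Obj S"
  shows "cocartesian C S \<Phi> (a \<cdot> u)"
  unfolding cocartesian_def
proof (intro conjI ballI impI)
  note [simp] = functor_simps[OF \<Phi>] cocartesian_Arr[OF u] is_iso_Arr[OF functor_source[OF \<Phi>] a(1)] a
  have A: "FObj \<Phi> (Cod C a) = A" "FObj \<Phi> (Cod C u) = A"
    using functor_Cod[OF \<Phi>, of a] functor_Dom[OF \<Phi>, of a] by auto
  have Au: "Idt S A \<cdot>\<^bsub>S\<^esub> FArr \<Phi> u = FArr \<Phi> u" using functor_Cod[OF \<Phi>, of u] A by simp
  have inv: "FArr \<Phi> (inv_arrow C a) = Idt S A" using functor_inv[OF \<Phi> a(1)] by simp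
  show "a \<cdot> u \<in> Arr C" by simp
  fix Y v h assume Y: "Y \<in> Obj C" "v \<in> hom C (Dom C (a \<cdot> u)) Y" "h \<in> hom S (FObj \<Phi> (Cod C (a \<cdot> u))) (FObj \<Phi> Y)"
    and v: "FArr \<Phi> v = h \<cdot>\<^bsub>S\<^esub> FArr \<Phi> (a \<cdot> u)"
  obtain w where w: "w \<in> hom C (Cod C u) Y" "FArr \<Phi> w = h" "w \<cdot> u = v"
    by (rule cocartesian_factor[OF u, of v h]) (use Y v A Au in auto)
  show "\<exists>!w. w \<in> hom C (Cod C (a \<cdot> u)) Y \<and> FArr \<Phi> w = h \<and> w \<cdot> a \<cdot> u = v"
  proof (rule ex1I[of _ "w \<cdot> inv_arrow C a"])
    show "w \<cdot> inv_arrow C a \<in> hom C (Cod C (a \<cdot> u)) Y \<and> FArr \<Phi> (w \<cdot> inv_arrow C a) = h \<and>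
        (w \<cdot> inv_arrow C a) \<cdot> a \<cdot> u = v"
      using w Y inv A by (simp add: Comp_assoc)
    fix w' assume w': "w' \<in> hom C (Cod C (a \<cdot> u)) Y \<and> FArr \<Phi> w' = h \<and> w' \<cdot> a \<cdot> u = v"
    have "w' \<cdot> a = w"
      by (rule cocartesian_cancel[OF u]) (use w w' Y A in \<open>auto simp: Comp_assoc\<close>)
    then show "w' = w \<cdot> inv_arrow C a" using w' by (auto simp: Comp_assoc)
  qed
qed

lemma cocartesian_comparison:
  assumes u: "cocartesian C S \<Phi> u" and v: "cocartesian C S \<Phi> v" and uv: "FArr \<Phi> u = FArr \<Phi> v"
    and s: "is_iso C s" "Dom C s = Dom C u" "Cod C s = Dom C v" "FArr \<Phi> s = Idt S A" "A \<in> Obj S"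
  obtains m where "is_iso C m" "Dom C m = Cod C u" "Cod C m = Cod C v"
    "FArr \<Phi> m = Idt S (FObj \<Phi> (Cod C u))" "m \<cdot> u = v \<cdot> s"
proof -
  note [simp] = functor_simps[OF \<Phi>] cocartesian_Arr[OF u] cocartesian_Arr[OF v]
    is_iso_Arr[OF functor_source[OF \<Phi>] s(1)] s
  have A: "FObj \<Phi> (Dom C u) = A" "FObj \<Phi> (Dom C v) = A"
    using functor_Cod[OF \<Phi>, of s] functor_Dom[OF \<Phi>, of s] by auto
  define B where "B = FObj \<Phi> (Cod C u)"
  have B: "FObj \<Phi> (Cod C u) = B" "FObj \<Phi> (Cod C v) = B" "B \<in> Obj S"
    using functor_Cod[OF \<Phi>, of u] functor_Cod[OF \<Phi>, of v] uv by (auto simp: B_def)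
  have unit: "FArr \<Phi> v \<cdot>\<^bsub>S\<^esub> Idt S A = FArr \<Phi> v" "Idt S B \<cdot>\<^bsub>S\<^esub> FArr \<Phi> v = FArr \<Phi> v"
    using functor_Cod[OF \<Phi>, of v] functor_Dom[OF \<Phi>, of v] A B by simp_all
  have inv: "FArr \<Phi> (inv_arrow C s) = Idt S A" using functor_inv[OF \<Phi> s(1)] by simp
  obtain m where m: "m \<in> hom C (Cod C u) (Cod C (v \<cdot> s))" "FArr \<Phi> m = Idt S B" "m \<cdot> u = v \<cdot> s"
    by (rule cocartesian_factor[OF u, of "v \<cdot> s" "Idt S B"]) (use B unit uv in auto)
  obtain m' where m': "m' \<in> hom C (Cod C v) (Cod C (u \<cdot> inv_arrow C s))" "FArr \<Phi> m' = Idt S B"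
      "m' \<cdot> v = u \<cdot> inv_arrow C s"
    by (rule cocartesian_factor[OF v, of "u \<cdot> inv_arrow C s" "Idt S B"]) (use B unit uv inv in auto)
  have mm: "m \<in> Arr C" "Dom C m = Cod C u" "Cod C m = Cod C v"
    "m' \<in> Arr C" "Dom C m' = Cod C v" "Cod C m' = Cod C u" using m(1) m'(1) by simp_all
  have "(m' \<cdot> m) \<cdot> u = (m' \<cdot> v) \<cdot> s" using m(3) mm by (simp add: Comp_assoc)
  also have "\<dots> = u" unfolding m'(3) by (simp add: Comp_assoc)
  finally have mu: "(m' \<cdot> m) \<cdot> u = u" .
  have "m' \<cdot> m = Idt C (Cod C u)"
    by (rule cocartesian_cancel[OF u]) (use mm m(2) m'(2) B mu in simp_all)
  moreover have "(m \<cdot> m') \<cdot> v = (m \<cdot> u) \<cdot> inv_arrow C s" using m'(3) mm by (simp add: Comp_assoc)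
  then have mv: "(m \<cdot> m') \<cdot> v = v" unfolding m(3) by (simp add: Comp_assoc)
  have "m \<cdot> m' = Idt C (Cod C v)"
    by (rule cocartesian_cancel[OF v]) (use mm m(2) m'(2) B mv in simp_all)
  ultimately have "inverse_arrows C m m'" using mm by (simp add: inverse_arrows_def)
  then show ?thesis using that[of m] m mm B(1) unfolding is_iso_def by auto
qed

end

context cofibrant_opfibration
begin

text \<open>Existence of factorizations is \<open>Ho_factor\<close> along the composite of
  \<open>h\<close> and \<open>f\<close>, rewritten through \<open>m\<close>. For uniqueness, an
  arrow out of the cofibrant \<open>Y\<close> over \<open>h\<close> factors through
  \<open>c h Y\<close> itself; comparing its target with the pushforward along the composite reduces
  the question to \<open>Ho_factor_unique\<close>.\<close>

lemma Ho_cocartesian: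
  assumes f: "f \<in> Arr S" and X: "X \<in> Obj C" "FO X = Dom S f"
  defines "d \<equiv> N (c f (q X)) \<cdot>\<^bsub>H\<^esub> inv_arrow H (N (t X))"
  shows "cocartesian H S \<pi> d" "Dom H d = X" "Cod H d = Cod C (c f (q X))" "FArr \<pi> d = f"
proof -
  note [simp] = f X
  let ?c = "c f (q X)"
  define Y where "Y = Cod C ?c"
  have iso: "is_iso H (N (t X))" using N_t_iso X by simp
  have c [simp]: "?c \<in> Arr C" "Dom C ?c = q X" "FA ?c = f" "Cod C ?c = Y"
    using f X by (simp_all add: Y_def)
  have FOY [simp]: "Y \<in> Obj C" "FO Y = Cod S f" using f X by (simp_all add: Y_def del: c(4))
  have YC: "Y \<in> Cof (Cod S f)" using push_Cof[OF f, of "q X"] q_Cof[of X] X by simp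
  have inv: "FArr \<pi> (inv_arrow H (N (t X))) = Idt S (Dom S f)"
    using functor_inv[OF \<pi>_functor iso] X f by simp
  show d: "Dom H d = X" "Cod H d = Cod C ?c" "FArr \<pi> d = f"
    using X iso f inv by (simp_all add: d_def \<pi>_Comp)
  have dA: "d \<in> Arr H" using X iso by (simp add: d_def)
  have ex: "\<exists>!w. w \<in> hom H Y V \<and> FArr \<pi> w = h \<and> w \<cdot>\<^bsub>H\<^esub> d = v"
    if V: "V \<in> Obj C" and v: "v \<in> hom H X V" and h: "h \<in> hom S (Cod S f) (FO V)"
      and vh: "FArr \<pi> v = h \<cdot>\<^bsub>S\<^esub> f" for V v h
  proof (rule ex_ex1I)
    let ?k = "h \<cdot>\<^bsub>S\<^esub> f"
    let ?ck = "c ?k (q X)"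
    have h [simp]: "h \<in> Arr S" "Dom S h = Cod S f" "Cod S h = FO V" using h by simp_all
    have ck [simp]: "?ck \<in> Arr C" "Dom C ?ck = q X" "FA ?ck = ?k" using f X by simp_all
    \<comment> \<open>The comparison from \<open>f_! Q X\<close> to the pushforward of
      \<open>Q X\<close> along the composite, lying over \<open>h\<close>.\<close>
    obtain m where m: "m \<in> Arr C" "Dom C m = Y" "Cod C m = Cod C ?ck" "FA m = h" "m \<cdot> ?c = ?ck"
      using cocartesian_factor[OF \<Phi> cocart[OF f, of "q X"], of ?ck h] f X by auto
    show "\<exists>w. w \<in> hom H Y V \<and> FArr \<pi> w = h \<and> w \<cdot>\<^bsub>H\<^esub> d = v"
    proof -
      obtain g where g: "g \<in> hom (HF (FO V)) (Cod C ?ck) V"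
        "v = FArr (\<iota> (FO V)) g \<cdot>\<^bsub>H\<^esub> N ?ck \<cdot>\<^bsub>H\<^esub> inv_arrow H (N (t X))"
        by (rule Ho_factor[OF V, of v X]) (use v vh in auto)
      have w: "FArr (\<iota> (FO V)) g \<cdot>\<^bsub>H\<^esub> N m \<in> hom H Y V" using g(1) m V by simp
      have "FArr \<pi> (FArr (\<iota> (FO V)) g \<cdot>\<^bsub>H\<^esub> N m) = h"
        using g(1) m V by (simp add: \<pi>_Comp \<pi>_\<iota>)
      moreover have "(FArr (\<iota> (FO V)) g \<cdot>\<^bsub>H\<^esub> N m) \<cdot>\<^bsub>H\<^esub> d = v"
      proof -
        have "N m \<cdot>\<^bsub>H\<^esub> N ?c = N ?ck" using N_Comp[of ?c m] m by simp
        moreover have "(FArr (\<iota> (FO V)) g \<cdot>\<^bsub>H\<^esub> N m) \<cdot>\<^bsub>H\<^esub> d =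
            FArr (\<iota> (FO V)) g \<cdot>\<^bsub>H\<^esub> (N m \<cdot>\<^bsub>H\<^esub> N ?c) \<cdot>\<^bsub>H\<^esub> inv_arrow H (N (t X))"
          unfolding d_def using g(1) m V iso X by (simp add: Comp_assoc)
        ultimately show ?thesis using g(2) by simp
      qed
      ultimately show ?thesis using w by blast
    qed
    fix w w' assume ww: "w \<in> hom H Y V \<and> FArr \<pi> w = h \<and> w \<cdot>\<^bsub>H\<^esub> d = v" "w' \<in> hom H Y V \<and> FArr \<pi> w' = h \<and> w' \<cdot>\<^bsub>H\<^esub> d = v"
    let ?D = "FO V"
    let ?cY = "c h Y"
    let ?e = "p h ?c"
    have cY [simp]: "?cY \<in> Arr C" "Dom C ?cY = Y" "FA ?cY = h" by simp_all
    have e [simp]: "?e \<in> Arr C" "Dom C ?e = Cod C ?ck" "Cod C ?e = Cod C ?cY" "FA ?e = Idt S ?D"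
      using p_simps[of ?c h] by simp_all
    have ec: "?e \<cdot> ?ck = ?cY \<cdot> ?c" using p_c[of ?c h] by simp
    have bm [simp]: "bar m \<in> Arr C" "Dom C (bar m) = Cod C ?cY" "Cod C (bar m) = Cod C ?ck"
      "FA (bar m) = Idt S ?D" "bar m \<cdot> ?cY = m"
      using bar_simps[OF m(1)] m by simp_all
    \<comment> \<open>Gives \<open>bar m\<close> as a right inverse of \<open>?e\<close>, by taking
      vertical factors of both sides. This is all that is needed to cancel \<open>?e\<close> at the
      end.\<close>
    have "?e \<cdot> m = ?cY"
    proof (rule cocartesian_cancel[OF \<Phi> cocart[OF f, of "q X"]])
      show "(?e \<cdot> m) \<cdot> c f (q X) = ?cY \<cdot> c f (q X)"
        using m ec by (simp add: Comp_assoc)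
    qed (use X m in simp_all)
    then have "bar ?cY = ?e \<cdot> bar m"
      using bar_vertical[of m ?e] m by simp
    then have "?e \<cdot> bar m = Idt C (Cod C ?cY)" using bar_c[of h Y] by simp
    then have ebm: "L ?D ?e \<cdot>\<^bsub>HF ?D\<^esub> L ?D (bar m) = Idt (HF ?D) (Cod C ?cY)"
      using L_Comp[of ?D "bar m" ?e] loc_simps(4)[of "Fib ?D" "Cod C ?cY"] V by simp
    have pt: "E h (t Y) \<in> Arr (HF ?D)" "Dom (HF ?D) (E h (t Y)) = Cod C (c h (q Y))"
      "Cod (HF ?D) (E h (t Y)) = Cod C ?cY" "is_iso (HF ?D) (E h (t Y))"
      "FArr (\<iota> ?D) (E h (t Y)) = N (p h (t Y))"
      "p h (t Y) \<in> Arr C" "Dom C (p h (t Y)) = Cod C (c h (q Y))" "Cod C (p h (t Y)) = Cod C ?cY"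
      using E_simps[of "t Y" h] E_t_iso[of h Y] YC \<iota>_E[of "t Y" h] p_simps[of "t Y" h] by simp_all
    have isoY: "is_iso H (N (t Y))" using N_t_iso by simp
    have isop: "is_iso H (N (p h (t Y)))" using functor_is_iso[OF \<iota>_functor pt(4)] pt(5) V by simp
    have "N (p h (t Y)) \<cdot>\<^bsub>H\<^esub> N (c h (q Y)) = N ?cY \<cdot>\<^bsub>H\<^esub> N (t Y)"
      using p_c[of "t Y" h] pt by (intro N_square) simp_all
    then have sq: "N (c h (q Y)) \<cdot>\<^bsub>H\<^esub> inv_arrow H (N (t Y)) = inv_arrow H (N (p h (t Y))) \<cdot>\<^bsub>H\<^esub> N ?cY"
      using isoY isop pt by (intro iso_square) simp_all
    \<comment> \<open>\<open>Ho_factor\<close> yields a factorization through \<open>Q Y\<close>; as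
      \<open>Y\<close> is cofibrant, \<open>E h (t Y)\<close> is invertible and \<open>Q Y\<close>
      may be replaced by \<open>Y\<close>.\<close>
    have factor: "\<exists>\<gamma>. \<gamma> \<in> hom (HF ?D) (Cod C ?cY) V \<and> x = FArr (\<iota> ?D) \<gamma> \<cdot>\<^bsub>H\<^esub> N ?cY"
      if x: "x \<in> hom H Y V \<and> FArr \<pi> x = h" for x
    proof -
      obtain g where g: "g \<in> hom (HF ?D) (Cod C (c h (q Y))) V"
        "x = FArr (\<iota> ?D) g \<cdot>\<^bsub>H\<^esub> N (c h (q Y)) \<cdot>\<^bsub>H\<^esub> inv_arrow H (N (t Y))"
        by (rule Ho_factor[OF V, of x Y]) (use x in auto)
      have "g \<cdot>\<^bsub>HF ?D\<^esub> inv_arrow (HF ?D) (E h (t Y)) \<in> hom (HF ?D) (Cod C ?cY) V"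
        using g(1) pt V by simp
      moreover have "x = FArr (\<iota> ?D) (g \<cdot>\<^bsub>HF ?D\<^esub> inv_arrow (HF ?D) (E h (t Y))) \<cdot>\<^bsub>H\<^esub> N ?cY"
        unfolding g(2) sq using g(1) pt V isop
        by (simp add: \<iota>_Comp functor_inv[OF \<iota>_functor] Comp_assoc)
      ultimately show ?thesis by blast
    qed
    obtain \<gamma> where \<gamma>: "\<gamma> \<in> hom (HF ?D) (Cod C ?cY) V" "w = FArr (\<iota> ?D) \<gamma> \<cdot>\<^bsub>H\<^esub> N ?cY"
      using factor[of w] ww(1) by blast
    obtain \<gamma>' where \<gamma>': "\<gamma>' \<in> hom (HF ?D) (Cod C ?cY) V" "w' = FArr (\<iota> ?D) \<gamma>' \<cdot>\<^bsub>H\<^esub> N ?cY"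
      using factor[of w'] ww(2) by blast
    have Nc: "N ?cY \<cdot>\<^bsub>H\<^esub> N ?c = N ?e \<cdot>\<^bsub>H\<^esub> N ?ck" using ec by (intro N_square) simp_all
    have red: "(x \<cdot>\<^bsub>H\<^esub> d) \<cdot>\<^bsub>H\<^esub> N (t X) = FArr (\<iota> ?D) (\<gamma> \<cdot>\<^bsub>HF ?D\<^esub> L ?D ?e) \<cdot>\<^bsub>H\<^esub> N ?ck"
      if \<gamma>: "\<gamma> \<in> hom (HF ?D) (Cod C ?cY) V" "x = FArr (\<iota> ?D) \<gamma> \<cdot>\<^bsub>H\<^esub> N ?cY" for x \<gamma>
    proof -
      have "(x \<cdot>\<^bsub>H\<^esub> d) \<cdot>\<^bsub>H\<^esub> N (t X) = FArr (\<iota> ?D) \<gamma> \<cdot>\<^bsub>H\<^esub> (N ?cY \<cdot>\<^bsub>H\<^esub> N ?c)"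
        unfolding \<gamma>(2) d_def using \<gamma>(1) X V iso by (simp add: Comp_assoc)
      also have "\<dots> = FArr (\<iota> ?D) (\<gamma> \<cdot>\<^bsub>HF ?D\<^esub> L ?D ?e) \<cdot>\<^bsub>H\<^esub> N ?ck"
        unfolding Nc using \<gamma>(1) V by (simp add: \<iota>_Comp Comp_assoc)
      finally show ?thesis .
    qed
    have eq: "FArr (\<iota> ?D) (\<gamma> \<cdot>\<^bsub>HF ?D\<^esub> L ?D ?e) \<cdot>\<^bsub>H\<^esub> N ?ck = FArr (\<iota> ?D) (\<gamma>' \<cdot>\<^bsub>HF ?D\<^esub> L ?D ?e) \<cdot>\<^bsub>H\<^esub> N ?ck"
      using red[OF \<gamma>] red[OF \<gamma>'] ww by simp
    have "\<gamma> \<cdot>\<^bsub>HF ?D\<^esub> L ?D ?e = \<gamma>' \<cdot>\<^bsub>HF ?D\<^esub> L ?D ?e"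
      by (rule Ho_factor_unique[OF V X(1) _ _ _ _ _ eq]) (use \<gamma>(1) \<gamma>'(1) X f V in simp_all)
    then have "(\<gamma> \<cdot>\<^bsub>HF ?D\<^esub> L ?D ?e) \<cdot>\<^bsub>HF ?D\<^esub> L ?D (bar m) = (\<gamma>' \<cdot>\<^bsub>HF ?D\<^esub> L ?D ?e) \<cdot>\<^bsub>HF ?D\<^esub> L ?D (bar m)"
      by simp
    then have "\<gamma> = \<gamma>'" using \<gamma>(1) \<gamma>'(1) V by (simp add: Comp_assoc ebm)
    then show "w = w'" using \<gamma>(2) \<gamma>'(2) by simp
  qed
  show "cocartesian H S \<pi> d"
    unfolding cocartesian_def
  proof (intro conjI ballI impI)
    fix V v h assume "V \<in> Obj H" "v \<in> hom H (Dom H d) V" "h \<in> hom S (FObj \<pi> (Cod H d)) (FObj \<pi> V)"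
      "FArr \<pi> v = h \<cdot>\<^bsub>S\<^esub> FArr \<pi> d"
    then show "\<exists>!w. w \<in> hom H (Cod H d) V \<and> FArr \<pi> w = h \<and> w \<cdot>\<^bsub>H\<^esub> d = v"
      using ex[of V v h] d by simp
  qed (rule dA)
qed

text \<open>If the comparison of the derived pushforward with \<open>f_!\<close> is a weak
  equivalence at \<open>X\<close>, the given arrow differs from the derived cocartesian one by an
  isomorphism over an identity. This supplies the arrows of \<open>C\<close> in the Beck-Chevalley
  argument.\<close>

lemma Ho_cocartesian_c:
  assumes f: "f \<in> Arr S" and X: "X \<in> Obj C" "FO X = Dom S f" and W: "p f (t X) \<in> W (Cod S f)"
  shows "cocartesian H S \<pi> (N (c f X))"
proof -
  let ?d = "N (c f (q X)) \<cdot>\<^bsub>H\<^esub> inv_arrow H (N (t X))"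
  note d = Ho_cocartesian[OF f X]
  have iso: "is_iso H (N (t X))" "is_iso H (N (p f (t X)))"
    using N_t_iso[of X] N_iso[OF _ W] X f by simp_all
  have p: "p f (t X) \<in> Arr C" "Dom C (p f (t X)) = Cod C (c f (q X))" "Cod C (p f (t X)) = Cod C (c f X)"
    "FA (p f (t X)) = Idt S (Cod S f)"
    using p_simps[of "t X" f] X f by simp_all
  have "N (p f (t X)) \<cdot>\<^bsub>H\<^esub> N (c f (q X)) = N (c f X) \<cdot>\<^bsub>H\<^esub> N (t X)"
    using p_c[of "t X" f] p X f by (intro N_square) simp_all
  then have "(N (p f (t X)) \<cdot>\<^bsub>H\<^esub> N (c f (q X))) \<cdot>\<^bsub>H\<^esub> inv_arrow H (N (t X)) = N (c f X)"
    using iso X f by (simp add: Comp_assoc)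
  then have "N (c f X) = N (p f (t X)) \<cdot>\<^bsub>H\<^esub> ?d"
    using iso X f p by (simp add: Comp_assoc)
  then show ?thesis
    using iso_Comp_cocartesian[OF \<pi>_functor d(1), of "N (p f (t X))" "Cod S f"] iso p f d(3) by simp
qed

text \<open>Over an identity the arrow \<open>c\<close> is itself vertical, so every part of the
  factorization of \<open>Ho_factor\<close> comes from the homotopy category of the fiber; this
  gives surjectivity. Injectivity is \<open>Ho_factor_unique\<close> applied after the
  counit.\<close>

theorem Ho_fiber_iso:
  assumes A: "A \<in> Obj S"
  shows "cat_iso (HF A) (fiber H S \<pi> A) (\<iota> A)"
proof -
  note [simp] = A
  have F: "is_functor (HF A) (fiber H S \<pi> A) (\<iota> A)"
    using \<iota>_functor[OF A] is_category_fiber[OF \<pi>_functor A] \<pi>_\<iota>[OF A]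
    unfolding is_functor_def by auto
  have inj: "K = K'" if K: "K \<in> Arr (HF A)" "K' \<in> Arr (HF A)" "FArr (\<iota> A) K = FArr (\<iota> A) K'" for K K'
  proof -
    define X Z where "X = Dom (HF A) K" and "Z = Cod (HF A) K"
    have K': "Dom (HF A) K' = X" "Cod (HF A) K' = Z"
      using K \<iota>_simps(2,3)[OF A] by (metis X_def, metis Z_def)
    have XZ [simp]: "X \<in> Obj C" "FO X = A" "Z \<in> Obj C" "FO Z = A"
      using Dom_Obj[of "HF A" K] Cod_Obj[of "HF A" K] K(1) by (simp_all add: X_def Z_def)
    let ?c = "c (Idt S A) (q X)"
    have c: "?c \<in> Arr C" "Dom C ?c = q X" "FA ?c = Idt S A" by simp_all
    have b: "bar (t X) \<in> Arr C" "Dom C (bar (t X)) = Cod C ?c" "Cod C (bar (t X)) = X" "FA (bar (t X)) = Idt S A"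
      "bar (t X) \<cdot> ?c = t X"
      using bar_simps[of "t X"] by simp_all
    have cu: "counit X = L A (bar (t X))" by (simp add: counit_def)
    \<comment> \<open>The counit itself has not been shown invertible. Preceded by
      \<open>L A ?c\<close> it becomes the isomorphism \<open>L A (t X)\<close>, which can be
      cancelled.\<close>
    have "L A (bar (t X)) \<cdot>\<^bsub>HF A\<^esub> L A ?c = L A (t X)"
      using L_Comp[OF A, of ?c "bar (t X)"] b c by simp
    then have iso: "is_iso (HF A) (L A (bar (t X)) \<cdot>\<^bsub>HF A\<^esub> L A ?c)"
      using L_iso[OF A, of "t X"] t_weq[of X] by simp
    have "K \<cdot>\<^bsub>HF A\<^esub> counit X = K' \<cdot>\<^bsub>HF A\<^esub> counit X"
      by (rule Ho_factor_unique[of Z X "Idt S A"])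
        (use K K' b c in \<open>simp_all add: cu X_def[symmetric] Z_def[symmetric] \<iota>_Comp\<close>)
    then have "(K \<cdot>\<^bsub>HF A\<^esub> counit X) \<cdot>\<^bsub>HF A\<^esub> L A ?c = (K' \<cdot>\<^bsub>HF A\<^esub> counit X) \<cdot>\<^bsub>HF A\<^esub> L A ?c" by simp
    then have "K \<cdot>\<^bsub>HF A\<^esub> (L A (bar (t X)) \<cdot>\<^bsub>HF A\<^esub> L A ?c) = K' \<cdot>\<^bsub>HF A\<^esub> (L A (bar (t X)) \<cdot>\<^bsub>HF A\<^esub> L A ?c)"
      using K K' b c by (simp add: cu Comp_assoc X_def[symmetric])
    then show ?thesis
      by (rule Comp_iso_cancel[rotated]) (use K K' iso b c in \<open>simp_all add: X_def[symmetric]\<close>)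
  qed
  have surj: "\<alpha> \<in> FArr (\<iota> A) ` Arr (HF A)" if \<alpha>: "\<alpha> \<in> Arr H" "FArr \<pi> \<alpha> = Idt S A" for \<alpha>
  proof -
    define X Z where "X = Dom H \<alpha>" and "Z = Cod H \<alpha>"
    have XZ [simp]: "X \<in> Obj C" "FO X = A" "Z \<in> Obj C" "FO Z = A"
      using Dom_Obj[OF catH \<alpha>(1)] Cod_Obj[OF catH \<alpha>(1)] \<pi>_Dom[OF \<alpha>(1)] \<pi>_Cod[OF \<alpha>(1)] \<alpha>(2)
      by (simp_all add: X_def Z_def)
    let ?c = "c (Idt S A) (q X)"
    have c: "?c \<in> Arr C" "Dom C ?c = q X" "FA ?c = Idt S A" by simp_all
    obtain g where g: "g \<in> hom (HF A) (Cod C ?c) Z"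
      "\<alpha> = FArr (\<iota> A) g \<cdot>\<^bsub>H\<^esub> N ?c \<cdot>\<^bsub>H\<^esub> inv_arrow H (N (t X))"
      by (rule Ho_factor[of Z \<alpha> X]) (use \<alpha> in \<open>simp_all add: X_def[symmetric] Z_def[symmetric]\<close>)
    have iso: "is_iso (HF A) (L A (t X))" using L_iso[OF A, of "t X"] t_weq[of X] by simp
    have "FArr (\<iota> A) (g \<cdot>\<^bsub>HF A\<^esub> L A ?c \<cdot>\<^bsub>HF A\<^esub> inv_arrow (HF A) (L A (t X))) = \<alpha>"
      using g c iso by (simp add: \<iota>_Comp functor_inv[OF \<iota>_functor])
    moreover have "g \<cdot>\<^bsub>HF A\<^esub> L A ?c \<cdot>\<^bsub>HF A\<^esub> inv_arrow (HF A) (L A (t X)) \<in> Arr (HF A)"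
      using g c iso by simp
    ultimately show ?thesis by (rule image_eqI[OF sym])
  qed
  have "bij_betw (FObj (\<iota> A)) (Obj (HF A)) (Obj (fiber H S \<pi> A))"
    by (rule bij_betw_imageI) (auto intro!: inj_onI simp: image_iff)
  moreover have "bij_betw (FArr (\<iota> A)) (Arr (HF A)) (Arr (fiber H S \<pi> A))"
    using inj surj \<pi>_\<iota>[OF A] by (intro bij_betw_imageI inj_onI equalityI subsetI) auto
  ultimately show ?thesis unfolding cat_iso_def using F by simp
qed

end

section \<open>Opposite categories\<close>

definition op :: "('o, 'a) category \<Rightarrow> ('o, 'a) category" where
  "op C = \<lparr>Obj = Obj C, Arr = Arr C, Dom = Cod C, Cod = Dom C, Idt = Idt C, Comp = \<lambda>v u. u \<cdot>\<^bsub>C\<^esub> v\<rparr>"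

lemma op_simps [simp]:
  "Obj (op C) = Obj C" "Arr (op C) = Arr C" "Dom (op C) = Cod C" "Cod (op C) = Dom C"
  "Idt (op C) = Idt C" "v \<cdot>\<^bsub>op C\<^esub> u = u \<cdot>\<^bsub>C\<^esub> v" "op (op C) = C"
  by (simp_all add: op_def)

lemma hom_op [simp]: "hom (op C) X Y = hom C Y X"
  by (auto simp: hom_def)

lemma is_category_op: "is_category C \<Longrightarrow> is_category (op C)"
  unfolding is_category_def by auto

lemma is_functor_op: "is_functor C D F \<Longrightarrow> is_functor (op C) (op D) F"
  unfolding is_functor_def by (auto simp: is_category_op)

lemma inverse_arrows_op: "inverse_arrows (op C) u v \<longleftrightarrow> inverse_arrows C u v"
  unfolding inverse_arrows_def by auto

lemma is_iso_op [simp]: "is_iso (op C) u \<longleftrightarrow> is_iso C u"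
  by (simp add: is_iso_def inverse_arrows_op)

lemma inv_arrow_op [simp]: "inv_arrow (op C) = inv_arrow C"
  by (simp add: inv_arrow_def inverse_arrows_op fun_eq_iff)

lemma fiber_op [simp]: "fiber (op C) (op S) \<Phi> A = op (fiber C S \<Phi> A)"
  by (simp add: fiber_def op_def)

lemma nat_weq_op: "nat_weq C D W F G \<tau> \<Longrightarrow> nat_weq (op C) (op D) W G F \<tau>"
  unfolding nat_weq_def nat_trans_def by (auto simp: is_functor_op)

lemma cocartesian_op: "cocartesian (op C) (op S) \<Phi> u \<longleftrightarrow> cartesian C S \<Phi> u"
  unfolding cocartesian_def cartesian_def by (simp add: conj_ac)

text \<open>Steps keep their tags: passing to the opposite category already exchanges the ends of
  each arrow, so only the order is reversed.\<close>

definition zigzag_rev :: "('o, 'a) zigzag \<Rightarrow> ('o, 'a) zigzag" where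
  "zigzag_rev = (\<lambda>(X, us, Y). (Y, rev us, X))"

lemma zigzag_rev_simps [simp]:
  "zigzag_rev (X, us, Y) = (Y, rev us, X)" "zigzag_rev (zigzag_rev z) = z"
  by (auto simp: zigzag_rev_def split: prod.splits)

lemma image_zigzag_rev [simp]: "zigzag_rev ` zigzag_rev ` K = K"
  by (simp add: image_image)

context
  fixes C :: "('o, 'a) category" and W :: "'a set"
  assumes cat: "is_category C"
begin

lemma is_zigzag_rev: "is_zigzag C W X us Y \<Longrightarrow> is_zigzag (op C) W Y (rev us) X"
proof (induction us arbitrary: X)
  case (Cons s us)
  then show ?case
    using cat by (cases s) (auto simp: is_zigzag_append[OF is_category_op[OF cat]] intro!: exI[of _ "step_tgt C s"])
qed auto

lemma zigzag_red_rev: "zigzag_red C W us vs \<Longrightarrow> zigzag_red (op C) W (rev us) (rev vs)"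
proof (induction rule: zigzag_red.induct)
  case (red_id X)
  then show ?case using zigzag_red.red_id[of X "op C" W] by simp
next
  case (red_comp u v)
  then show ?case using zigzag_red.red_comp[of v "op C" u W] by simp
next
  case (red_fwd_bwd w)
  then show ?case using zigzag_red.red_bwd_fwd[of w "op C" W] by simp
next
  case (red_bwd_fwd w)
  then show ?case using zigzag_red.red_fwd_bwd[of w "op C" W] by simp
qed

lemma zigzag_eq_rev: "(z, z') \<in> zigzag_eq C W \<Longrightarrow> (zigzag_rev z, zigzag_rev z') \<in> zigzag_eq (op C) W"
proof (induction rule: zigzag_eq.induct)
  case (zz_red us vs X as bs Y)
  then show ?case
    using zigzag_eq.zz_red[OF zigzag_red_rev[OF zz_red(1)], of Y "rev bs" "rev as" X]
      is_zigzag_rev[of X "as @ us @ bs" Y] is_zigzag_rev[of X "as @ vs @ bs" Y]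
    by (simp add: zigzags_def)
next
  case (zz_refl z)
  then show ?case
    using is_zigzag_rev by (cases z) (auto simp: zigzags_def intro: zigzag_eq.zz_refl)
next
  case (zz_sym z z')
  then show ?case by (blast intro: zigzag_eq.zz_sym)
next
  case (zz_trans z z' z'')
  then show ?case by (blast intro: zigzag_eq.zz_trans)
qed

end

context
  fixes C :: "('o, 'a) category" and W :: "'a set"
  assumes cat: "is_category C"
begin

text \<open>Localizing the opposite category gives classes of other lists than the opposite of the
  localization, so the two are not equal. Taking images under \<open>zigzag_rev\<close> is the
  isomorphism along which results are transported.\<close>

lemma zclass_op: "zclass (op C) W Y (rev us) X = zigzag_rev ` zclass C W X us Y"
proof -
  have "z \<in> zigzag_rev ` zclass C W X us Y" if "z \<in> zclass (op C) W Y (rev us) X" for z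
  proof (rule image_eqI)
    show "zigzag_rev z \<in> zclass C W X us Y"
      using that zigzag_eq_rev[OF is_category_op[OF cat], of "(Y, rev us, X)" z W] by (simp add: zclass_def)
  qed simp
  moreover have "zigzag_rev z \<in> zclass (op C) W Y (rev us) X" if "z \<in> zclass C W X us Y" for z
    using that zigzag_eq_rev[OF cat, of "(X, us, Y)" z W] by (simp add: zclass_def)
  ultimately show ?thesis by blast
qed

lemma Ho_op_Arr:
  assumes "K \<in> Arr (Ho C W)"
  shows "zigzag_rev ` K \<in> Arr (Ho (op C) W)"
    "Dom (Ho (op C) W) (zigzag_rev ` K) = Cod (Ho C W) K"
    "Cod (Ho (op C) W) (zigzag_rev ` K) = Dom (Ho C W) K"
proof -
  obtain X us Y where us: "is_zigzag C W X us Y" and K: "K = zclass C W X us Y"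
    using assms by (rule Ho_ArrE[OF cat])
  note z = is_zigzag_rev[OF cat us]
  show "zigzag_rev ` K \<in> Arr (Ho (op C) W)"
    "Dom (Ho (op C) W) (zigzag_rev ` K) = Cod (Ho C W) K"
    "Cod (Ho (op C) W) (zigzag_rev ` K) = Dom (Ho C W) K"
    unfolding K zclass_op[symmetric]
    using us z cat is_category_op[OF cat] by (simp_all add: zclass_Arr Dom_zclass Cod_zclass)
qed

lemma Ho_op_Comp:
  assumes KL: "K \<in> Arr (Ho C W)" "L \<in> Arr (Ho C W)" "Cod (Ho C W) K = Dom (Ho C W) L"
  shows "zigzag_rev ` (L \<cdot>\<^bsub>Ho C W\<^esub> K) = zigzag_rev ` K \<cdot>\<^bsub>Ho (op C) W\<^esub> zigzag_rev ` L"
proof -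
  obtain X us Y where us: "is_zigzag C W X us Y" and K: "K = zclass C W X us Y"
    using KL(1) by (rule Ho_ArrE[OF cat])
  have "Dom (Ho C W) L = Y" using KL(3) K Cod_zclass[OF cat us] by simp
  with KL(2) obtain vs Z where vs: "is_zigzag C W Y vs Z" and L: "L = zclass C W Y vs Z"
    by (rule Ho_DomE[OF cat])
  show ?thesis
    unfolding K L Comp_zclass[OF cat us vs] zclass_op[symmetric]
    using Comp_zclass[OF is_category_op[OF cat] is_zigzag_rev[OF cat vs] is_zigzag_rev[OF cat us]] by simp
qed

end

context
  fixes C :: "('o, 'a) category" and S :: "('b, 's) category" and W :: "'a set"
    and \<Phi> :: "('o, 'a, 'b, 's) fmap"
  assumes \<Phi>: "is_functor C S \<Phi>" and inverts: "\<And>w. w \<in> Arr C \<Longrightarrow> w \<in> W \<Longrightarrow> is_iso S (FArr \<Phi> w)"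
begin

lemma Ho_lift_op:
  assumes "K \<in> Arr (Ho C W)"
  shows "FArr (Ho_lift (op C) (op S) \<Phi>) (zigzag_rev ` K) = FArr (Ho_lift C S \<Phi>) K"
proof -
  note cat = functor_source[OF \<Phi>] and \<Phi>op = is_functor_op[OF \<Phi>]
  have inv': "is_iso (op S) (FArr \<Phi> w)" if "w \<in> Arr (op C)" "w \<in> W" for w
    using inverts that by simp
  have ev: "eval_zigzag (op C) (op S) \<Phi> Y (rev us) = eval_zigzag C S \<Phi> X us" if "is_zigzag C W X us Y" for X us Y
    using that
  proof (induction us arbitrary: X)
    case (Cons s us)
    have z: "is_zigzag (op C) W Y (rev us) (step_tgt C s)"
      using Cons(2) is_zigzag_rev[OF cat] by simp
    have s: "is_zigzag (op C) W (step_tgt C s) [s] X"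
      using Cons(2) is_zigzag_rev[OF cat, of W X "[s]" "step_tgt C s"] is_zigzag_Obj[OF cat Cons(2)] is_zigzag_Obj[OF cat, of W "step_tgt C s" us Y]
      by simp
    have "eval_zigzag (op C) (op S) \<Phi> Y (rev us @ [s]) =
        eval_zigzag C S \<Phi> (step_tgt C s) us \<cdot>\<^bsub>S\<^esub> eval_zigzag (op C) (op S) \<Phi> (step_tgt C s) [s]"
      using eval_zigzag_append[OF \<Phi>op inv' z s] Cons(1)[of "step_tgt C s"] Cons(2) by simp
    also have "\<dots> = eval_zigzag C S \<Phi> X (s # us)"
      using Cons(2) functor_simps[OF \<Phi>] inverts functor_target[OF \<Phi>] by (cases s) auto
    finally show ?case by simp
  qed auto
  obtain X us Y where us: "is_zigzag C W X us Y" and K: "K = zclass C W X us Y"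
    using assms by (rule Ho_ArrE[OF cat])
  show ?thesis
    unfolding K zclass_op[OF cat, symmetric]
    using FArr_Ho_lift_zclass[OF \<Phi> inverts us] FArr_Ho_lift_zclass[OF \<Phi>op inv' is_zigzag_rev[OF cat us]] ev[OF us] by simp
qed

lemma cartesian_if_cocartesian_op:
  assumes K: "K \<in> Arr (Ho C W)"
    and cocart: "cocartesian (Ho (op C) W) (op S) (Ho_lift (op C) (op S) \<Phi>) (zigzag_rev ` K)"
  shows "cartesian (Ho C W) S (Ho_lift C S \<Phi>) K"
  unfolding cartesian_def
proof (intro conjI ballI impI)
  note cat = functor_source[OF \<Phi>]
  note R = Ho_op_Arr[OF cat] Ho_lift_op
  have R': "zigzag_rev ` M \<in> Arr (Ho C W)" "Dom (Ho C W) (zigzag_rev ` M) = Cod (Ho (op C) W) M"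
    "Cod (Ho C W) (zigzag_rev ` M) = Dom (Ho (op C) W) M" if "M \<in> Arr (Ho (op C) W)" for M
    using Ho_op_Arr[OF is_category_op[OF cat] that] by simp_all
  let ?H = "Ho C W" and ?H' = "Ho (op C) W" and ?P = "Ho_lift C S \<Phi>" and ?P' = "Ho_lift (op C) (op S) \<Phi>"
  have [simp]: "FObj ?P = FObj \<Phi>" "FObj ?P' = FObj \<Phi>" by (simp_all add: Ho_lift_def)
  show "K \<in> Arr ?H" by (rule K)
  fix Y v h assume Y: "Y \<in> Obj ?H" and v: "v \<in> hom ?H Y (Cod ?H K)"
    and h: "h \<in> hom S (FObj ?P Y) (FObj ?P (Dom ?H K))" and vh: "FArr ?P v = FArr ?P K \<cdot>\<^bsub>S\<^esub> h"
  have ex: "\<exists>!w. w \<in> hom ?H' (Dom ?H K) Y \<and> FArr ?P' w = h \<and> w \<cdot>\<^bsub>?H'\<^esub> zigzag_rev ` K = zigzag_rev ` v"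
    using cocart[unfolded cocartesian_def, THEN conjunct2, rule_format, of Y "zigzag_rev ` v" h]
      Y v h vh K by (simp add: R cat is_category_op)
  show "\<exists>!w. w \<in> hom ?H Y (Dom ?H K) \<and> FArr ?P w = h \<and> K \<cdot>\<^bsub>?H\<^esub> w = v"
  proof (rule ex_ex1I)
    from ex obtain w where w: "w \<in> hom ?H' (Dom ?H K) Y" "FArr ?P' w = h"
      "w \<cdot>\<^bsub>?H'\<^esub> zigzag_rev ` K = zigzag_rev ` v" by blast
    have w': "zigzag_rev ` w \<in> hom ?H Y (Dom ?H K)" using w(1) R'[of w] by simp
    moreover have "FArr ?P (zigzag_rev ` w) = h" using w(2) w' R(4)[of "zigzag_rev ` w"] by simp
    moreover have "K \<cdot>\<^bsub>?H\<^esub> zigzag_rev ` w = v"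
    proof -
      have "zigzag_rev ` (K \<cdot>\<^bsub>?H\<^esub> zigzag_rev ` w) = zigzag_rev ` v"
        using Ho_op_Comp[OF cat, of "zigzag_rev ` w" W K] w(3) w' K by simp
      then show ?thesis by (metis image_zigzag_rev)
    qed
    ultimately show "\<exists>w. w \<in> hom ?H Y (Dom ?H K) \<and> FArr ?P w = h \<and> K \<cdot>\<^bsub>?H\<^esub> w = v" by blast
  next
    fix w w' assume w: "w \<in> hom ?H Y (Dom ?H K) \<and> FArr ?P w = h \<and> K \<cdot>\<^bsub>?H\<^esub> w = v"
      "w' \<in> hom ?H Y (Dom ?H K) \<and> FArr ?P w' = h \<and> K \<cdot>\<^bsub>?H\<^esub> w' = v"
    have "zigzag_rev ` x \<in> hom ?H' (Dom ?H K) Y \<and> FArr ?P' (zigzag_rev ` x) = h \<and>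
        zigzag_rev ` x \<cdot>\<^bsub>?H'\<^esub> zigzag_rev ` K = zigzag_rev ` v"
      if "x \<in> hom ?H Y (Dom ?H K) \<and> FArr ?P x = h \<and> K \<cdot>\<^bsub>?H\<^esub> x = v" for x
      using that R[of x] Ho_op_Comp[OF cat, of x W K] K by auto
    then have "zigzag_rev ` w = zigzag_rev ` w'" using ex w by blast
    then show "w = w'" by (metis image_zigzag_rev)
  qed
qed

end

section \<open>The Beck-Chevalley map\<close>

context
  fixes C :: "('o, 'a) category" (structure) and S :: "('b, 's) category"
    and \<Phi> :: "('o, 'a, 'b, 's) fmap"
  assumes \<Phi>: "is_functor C S \<Phi>"
begin

private lemmas [simp] = functor_simps[OF \<Phi>]

lemma cocartesian_Comp:
  assumes u: "cocartesian C S \<Phi> u" and v: "cocartesian C S \<Phi> v" and uv: "Cod C u = Dom C v"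
  shows "cocartesian C S \<Phi> (v \<cdot> u)"
  unfolding cocartesian_def
proof (intro conjI ballI impI)
  note [simp] = cocartesian_Arr[OF \<Phi> u] cocartesian_Arr[OF \<Phi> v] uv
  show "v \<cdot> u \<in> Arr C" by simp
  fix Y x h assume Y: "Y \<in> Obj C" "x \<in> hom C (Dom C (v \<cdot> u)) Y"
    "h \<in> hom S (FObj \<Phi> (Cod C (v \<cdot> u))) (FObj \<Phi> Y)" and x: "FArr \<Phi> x = h \<cdot>\<^bsub>S\<^esub> FArr \<Phi> (v \<cdot> u)"
  obtain y where y: "y \<in> hom C (Cod C u) (Cod C x)" "FArr \<Phi> y = h \<cdot>\<^bsub>S\<^esub> FArr \<Phi> v" "y \<cdot> u = x"
    by (rule cocartesian_factor[OF \<Phi> u, of x "h \<cdot>\<^bsub>S\<^esub> FArr \<Phi> v"]) (use Y x in \<open>auto simp: Comp_assoc\<close>)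
  obtain w where w: "w \<in> hom C (Cod C v) (Cod C y)" "FArr \<Phi> w = h" "w \<cdot> v = y"
    by (rule cocartesian_factor[OF \<Phi> v, of y h]) (use Y y in auto)
  show "\<exists>!w. w \<in> hom C (Cod C (v \<cdot> u)) Y \<and> FArr \<Phi> w = h \<and> w \<cdot> v \<cdot> u = x"
  proof (rule ex1I[of _ w])
    have "w \<cdot> v \<cdot> u = (w \<cdot> v) \<cdot> u" using w(1) by (simp add: Comp_assoc)
    then show "w \<in> hom C (Cod C (v \<cdot> u)) Y \<and> FArr \<Phi> w = h \<and> w \<cdot> v \<cdot> u = x"
      using w y Y by auto
    fix w' assume w': "w' \<in> hom C (Cod C (v \<cdot> u)) Y \<and> FArr \<Phi> w' = h \<and> w' \<cdot> v \<cdot> u = x"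
    have "w' \<cdot> v = y"
    proof (rule cocartesian_cancel[OF \<Phi> u])
      show "(w' \<cdot> v) \<cdot> u = y \<cdot> u" using w' y by (simp add: Comp_assoc)
    qed (use w' y Y in auto)
    moreover have "Cod C w = Y" "Cod C w' = Y" using w(1) w' y(1) Y by auto
    ultimately show "w' = w"
      using cocartesian_cancel[OF \<Phi> v, of w' w] w w' by simp
  qed
qed

lemma cocart_factor:
  assumes "cocartesian C S \<Phi> u" "v \<in> Arr C" "Dom C v = Dom C u"
    "h \<in> Arr S" "Dom S h = FObj \<Phi> (Cod C u)" "Cod S h = FObj \<Phi> (Cod C v)" "FArr \<Phi> v = h \<cdot>\<^bsub>S\<^esub> FArr \<Phi> u"
  shows "cocart_factor C \<Phi> u h v \<in> Arr C" "Dom C (cocart_factor C \<Phi> u h v) = Cod C u"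
    "Cod C (cocart_factor C \<Phi> u h v) = Cod C v" "FArr \<Phi> (cocart_factor C \<Phi> u h v) = h"
    "cocart_factor C \<Phi> u h v \<cdot> u = v"
proof -
  have "\<exists>!w. w \<in> hom C (Cod C u) (Cod C v) \<and> FArr \<Phi> w = h \<and> w \<cdot> u = v"
    using assms(1)[unfolded cocartesian_def, THEN conjunct2, rule_format, of "Cod C v" v h] assms(2-)
    by simp
  from theI'[OF this] show "cocart_factor C \<Phi> u h v \<in> Arr C" "Dom C (cocart_factor C \<Phi> u h v) = Cod C u"
    "Cod C (cocart_factor C \<Phi> u h v) = Cod C v" "FArr \<Phi> (cocart_factor C \<Phi> u h v) = h"
    "cocart_factor C \<Phi> u h v \<cdot> u = v"
    unfolding cocart_factor_def by simp_all
qed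

lemma cocart_factor_eqI:
  assumes "cocartesian C S \<Phi> u" "w \<in> Arr C" "Dom C w = Cod C u" "FArr \<Phi> w = h" "w \<cdot> u = v"
  shows "cocart_factor C \<Phi> u h v = w"
proof -
  have u: "u \<in> Arr C" by (rule cocartesian_Arr[OF \<Phi> assms(1)])
  have v: "v \<in> Arr C" "Dom C v = Dom C u" "Cod C v = Cod C w" "FArr \<Phi> v = h \<cdot>\<^bsub>S\<^esub> FArr \<Phi> u"
    using assms u by auto
  note cf = cocart_factor[OF assms(1) v(1,2), of h]
  show ?thesis
    by (rule cocartesian_cancel[OF \<Phi> assms(1)]) (use assms u v cf in auto)
qed

end

lemma cocart_factor_op: "cocart_factor (op C) \<Phi> u h v = cart_factor C \<Phi> u h v"
  by (simp add: cocart_factor_def cart_factor_def del: hom_iff)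

context
  fixes C :: "('o, 'a) category" (structure) and S :: "('b, 's) category"
    and \<Phi> :: "('o, 'a, 'b, 's) fmap"
  assumes \<Phi>: "is_functor C S \<Phi>"
begin

private lemmas cat = functor_source[OF \<Phi>]
private lemmas [simp] = functor_simps[OF \<Phi>]
private lemmas dual = is_functor_op[OF \<Phi>]

lemmas cartesian_Arr = cocartesian_Arr[OF dual, unfolded cocartesian_op op_simps]
lemmas cartesian_cancel = cocartesian_cancel[OF dual, unfolded cocartesian_op op_simps]
lemmas cartesian_Comp = cocartesian_Comp[OF dual, unfolded cocartesian_op op_simps]
lemmas cartesian_comparison = cocartesian_comparison[OF dual, unfolded cocartesian_op op_simps is_iso_op]
lemmas cart_factor = cocart_factor[OF dual, unfolded cocartesian_op op_simps cocart_factor_op]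

lemma is_iso_fiber:
  assumes "is_iso C b" "FArr \<Phi> b = Idt S A" "A \<in> Obj S"
  shows "is_iso (fiber C S \<Phi> A) b"
proof -
  have "FArr \<Phi> (inv_arrow C b) = Idt S A" using functor_inv[OF \<Phi> assms(1)] assms by simp
  then have "inverse_arrows (fiber C S \<Phi> A) b (inv_arrow C b)"
    using inverse_inv_arrow[OF cat assms(1)] assms by (simp add: inverse_arrows_def)
  then show ?thesis unfolding is_iso_def by blast
qed

lemma is_iso_if_fiber: "is_iso (fiber C S \<Phi> A) b \<Longrightarrow> is_iso C b"
  by (auto simp: is_iso_def inverse_arrows_def)

context
  fixes \<kappa> :: "('o, 'a, 's) cleavage"
  assumes \<kappa>: "is_cleavage C S \<Phi> \<kappa>"
begin

lemma Cart_simps: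
  assumes "k \<in> Arr S" "Y \<in> Obj C" "FObj \<Phi> Y = Cod S k"
  shows "cartesian C S \<Phi> (Cart \<kappa> k Y)" "Cart \<kappa> k Y \<in> Arr C" "Cod C (Cart \<kappa> k Y) = Y"
    "FArr \<Phi> (Cart \<kappa> k Y) = k" "FObj \<Phi> (Dom C (Cart \<kappa> k Y)) = Dom S k"
proof -
  show *: "cartesian C S \<Phi> (Cart \<kappa> k Y)" "Cod C (Cart \<kappa> k Y) = Y" "FArr \<Phi> (Cart \<kappa> k Y) = k"
    using \<kappa> assms unfolding is_cleavage_def by blast+
  then show "Cart \<kappa> k Y \<in> Arr C" by (simp add: cartesian_Arr)
  then show "FObj \<Phi> (Dom C (Cart \<kappa> k Y)) = Dom S k" using functor_Dom[OF \<Phi>, of "Cart \<kappa> k Y"] * by simp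
qed

lemma Cocart_simps:
  assumes "k \<in> Arr S" "Y \<in> Obj C" "FObj \<Phi> Y = Dom S k"
  shows "cocartesian C S \<Phi> (Cocart \<kappa> k Y)" "Cocart \<kappa> k Y \<in> Arr C" "Dom C (Cocart \<kappa> k Y) = Y"
    "FArr \<Phi> (Cocart \<kappa> k Y) = k" "FObj \<Phi> (Cod C (Cocart \<kappa> k Y)) = Cod S k"
proof -
  show *: "cocartesian C S \<Phi> (Cocart \<kappa> k Y)" "Dom C (Cocart \<kappa> k Y) = Y" "FArr \<Phi> (Cocart \<kappa> k Y) = k"
    using \<kappa> assms unfolding is_cleavage_def by blast+
  then show "Cocart \<kappa> k Y \<in> Arr C" by (simp add: cocartesian_Arr[OF \<Phi>])
  then show "FObj \<Phi> (Cod C (Cocart \<kappa> k Y)) = Cod S k" using functor_Cod[OF \<Phi>, of "Cocart \<kappa> k Y"] * by simp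
qed

end

context
  fixes \<kappa> :: "('o, 'a, 's) cleavage" and g f p q :: 's and X :: 'o
  assumes \<kappa>: "is_cleavage C S \<Phi> \<kappa>"
    and sq: "commuting_square S (g, f, p, q)"
    and X: "X \<in> Obj C" "FObj \<Phi> X = Cod S g"
begin

text \<open>The units, counits and functors involved are all factorizations through cartesian or
  cocartesian arrows. Between \<open>c\<close> and \<open>d\<close> each of them is removed by its
  defining equation, which leaves an equation free of all auxiliary choices.\<close>

lemma beck_chevalley_map:
  defines "a \<equiv> Cart \<kappa> g X" and "d \<equiv> Cocart \<kappa> f (Dom C (Cart \<kappa> g X))" and "e \<equiv> Cocart \<kappa> p X"
    and "c \<equiv> Cart \<kappa> q (Cod C (Cocart \<kappa> p X))"
    and "b \<equiv> beck_chevalley_map C S \<Phi> \<kappa> (g, f, p, q) X"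
  shows "b \<in> Arr C" "Dom C b = Cod C d" "Cod C b = Dom C c" "FArr \<Phi> b = Idt S (Cod S f)"
    "c \<cdot> b \<cdot> d = e \<cdot> a"
proof -
  have s [simp]: "g \<in> Arr S" "f \<in> Arr S" "p \<in> Arr S" "q \<in> Arr S" "Dom S g = Dom S f" "Cod S g = Dom S p"
    "Cod S f = Dom S q" "Cod S p = Cod S q" and pg: "p \<cdot>\<^bsub>S\<^esub> g = q \<cdot>\<^bsub>S\<^esub> f"
    using sq by simp_all
  define Z where "Z = Cod C e"
  have a: "a \<in> Arr C" "Cod C a = X" "FArr \<Phi> a = g" "FObj \<Phi> (Dom C a) = Dom S f"
    using Cart_simps[OF \<kappa>, of g X] X by (simp_all add: a_def)
  have e: "e \<in> Arr C" "Dom C e = X" "FArr \<Phi> e = p" "Cod C e = Z" "FObj \<Phi> Z = Cod S q"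
    using Cocart_simps[OF \<kappa>, of p X] X by (simp_all add: e_def Z_def)
  have Z: "Z \<in> Obj C" using e by auto
  define cp where "cp = Cart \<kappa> p Z"
  have cp: "cartesian C S \<Phi> cp" "cp \<in> Arr C" "Cod C cp = Z" "FArr \<Phi> cp = p" "FObj \<Phi> (Dom C cp) = Dom S p"
    using Cart_simps[OF \<kappa>, of p Z] e Z by (simp_all add: cp_def)
  have cc: "cartesian C S \<Phi> c" "c \<in> Arr C" "Cod C c = Z" "FArr \<Phi> c = q" "FObj \<Phi> (Dom C c) = Dom S q"
    using Cart_simps[OF \<kappa>, of q Z] e Z by (simp_all add: c_def e_def[symmetric])
  \<comment> \<open>\<open>\<eta>\<close> is the unit and \<open>\<gamma>\<close> its pullback along
    \<open>g\<close>; \<open>\<psi>\<close> compares the two iterated pullbacks;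
    \<open>\<delta>1\<close> and \<open>\<delta>2\<close> are the pushforwards of
    \<open>\<gamma>\<close> and \<open>\<psi>\<close> along \<open>f\<close>;
    \<open>\<epsilon>\<close> is the counit.\<close>
  define \<eta> where "\<eta> = cart_factor C \<Phi> cp (Idt S (Dom S p)) e"
  have \<eta>: "\<eta> \<in> Arr C" "Cod C \<eta> = Dom C cp" "Dom C \<eta> = X" "FArr \<Phi> \<eta> = Idt S (Dom S p)" "cp \<cdot> \<eta> = e"
    using cart_factor[OF cp(1) e(1), of "Idt S (Dom S p)"] cp e X by (simp_all add: \<eta>_def)
  define a' where "a' = Cart \<kappa> g (Dom C cp)"
  have a': "cartesian C S \<Phi> a'" "a' \<in> Arr C" "Cod C a' = Dom C cp" "FArr \<Phi> a' = g" "FObj \<Phi> (Dom C a') = Dom S f"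
    using Cart_simps[OF \<kappa>, of g "Dom C cp"] cp by (simp_all add: a'_def)
  have \<eta>a: "\<eta> \<cdot> a \<in> Arr C" "Dom C (\<eta> \<cdot> a) = Dom C a" "Cod C (\<eta> \<cdot> a) = Dom C cp" "FArr \<Phi> (\<eta> \<cdot> a) = g"
    using \<eta> a by simp_all
  define \<gamma> where "\<gamma> = cart_factor C \<Phi> a' (Idt S (Dom S g)) (\<eta> \<cdot> a)"
  have \<gamma>: "\<gamma> \<in> Arr C" "Cod C \<gamma> = Dom C a'" "Dom C \<gamma> = Dom C a" "FArr \<Phi> \<gamma> = Idt S (Dom S f)" "a' \<cdot> \<gamma> = \<eta> \<cdot> a"
    using cart_factor[OF a'(1) \<eta>a(1), of "Idt S (Dom S g)"] a' a \<eta>a by (simp_all add: \<gamma>_def)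
  define a2 where "a2 = Cart \<kappa> f (Dom C c)"
  have a2: "cartesian C S \<Phi> a2" "a2 \<in> Arr C" "Cod C a2 = Dom C c" "FArr \<Phi> a2 = f" "FObj \<Phi> (Dom C a2) = Dom S f"
    using Cart_simps[OF \<kappa>, of f "Dom C c"] cc by (simp_all add: a2_def)
  have ca2: "cartesian C S \<Phi> (c \<cdot> a2)" using cartesian_Comp[OF cc(1) a2(1)] a2 by simp
  have ca2': "c \<cdot> a2 \<in> Arr C" "Dom C (c \<cdot> a2) = Dom C a2" "Cod C (c \<cdot> a2) = Z" "FArr \<Phi> (c \<cdot> a2) = q \<cdot>\<^bsub>S\<^esub> f"
    using cc a2 by simp_all
  have cpa: "cp \<cdot> a' \<in> Arr C" "Dom C (cp \<cdot> a') = Dom C a'" "Cod C (cp \<cdot> a') = Z" "FArr \<Phi> (cp \<cdot> a') = q \<cdot>\<^bsub>S\<^esub> f"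
    using cp a' pg by simp_all
  define \<psi> where "\<psi> = cart_factor C \<Phi> (c \<cdot> a2) (Idt S (Dom S f)) (cp \<cdot> a')"
  have \<psi>: "\<psi> \<in> Arr C" "Cod C \<psi> = Dom C a2" "Dom C \<psi> = Dom C a'" "FArr \<Phi> \<psi> = Idt S (Dom S f)"
      "(c \<cdot> a2) \<cdot> \<psi> = cp \<cdot> a'"
    using cart_factor[OF ca2 cpa(1), of "Idt S (Dom S f)"] ca2' cpa a2 a' by (simp_all add: \<psi>_def)
  have d: "cocartesian C S \<Phi> d" "d \<in> Arr C" "Dom C d = Dom C a" "FArr \<Phi> d = f" "FObj \<Phi> (Cod C d) = Cod S f"
    using Cocart_simps[OF \<kappa>, of f "Dom C a"] a by (simp_all add: d_def a_def[symmetric])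
  define d' d2 where "d' = Cocart \<kappa> f (Dom C a')" and "d2 = Cocart \<kappa> f (Dom C a2)"
  have d': "cocartesian C S \<Phi> d'" "d' \<in> Arr C" "Dom C d' = Dom C a'" "FArr \<Phi> d' = f" "FObj \<Phi> (Cod C d') = Cod S f"
    using Cocart_simps[OF \<kappa>, of f "Dom C a'"] a' by (simp_all add: d'_def)
  have d2: "cocartesian C S \<Phi> d2" "d2 \<in> Arr C" "Dom C d2 = Dom C a2" "FArr \<Phi> d2 = f" "FObj \<Phi> (Cod C d2) = Cod S f"
    using Cocart_simps[OF \<kappa>, of f "Dom C a2"] a2 by (simp_all add: d2_def)
  define \<delta>1 where "\<delta>1 = cocart_factor C \<Phi> d (Idt S (Cod S f)) (d' \<cdot> \<gamma>)"
  have \<delta>1: "\<delta>1 \<in> Arr C" "Dom C \<delta>1 = Cod C d" "Cod C \<delta>1 = Cod C d'" "FArr \<Phi> \<delta>1 = Idt S (Cod S f)" "\<delta>1 \<cdot> d = d' \<cdot> \<gamma>"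
    using cocart_factor[OF \<Phi> d(1), of "d' \<cdot> \<gamma>" "Idt S (Cod S f)"] d d' \<gamma> by (simp_all add: \<delta>1_def)
  define \<delta>2 where "\<delta>2 = cocart_factor C \<Phi> d' (Idt S (Cod S f)) (d2 \<cdot> \<psi>)"
  have \<delta>2: "\<delta>2 \<in> Arr C" "Dom C \<delta>2 = Cod C d'" "Cod C \<delta>2 = Cod C d2" "FArr \<Phi> \<delta>2 = Idt S (Cod S f)" "\<delta>2 \<cdot> d' = d2 \<cdot> \<psi>"
    using cocart_factor[OF \<Phi> d'(1), of "d2 \<cdot> \<psi>" "Idt S (Cod S f)"] d' d2 \<psi> by (simp_all add: \<delta>2_def)
  define \<epsilon> where "\<epsilon> = cocart_factor C \<Phi> d2 (Idt S (Cod S f)) a2"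
  have \<epsilon>: "\<epsilon> \<in> Arr C" "Dom C \<epsilon> = Cod C d2" "Cod C \<epsilon> = Dom C c" "FArr \<Phi> \<epsilon> = Idt S (Cod S f)" "\<epsilon> \<cdot> d2 = a2"
    using cocart_factor[OF \<Phi> d2(1), of a2 "Idt S (Cod S f)"] d2 a2 cc by (simp_all add: \<epsilon>_def)
  have "unit_arr C S \<Phi> \<kappa> p X = \<eta>"
    by (simp add: unit_arr_def push_def \<eta>_def cp_def e_def Z_def)
  moreover have "FArr (pull C S \<Phi> \<kappa> g) \<eta> = \<gamma>"
    using \<eta> by (simp add: pull_def \<gamma>_def a'_def a_def)
  moreover have "FArr (push C S \<Phi> \<kappa> f) \<gamma> = \<delta>1"
    using \<gamma> by (simp add: push_def \<delta>1_def d_def a_def d'_def)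
  moreover have "pull_pull_iso C S \<Phi> \<kappa> (g, f, p, q) Z = \<psi>"
    by (simp add: pull_pull_iso_def pull_def \<psi>_def a2_def c_def e_def cp_def a'_def Z_def)
  moreover have "FArr (push C S \<Phi> \<kappa> f) \<psi> = \<delta>2"
    using \<psi> by (simp add: push_def \<delta>2_def d2_def d'_def)
  moreover have "counit_arr C S \<Phi> \<kappa> f (Dom C c) = \<epsilon>"
    by (simp add: counit_arr_def pull_def \<epsilon>_def d2_def a2_def)
  moreover have "FObj (push C S \<Phi> \<kappa> p) X = Z" "FObj (pull C S \<Phi> \<kappa> q) Z = Dom C c"
    by (simp_all add: push_def pull_def Z_def e_def c_def)
  ultimately have b: "b = \<epsilon> \<cdot> \<delta>2 \<cdot> \<delta>1"
    by (simp add: b_def beck_chevalley_map_def)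
  show "b \<in> Arr C" "Dom C b = Cod C d" "Cod C b = Dom C c" "FArr \<Phi> b = Idt S (Cod S f)"
    unfolding b using \<epsilon> \<delta>1 \<delta>2 by simp_all
  have "c \<cdot> b \<cdot> d = c \<cdot> \<epsilon> \<cdot> \<delta>2 \<cdot> (\<delta>1 \<cdot> d)"
    unfolding b using \<epsilon>(1-4) \<delta>1(1-4) \<delta>2(1-4) d cc by (simp add: Comp_assoc)
  also have "\<dots> = c \<cdot> \<epsilon> \<cdot> (\<delta>2 \<cdot> d') \<cdot> \<gamma>"
    unfolding \<delta>1(5) using \<epsilon>(1-4) \<delta>2(1-4) d' cc \<gamma>(1-4) by (simp add: Comp_assoc)
  also have "\<dots> = c \<cdot> (\<epsilon> \<cdot> d2) \<cdot> \<psi> \<cdot> \<gamma>"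
    unfolding \<delta>2(5) using \<epsilon>(1-4) d2 cc \<gamma>(1-4) \<psi>(1-4) by (simp add: Comp_assoc)
  also have "\<dots> = ((c \<cdot> a2) \<cdot> \<psi>) \<cdot> \<gamma>"
    unfolding \<epsilon>(5) using a2 cc \<gamma>(1-4) \<psi>(1-4) by (simp add: Comp_assoc)
  also have "\<dots> = cp \<cdot> (a' \<cdot> \<gamma>)"
    unfolding \<psi>(5) using cp a' \<gamma>(1-4) by (simp add: Comp_assoc)
  also have "\<dots> = (cp \<cdot> \<eta>) \<cdot> a"
    unfolding \<gamma>(5) using cp \<eta>(1-4) a by (simp add: Comp_assoc)
  finally show "c \<cdot> b \<cdot> d = e \<cdot> a" unfolding \<eta>(5) .
qed

end

text \<open>The isomorphism \<open>s\<close> induces isomorphisms between corresponding ends of the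
  two systems of arrows. Both \<open>b' \<cdot> m\<close> and \<open>n \<cdot> b\<close> complete
  the same diagram, so they agree, and \<open>b'\<close> is invertible with \<open>b\<close>. This
  permits changing the cleavage and the object at once.\<close>

lemma base_change_iso_transfer:
  assumes S: "commuting_square S (g, f, p, q)"
    and a: "cartesian C S \<Phi> a" "FArr \<Phi> a = g" and d: "cocartesian C S \<Phi> d" "FArr \<Phi> d = f" "Dom C d = Dom C a"
    and e: "cocartesian C S \<Phi> e" "FArr \<Phi> e = p" "Dom C e = Cod C a"
    and c: "cartesian C S \<Phi> c" "FArr \<Phi> c = q" "Cod C c = Cod C e"
    and b: "b \<in> Arr C" "Dom C b = Cod C d" "Cod C b = Dom C c" "FArr \<Phi> b = Idt S (Cod S f)" "c \<cdot> b \<cdot> d = e \<cdot> a"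
    and a': "cartesian C S \<Phi> a'" "FArr \<Phi> a' = g" and d': "cocartesian C S \<Phi> d'" "FArr \<Phi> d' = f" "Dom C d' = Dom C a'"
    and e': "cocartesian C S \<Phi> e'" "FArr \<Phi> e' = p" "Dom C e' = Cod C a'"
    and c': "cartesian C S \<Phi> c'" "FArr \<Phi> c' = q" "Cod C c' = Cod C e'"
    and b': "b' \<in> Arr C" "Dom C b' = Cod C d'" "Cod C b' = Dom C c'" "FArr \<Phi> b' = Idt S (Cod S f)"
      "c' \<cdot> b' \<cdot> d' = e' \<cdot> a'"
    and s: "is_iso C s" "Dom C s = Cod C a" "Cod C s = Cod C a'" "FArr \<Phi> s = Idt S (Cod S g)"
    and iso: "is_iso C b"
  shows "is_iso C b'"
proof -
  have sq [simp]: "g \<in> Arr S" "f \<in> Arr S" "p \<in> Arr S" "q \<in> Arr S" "Dom S g = Dom S f" "Cod S g = Dom S p"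
    "Cod S f = Dom S q" "Cod S p = Cod S q" and pg: "p \<cdot>\<^bsub>S\<^esub> g = q \<cdot>\<^bsub>S\<^esub> f"
    using S by simp_all
  note [simp] = cartesian_Arr[OF a(1)] cartesian_Arr[OF a'(1)] cartesian_Arr[OF c(1)] cartesian_Arr[OF c'(1)]
    cocartesian_Arr[OF \<Phi> d(1)] cocartesian_Arr[OF \<Phi> d'(1)] cocartesian_Arr[OF \<Phi> e(1)] cocartesian_Arr[OF \<Phi> e'(1)]
    is_iso_Arr[OF cat s(1)]
  have FO: "FObj \<Phi> (Dom C a) = Dom S f" "FObj \<Phi> (Cod C e) = Cod S q" "FObj \<Phi> (Cod C d) = Dom S q"
    "FObj \<Phi> (Dom C c) = Dom S q"
    using functor_Dom[OF \<Phi>, of a] functor_Cod[OF \<Phi>, of e] functor_Cod[OF \<Phi>, of d] functor_Dom[OF \<Phi>, of c] a d e c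
    by simp_all
  have "is_iso C (inv_arrow C s)" "FArr \<Phi> (inv_arrow C s) = Idt S (Cod S g)"
    using s functor_inv[OF \<Phi> s(1)] cat by simp_all
  \<comment> \<open>The cartesian comparison is dual to the cocartesian one and runs against
    \<open>s\<close>; hence it is applied to the inverse of \<open>s\<close> and then inverted. The
    same is done for \<open>n\<close> below.\<close>
  obtain \<phi>' where \<phi>': "is_iso C \<phi>'" "Cod C \<phi>' = Dom C a" "Dom C \<phi>' = Dom C a'" "FArr \<Phi> \<phi>' = Idt S (FObj \<Phi> (Dom C a))"
    "a \<cdot> \<phi>' = inv_arrow C s \<cdot> a'"
    by (rule cartesian_comparison[OF a(1) a'(1), of "inv_arrow C s" "Cod S g"])
      (use a a' s cat \<open>is_iso C (inv_arrow C s)\<close> \<open>FArr \<Phi> (inv_arrow C s) = Idt S (Cod S g)\<close> in auto)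
  define \<phi> where "\<phi> = inv_arrow C \<phi>'"
  have \<phi>: "is_iso C \<phi>" "Dom C \<phi> = Dom C a" "Cod C \<phi> = Dom C a'" "FArr \<Phi> \<phi> = Idt S (Dom S f)" "\<phi> \<in> Arr C"
    using \<phi>' functor_inv[OF \<Phi> \<phi>'(1)] cat FO by (simp_all add: \<phi>_def)
  have "s \<cdot> a = (s \<cdot> (a \<cdot> \<phi>')) \<cdot> \<phi>"
    using \<phi>'(1-4) s cat by (simp add: Comp_assoc \<phi>_def is_iso_Arr)
  also have "\<dots> = a' \<cdot> \<phi>"
    unfolding \<phi>'(5) using \<phi> s cat a' by (simp add: Comp_assoc)
  finally have sa: "s \<cdot> a = a' \<cdot> \<phi>" .
  obtain z where z: "is_iso C z" "Dom C z = Cod C e" "Cod C z = Cod C e'"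
      "FArr \<Phi> z = Idt S (FObj \<Phi> (Cod C e))" "z \<cdot> e = e' \<cdot> s"
    by (rule cocartesian_comparison[OF \<Phi> e(1) e'(1), of s "Cod S g"]) (use e e' s in auto)
  obtain m where m: "is_iso C m" "Dom C m = Cod C d" "Cod C m = Cod C d'"
      "FArr \<Phi> m = Idt S (FObj \<Phi> (Cod C d))" "m \<cdot> d = d' \<cdot> \<phi>"
    by (rule cocartesian_comparison[OF \<Phi> d(1) d'(1), of \<phi> "Dom S f"]) (use d d' \<phi> in auto)
  have zc: "z \<cdot> c \<in> Arr C" "Cod C (z \<cdot> c) = Cod C c'" "Dom C (z \<cdot> c) = Dom C c" "FArr \<Phi> (z \<cdot> c) = q"
    using z c c' FO is_iso_Arr[OF cat z(1)] by simp_all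
  obtain n where n: "is_iso C n" "Dom C n = Dom C c" "Cod C n = Dom C c'" "FArr \<Phi> n = Idt S (Dom S q)" "c' \<cdot> n = z \<cdot> c"
  proof -
    have zi: "is_iso C (inv_arrow C z)" "FArr \<Phi> (inv_arrow C z) = Idt S (Cod S q)"
      using z functor_inv[OF \<Phi> z(1)] cat FO by simp_all
    obtain n' where n': "is_iso C n'" "Cod C n' = Dom C c" "Dom C n' = Dom C c'"
      "FArr \<Phi> n' = Idt S (FObj \<Phi> (Dom C c))" "c \<cdot> n' = inv_arrow C z \<cdot> c'"
      by (rule cartesian_comparison[OF c(1) c'(1), of "inv_arrow C z" "Cod S q"])
        (use c c' z zi cat in auto)
    have "z \<cdot> c = (z \<cdot> (c \<cdot> n')) \<cdot> inv_arrow C n'"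
      using n'(1-4) z(1-4) cat c by (simp add: Comp_assoc is_iso_Arr)
    also have "\<dots> = c' \<cdot> inv_arrow C n'"
      unfolding n'(5) using n'(1-4) z(1-4) cat c' by (simp add: Comp_assoc is_iso_Arr)
    finally show ?thesis
      using that[of "inv_arrow C n'"] n' functor_inv[OF \<Phi> n'(1)] cat FO by simp
  qed
  note [simp] = is_iso_Arr[OF cat z(1)] is_iso_Arr[OF cat m(1)] is_iso_Arr[OF cat n(1)] \<phi>(5)
  have "c' \<cdot> (b' \<cdot> m) \<cdot> d = c' \<cdot> b' \<cdot> (m \<cdot> d)"
    using c' b'(1-4) m(1-4) by (simp add: Comp_assoc)
  also have "\<dots> = (c' \<cdot> b' \<cdot> d') \<cdot> \<phi>"
    unfolding m(5) using c' b'(1-4) d' \<phi> by (simp add: Comp_assoc)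
  also have "\<dots> = e' \<cdot> (a' \<cdot> \<phi>)"
    unfolding b'(5) using e' a' \<phi> by (simp add: Comp_assoc)
  also have "\<dots> = (e' \<cdot> s) \<cdot> a"
    unfolding sa[symmetric] using e' s by (simp add: Comp_assoc)
  also have "\<dots> = z \<cdot> (e \<cdot> a)"
    unfolding z(5)[symmetric] using e z(1-4) by (simp add: Comp_assoc)
  also have "\<dots> = (z \<cdot> c) \<cdot> b \<cdot> d"
    unfolding b(5)[symmetric] using c z(1-4) b(1-4) d by (simp add: Comp_assoc)
  also have "\<dots> = c' \<cdot> (n \<cdot> b) \<cdot> d"
    unfolding n(5)[symmetric] using n(1-4) b(1-4) d c' by (simp add: Comp_assoc)
  finally have eq: "c' \<cdot> (b' \<cdot> m) \<cdot> d = c' \<cdot> (n \<cdot> b) \<cdot> d" .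
  \<comment> \<open>First the cartesian arrow \<open>c'\<close> is cancelled on the left, then the
    cocartesian \<open>d\<close> on the right; both candidates lie over the same identity.\<close>
  have "(b' \<cdot> m) \<cdot> d = (n \<cdot> b) \<cdot> d"
    by (rule cartesian_cancel[OF c'(1) _ _ _ _ _ _ eq]) (use b'(1-4) m(1-4) d n(1-4) b(1-4) FO in simp_all)
  then have "b' \<cdot> m = n \<cdot> b"
    by (rule cocartesian_cancel[OF \<Phi> d(1), rotated -1]) (use b'(1-4) m(1-4) d n(1-4) b(1-4) FO in simp_all)
  then show ?thesis
    by (rule is_iso_if_Comp_iso[OF cat]) (use m(1-4) n(1-4) b(1-4) b'(1-4) iso cat in simp_all)
qed

end

section \<open>Bi-deformable bifibrations\<close>

context fibered_weqs
begin

text \<open>Each natural weak equivalence, in either direction, becomes an isomorphism over an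
  identity, and such isomorphisms compose. So every object is isomorphic in the homotopy category to
  its deformation.\<close>

lemma deformation_iso:
  assumes "deformation (Fib A) (W A) T" "A \<in> Obj S" "X \<in> Obj (Fib A)"
  shows "FObj T X \<in> Obj (Fib A) \<and> (\<exists>s. is_iso H s \<and> Dom H s = X \<and> Cod H s = FObj T X \<and> FArr \<pi> s = Idt S A)"
  using assms(1,3)
proof (induction arbitrary: X rule: deformation.induct)
  case (to_id T \<tau>)
  then have T: "FObj T X \<in> Obj (Fib A)" and \<tau>: "\<tau> X \<in> hom (Fib A) (FObj T X) X" "\<tau> X \<in> W A"
    unfolding nat_weq_def nat_trans_def using functor_Obj by (fastforce simp: id_fmap_def)+
  have iso: "is_iso H (N (\<tau> X))" using N_iso[OF assms(2) \<tau>(2)] .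
  have "FArr \<pi> (inv_arrow H (N (\<tau> X))) = Idt S A"
    using functor_inv[OF \<pi>_functor iso] \<tau> assms(2) by simp
  then show ?case using T \<tau> iso by (intro conjI exI[of _ "inv_arrow H (N (\<tau> X))"]) simp_all
next
  case (from_id T \<tau>)
  then have T: "FObj T X \<in> Obj (Fib A)" and \<tau>: "\<tau> X \<in> hom (Fib A) X (FObj T X)" "\<tau> X \<in> W A"
    unfolding nat_weq_def nat_trans_def using functor_Obj by (fastforce simp: id_fmap_def)+
  have iso: "is_iso H (N (\<tau> X))" using N_iso[OF assms(2) \<tau>(2)] .
  then show ?case using T \<tau> iso by (intro conjI exI[of _ "N (\<tau> X)"]) simp_all
next
  case (composite T T')
  from composite(3)[OF composite(5)] obtain s where T: "FObj T X \<in> Obj (Fib A)"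
    and s: "is_iso H s" "Dom H s = X" "Cod H s = FObj T X" "FArr \<pi> s = Idt S A" by blast
  from composite(4)[OF T] obtain s' where T': "FObj T' (FObj T X) \<in> Obj (Fib A)"
    and s': "is_iso H s'" "Dom H s' = FObj T X" "Cod H s' = FObj T' (FObj T X)" "FArr \<pi> s' = Idt S A" by blast
  have "FArr \<pi> (s' \<cdot>\<^bsub>H\<^esub> s) = Idt S A"
    using s s' assms(2) is_iso_Arr[OF catH s(1)] is_iso_Arr[OF catH s'(1)] by (simp add: \<pi>_Comp)
  then show ?case
    using T' s s' is_iso_Arr[OF catH s(1)] is_iso_Arr[OF catH s'(1)]
    by (intro conjI exI[of _ "s' \<cdot>\<^bsub>H\<^esub> s"]) (simp_all add: comp_fmap_def)
qed

end

lemma cofibrant_opfibrationI: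
  assumes \<Phi>: "is_functor C S \<Phi>" and \<kappa>: "is_cleavage C S \<Phi> \<kappa>" and W: "fiberwise_weqs C S \<Phi> W"
    and Q: "cofibrant_replacement C S \<Phi> \<kappa> W Q \<theta> Cof"
  shows "cofibrant_opfibration C S \<Phi> W (Cocart \<kappa>) Q \<theta> Cof"
proof unfold_locales
  fix A assume A: "A \<in> Obj S"
  show "W A \<subseteq> Arr (fiber C S \<Phi> A)" using W A unfolding fiberwise_weqs_def by blast
  then show "v \<cdot>\<^bsub>C\<^esub> u \<in> W A" if "u \<in> W A" "v \<in> W A" "Cod C u = Dom C v" for u v
    using W A that unfolding fiberwise_weqs_def by blast
  show "u \<in> W A" if "u \<in> Arr (fiber C S \<Phi> A)" "v \<in> W A" "Cod C u = Dom C v" "v \<cdot>\<^bsub>C\<^esub> u \<in> W A" for u v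
    using W A that unfolding fiberwise_weqs_def by blast
  show "Cof A \<subseteq> Obj (fiber C S \<Phi> A)"
    "nat_weq (fiber C S \<Phi> A) (fiber C S \<Phi> A) (W A) (Q A) id_fmap (\<theta> A)"
    "FObj (Q A) ` Obj (fiber C S \<Phi> A) \<subseteq> Cof A"
    using Q A unfolding cofibrant_replacement_def by blast+
next
  fix f X assume f: "f \<in> Arr S"
  have Qf: "preserves_weqs_between C (Cof (Dom S f)) (W (Dom S f)) (Cof (Cod S f)) (W (Cod S f)) (push C S \<Phi> \<kappa> f)"
    using Q f unfolding cofibrant_replacement_def by blast
  show "Cod C (Cocart \<kappa> f X) \<in> Cof (Cod S f)" if "X \<in> Cof (Dom S f)"
    using Qf that by (auto simp: preserves_weqs_between_def push_def)
  fix w p assume w: "w \<in> W (Dom S f)" "Dom C w \<in> Cof (Dom S f)" "Cod C w \<in> Cof (Dom S f)"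
    and p: "p \<in> hom C (Cod C (Cocart \<kappa> f (Dom C w))) (Cod C (Cocart \<kappa> f (Cod C w)))"
      "FArr \<Phi> p = Idt S (Cod S f)" "p \<cdot>\<^bsub>C\<^esub> Cocart \<kappa> f (Dom C w) = Cocart \<kappa> f (Cod C w) \<cdot>\<^bsub>C\<^esub> w"
  have "Dom S f \<in> Obj S" using functor_target[OF \<Phi>] f by simp
  then have "Cof (Dom S f) \<subseteq> Obj (fiber C S \<Phi> (Dom S f))"
    using Q unfolding cofibrant_replacement_def by blast
  then have "Dom C w \<in> Obj C" "FObj \<Phi> (Dom C w) = Dom S f" using w(2) by auto
  then have "cocartesian C S \<Phi> (Cocart \<kappa> f (Dom C w))"
    using \<kappa> f unfolding is_cleavage_def by blast
  then have "FArr (push C S \<Phi> \<kappa> f) w = p"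
    unfolding push_def using cocart_factor_eqI[OF \<Phi>, of _ p] p by simp
  moreover have "FArr (push C S \<Phi> \<kappa> f) w \<in> W (Cod S f)"
    using Qf w by (simp add: preserves_weqs_between_def)
  ultimately show "p \<in> W (Cod S f)" by simp
qed (use \<Phi> \<kappa> in \<open>auto simp: is_cleavage_def\<close>)

definition op_cleavage :: "('o, 'a, 's) cleavage \<Rightarrow> ('o, 'a, 's) cleavage" where
  "op_cleavage \<kappa> = \<lparr>Cart = Cocart \<kappa>, Cocart = Cart \<kappa>\<rparr>"

lemma is_cleavage_op: "is_cleavage C S \<Phi> \<kappa> \<Longrightarrow> is_cleavage (op C) (op S) \<Phi> (op_cleavage \<kappa>)"
  using cocartesian_op[of "op C" "op S"]
  by (auto simp: is_cleavage_def op_cleavage_def cocartesian_op)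

lemma push_op: "push (op C) (op S) \<Phi> (op_cleavage \<kappa>) f = pull C S \<Phi> \<kappa> f"
  by (simp add: push_def pull_def op_cleavage_def cocart_factor_op)

text \<open>Reversing composition interchanges the two cancellation clauses of
  two-out-of-three.\<close>

lemma fiberwise_weqs_op:
  assumes "fiberwise_weqs C S \<Phi> W"
  shows "fiberwise_weqs (op C) (op S) \<Phi> W"
  unfolding fiberwise_weqs_def fiber_op op_simps
proof (intro ballI, rule conjI)
  fix A assume A: "A \<in> Obj S"
  show "W A \<subseteq> Arr (fiber C S \<Phi> A)" using assms A unfolding fiberwise_weqs_def by blast
  show "\<forall>u\<in>Arr (fiber C S \<Phi> A). \<forall>v\<in>Arr (fiber C S \<Phi> A). Dom C u = Cod C v \<longrightarrow>
      (u \<in> W A \<and> v \<in> W A \<longrightarrow> u \<cdot>\<^bsub>C\<^esub> v \<in> W A) \<and> (u \<in> W A \<and> u \<cdot>\<^bsub>C\<^esub> v \<in> W A \<longrightarrow> v \<in> W A) \<and>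
      (v \<in> W A \<and> u \<cdot>\<^bsub>C\<^esub> v \<in> W A \<longrightarrow> u \<in> W A)"
  proof (intro ballI impI)
    fix u v assume uv: "u \<in> Arr (fiber C S \<Phi> A)" "v \<in> Arr (fiber C S \<Phi> A)" "Dom C u = Cod C v"
    show "(u \<in> W A \<and> v \<in> W A \<longrightarrow> u \<cdot>\<^bsub>C\<^esub> v \<in> W A) \<and> (u \<in> W A \<and> u \<cdot>\<^bsub>C\<^esub> v \<in> W A \<longrightarrow> v \<in> W A) \<and>
      (v \<in> W A \<and> u \<cdot>\<^bsub>C\<^esub> v \<in> W A \<longrightarrow> u \<in> W A)"
      using assms[unfolded fiberwise_weqs_def, rule_format, OF A, THEN conjunct2, rule_format,
          OF uv(2,1) uv(3)[symmetric]] by blast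
  qed
qed

lemma cofibrant_replacement_op:
  "fibrant_replacement C S \<Phi> \<kappa> W R \<rho> Fib \<Longrightarrow> cofibrant_replacement (op C) (op S) \<Phi> (op_cleavage \<kappa>) W R \<rho> Fib"
  unfolding cofibrant_replacement_def fibrant_replacement_def push_op
  by (auto simp: nat_weq_op preserves_weqs_between_def)

theorem theorem3p3p4:
  fixes C :: "('o, 'a) category" and S :: "('b, 's) category"
    and \<Phi> :: "('o, 'a, 'b, 's) fmap" and \<kappa> :: "('o, 'a, 's) cleavage"
    and W :: "'b \<Rightarrow> 'a set" and HBC :: "'s square set"
  assumes "bifibration C S \<Phi>"
    and "is_cleavage C S \<Phi> \<kappa>"
    and "fiberwise_weqs C S \<Phi> W"
    and "bi_deformable C S \<Phi> \<kappa> W HBC"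
  shows "bifibration (Ho_total C S W) S (Ho_proj C S \<Phi>) \<and>
    (\<forall>A\<in>Obj S. cat_iso (Ho (fiber C S \<Phi> A) (W A))
        (fiber (Ho_total C S W) S (Ho_proj C S \<Phi>) A)
        (Ho_fiber_comparison C S \<Phi> W A)) \<and>
    (\<forall>sq\<in>HBC. \<forall>\<kappa>'. is_cleavage (Ho_total C S W) S (Ho_proj C S \<Phi>) \<kappa>' \<longrightarrow>
        beck_chevalley (Ho_total C S W) S (Ho_proj C S \<Phi>) \<kappa>' sq)"
proof -
  note \<kappa> = assms(2)
  have \<Phi>: "is_functor C S \<Phi>" using assms(1) by (simp add: bifibration_def)
  obtain Q \<theta> Cof R \<rho> Fb where Q: "cofibrant_replacement C S \<Phi> \<kappa> W Q \<theta> Cof"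
    and R: "fibrant_replacement C S \<Phi> \<kappa> W R \<rho> Fb"
    and HBC: "homotopy_beck_chevalley C S \<Phi> \<kappa> W \<theta> \<rho> HBC"
    using assms(4) unfolding bi_deformable_def by blast
  interpret cof: cofibrant_opfibration C S \<Phi> W "Cocart \<kappa>" Q \<theta> Cof
    by (rule cofibrant_opfibrationI[OF \<Phi> \<kappa> assms(3) Q])
  \<comment> \<open>Fibrant replacements and pullbacks are cofibrant replacements and pushforwards
    for the opposite functor.\<close>
  interpret fib: cofibrant_opfibration "op C" "op S" \<Phi> W "Cart \<kappa>" R \<rho> Fb
    using cofibrant_opfibrationI[OF is_functor_op[OF \<Phi>] is_cleavage_op[OF \<kappa>] fiberwise_weqs_op[OF assms(3)]
      cofibrant_replacement_op[OF R]] by (simp add: op_cleavage_def)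
  let ?H = "Ho_total C S W" and ?\<pi> = "Ho_proj C S \<Phi>" and ?N = "loc C (all_weqs S W)"
  let ?H' = "Ho_total (op C) (op S) W" and ?\<pi>' = "Ho_proj (op C) (op S) \<Phi>"
  have wq: "all_weqs (op S) W = all_weqs S W" by (simp add: all_weqs_def)
  have H': "?H' = Ho (op C) (all_weqs S W)" by (simp add: Ho_total_def wq)
  have dual: "cartesian ?H S ?\<pi> K" if "K \<in> Arr ?H" "cocartesian ?H' (op S) ?\<pi>' (zigzag_rev ` K)" for K
    using cartesian_if_cocartesian_op[OF \<Phi> cof.FArr_inverts, of "all_weqs S W" K] that
    unfolding Ho_total_def Ho_proj_def wq by blast
  have cart_ex: "\<exists>u. cartesian ?H S ?\<pi> u \<and> Cod ?H u = X \<and> FArr ?\<pi> u = f"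
    if fX: "f \<in> Arr S" "X \<in> Obj C" "FObj \<Phi> X = Cod S f" for f X
  proof -
    obtain d where d: "cocartesian ?H' (op S) ?\<pi>' d" "Dom ?H' d = X" "FArr ?\<pi>' d = f"
      using fib.Ho_cocartesian[of f X] fX by auto
    then have dA: "d \<in> Arr (Ho (op C) (all_weqs S W))"
      using cocartesian_Arr[OF fib.\<pi>_functor] by (simp add: H')
    let ?K = "zigzag_rev ` d"
    note K = Ho_op_Arr[OF is_category_op[OF functor_source[OF \<Phi>]] dA, unfolded op_simps]
    have K: "?K \<in> Arr ?H" "Cod ?H ?K = X" using K d(2) unfolding Ho_total_def wq by simp_all
    have "FArr ?\<pi>' (zigzag_rev ` ?K) = FArr ?\<pi> ?K"
      unfolding Ho_proj_def using Ho_lift_op[OF \<Phi> cof.FArr_inverts, of "all_weqs S W" ?K] K(1) unfolding Ho_total_def by blast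
    then show ?thesis
      using dual[of ?K] d K by (intro exI[of _ ?K]) simp
  qed
  \<comment> \<open>\<open>fib.p f (fib.t X)\<close> is the comparison between \<open>f^*\<close>
    and its derived functor. Where it is a weak equivalence, the chosen arrow stays cartesian after
    localization.\<close>
  have cart_N: "cartesian ?H S ?\<pi> (?N (Cart \<kappa> f X))"
    if fX: "f \<in> Arr S" "X \<in> Obj C" "FObj \<Phi> X = Cod S f" "FArr (pull C S \<Phi> \<kappa> f) (\<rho> (Cod S f) X) \<in> W (Dom S f)" for f X
  proof -
    have u: "Cart \<kappa> f X \<in> Arr C" using fib.c_Arr[of f X] fX by simp
    have t: "fib.t X = \<rho> (Cod S f) X" by (simp add: fib.t_def fX)
    have t': "fib.t X \<in> Arr C" "Cod C (fib.t X) = fib.q X" "Dom C (fib.t X) = X" "FArr \<Phi> (fib.t X) = Idt S (FObj \<Phi> X)"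
      using fib.t_simps[of X] fX by simp_all
    have c: "Cart \<kappa> f X \<in> Arr C" "Cod C (Cart \<kappa> f X) = X" "FArr \<Phi> (Cart \<kappa> f X) = f"
      using fib.c_Arr[of f X] fib.Dom_c[of f X] fib.FArr_c[of f X] fX by simp_all
    have "fib.p f (fib.t X) = FArr (pull C S \<Phi> \<kappa> f) (fib.t X)"
      using c t' fX functor_simps[OF \<Phi>]
      by (simp add: fib.p_def fib.bar_def push_op[symmetric] push_def op_cleavage_def)
    then have "cocartesian ?H' (op S) ?\<pi>' (loc (op C) (all_weqs (op S) W) (Cart \<kappa> f X))"
      using fib.Ho_cocartesian_c[of f X] fX t by simp
    moreover have "loc (op C) (all_weqs (op S) W) (Cart \<kappa> f X) = zigzag_rev ` ?N (Cart \<kappa> f X)"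
      using zclass_op[OF functor_source[OF \<Phi>], of "all_weqs S W" "Cod C (Cart \<kappa> f X)" "[Fwd (Cart \<kappa> f X)]"]
      by (simp add: wq loc_eq[OF functor_source[OF \<Phi>]] loc_eq[OF is_category_op[OF functor_source[OF \<Phi>]]])
    ultimately show ?thesis using dual[of "?N (Cart \<kappa> f X)"] u by simp
  qed
  have cocart_N: "cocartesian ?H S ?\<pi> (?N (Cocart \<kappa> f X))"
    if fX: "f \<in> Arr S" "X \<in> Obj C" "FObj \<Phi> X = Dom S f" "FArr (push C S \<Phi> \<kappa> f) (\<theta> (Dom S f) X) \<in> W (Cod S f)" for f X
  proof -
    have t: "cof.t X = \<theta> (Dom S f) X" by (simp add: cof.t_def fX)
    have "cof.p f (cof.t X) = FArr (push C S \<Phi> \<kappa> f) (cof.t X)"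
      using cof.t_simps[of X] fX by (simp add: cof.p_def cof.bar_def push_def)
    then show ?thesis using cof.Ho_cocartesian_c[of f X] fX t by simp
  qed
  have "bifibration ?H S ?\<pi>"
    unfolding bifibration_def
  proof (intro conjI ballI impI)
    show "is_functor ?H S ?\<pi>" by (rule cof.\<pi>_functor)
    fix f X assume f: "f \<in> Arr S" and X: "X \<in> Obj ?H"
    show "\<exists>u. cartesian ?H S ?\<pi> u \<and> Cod ?H u = X \<and> FArr ?\<pi> u = f" if "FObj ?\<pi> X = Cod S f"
      using cart_ex[of f X] f X that by simp
    show "\<exists>u. cocartesian ?H S ?\<pi> u \<and> Dom ?H u = X \<and> FArr ?\<pi> u = f" if "FObj ?\<pi> X = Dom S f"
      using cof.Ho_cocartesian[of f X] f X that by auto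
  qed
  \<comment> \<open>The cleavage \<open>\<kappa>'\<close> is arbitrary and need not come from
    \<open>\<kappa>\<close>; \<open>base_change_iso_transfer\<close> absorbs the difference.\<close>
  moreover have "beck_chevalley ?H S ?\<pi> \<kappa>' (g, f, p, q)"
    if sq: "(g, f, p, q) \<in> HBC" and \<kappa>': "is_cleavage ?H S ?\<pi> \<kappa>'" for g f p q \<kappa>'
  proof -
    have com: "commuting_square S (g, f, p, q)" and bc: "beck_chevalley C S \<Phi> \<kappa> (g, f, p, q)"
      and def: "coherently_deformable_pair
          [derivable_pull C S \<Phi> \<kappa> W \<rho> g, derivable_push C S \<Phi> \<kappa> W \<theta> f]
          [derivable_push C S \<Phi> \<kappa> W \<theta> p, derivable_pull C S \<Phi> \<kappa> W \<rho> q]"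
      using HBC sq unfolding homotopy_beck_chevalley_def by blast+
    have s [simp]: "g \<in> Arr S" "f \<in> Arr S" "p \<in> Arr S" "q \<in> Arr S" "Dom S g = Dom S f" "Cod S g = Dom S p"
      "Cod S f = Dom S q" "Cod S p = Cod S q"
      using com by simp_all
    obtain As Bs where As: "coherently_deformable_along As [derivable_pull C S \<Phi> \<kappa> W \<rho> g, derivable_push C S \<Phi> \<kappa> W \<theta> f]"
      and Bs: "coherently_deformable_along Bs [derivable_push C S \<Phi> \<kappa> W \<theta> p, derivable_pull C S \<Phi> \<kappa> W \<rho> q]"
      and AB: "As ! 0 = Bs ! 0"
      using def unfolding coherently_deformable_pair_def by blast
    \<comment> \<open>At an object of the common first subcategory, \<open>g^*\<close> and
      \<open>p_!\<close> lead into the second subcategories of the two lists. So the comparison maps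
      of all four functors are weak equivalences where the Beck-Chevalley diagram needs
      them.\<close>
    have A: "As ! 0 \<subseteq> Obj (fiber C S \<Phi> (Cod S g))"
      "\<exists>T. deformation (fiber C S \<Phi> (Cod S g)) (W (Cod S g)) T \<and> FObj T ` Obj (fiber C S \<Phi> (Cod S g)) \<subseteq> As ! 0"
      "\<forall>X\<in>As ! 0. FArr (pull C S \<Phi> \<kappa> g) (\<rho> (Cod S g) X) \<in> W (Dom S g)"
      "\<forall>X\<in>As ! 0. Dom C (Cart \<kappa> g X) \<in> As ! 1"
      "\<forall>Y\<in>As ! 1. FArr (push C S \<Phi> \<kappa> f) (\<theta> (Dom S f) Y) \<in> W (Cod S f)"
      using As unfolding coherently_deformable_along_def
      by (auto simp: derivable_pull_def derivable_push_def pull_def All_less_Suc image_subset_iff simp del: fiber_simps)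
    have B: "\<forall>X\<in>Bs ! 0. FArr (push C S \<Phi> \<kappa> p) (\<theta> (Dom S p) X) \<in> W (Cod S p)"
      "\<forall>X\<in>Bs ! 0. Cod C (Cocart \<kappa> p X) \<in> Bs ! 1"
      "\<forall>Z\<in>Bs ! 1. FArr (pull C S \<Phi> \<kappa> q) (\<rho> (Cod S q) Z) \<in> W (Dom S q)"
      using Bs unfolding coherently_deformable_along_def
      by (auto simp: derivable_pull_def derivable_push_def push_def All_less_Suc image_subset_iff simp del: fiber_simps)
    show ?thesis
      unfolding beck_chevalley.simps
    proof
      fix X assume X: "X \<in> Obj (fiber ?H S ?\<pi> (Cod S g))"
      obtain T where T: "deformation (fiber C S \<Phi> (Cod S g)) (W (Cod S g)) T"
        "FObj T ` Obj (fiber C S \<Phi> (Cod S g)) \<subseteq> As ! 0" using A(2) by blast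
      define Y where "Y = FObj T X"
      have X': "X \<in> Obj (fiber C S \<Phi> (Cod S g))" using X by simp
      then have YA: "Y \<in> As ! 0" using T(2) by (auto simp: Y_def)
      obtain r where r: "is_iso ?H r" "Dom ?H r = X" "Cod ?H r = Y" "FArr ?\<pi> r = Idt S (Cod S g)"
        and Y: "Y \<in> Obj C" "FObj \<Phi> Y = Cod S g"
        using cof.deformation_iso[OF T(1) _ X'] by (auto simp: Y_def)
      \<comment> \<open>The condition is known at \<open>Y\<close> and wanted at \<open>X\<close>,
        so the transfer needs an isomorphism from \<open>Y\<close> to \<open>X\<close>.\<close>
      define r' where "r' = inv_arrow ?H r"
      have r': "is_iso ?H r'" "Dom ?H r' = Y" "Cod ?H r' = X" "FArr ?\<pi> r' = Idt S (Cod S g)"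
        using r functor_inv[OF cof.\<pi>_functor r(1)] by (simp_all add: r'_def)
      define a d e c b where "a = Cart \<kappa> g Y" and "d = Cocart \<kappa> f (Dom C (Cart \<kappa> g Y))"
        and "e = Cocart \<kappa> p Y" and "c = Cart \<kappa> q (Cod C (Cocart \<kappa> p Y))"
        and "b = beck_chevalley_map C S \<Phi> \<kappa> (g, f, p, q) Y"
      have a: "a \<in> Arr C" "Cod C a = Y" "FArr \<Phi> a = g" "FObj \<Phi> (Dom C a) = Dom S f"
        using Cart_simps[OF \<Phi> \<kappa>, of g Y] Y by (simp_all add: a_def)
      have d: "d \<in> Arr C" "Dom C d = Dom C a" "FArr \<Phi> d = f"
        using Cocart_simps[OF \<Phi> \<kappa>, of f "Dom C a"] a by (simp_all add: d_def a_def[symmetric])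
      have e: "e \<in> Arr C" "Dom C e = Y" "FArr \<Phi> e = p" "FObj \<Phi> (Cod C e) = Cod S q"
        using Cocart_simps[OF \<Phi> \<kappa>, of p Y] Y by (simp_all add: e_def)
      have c: "c \<in> Arr C" "Cod C c = Cod C e" "FArr \<Phi> c = q"
        using Cart_simps[OF \<Phi> \<kappa>, of q "Cod C e"] e by (simp_all add: c_def e_def[symmetric])
      note b = beck_chevalley_map[OF \<Phi> \<kappa> com Y, folded a_def d_def e_def c_def b_def]
      \<comment> \<open>The Beck-Chevalley condition in \<open>C\<close> itself, used at the
        deformed object \<open>Y\<close>; the localization functor keeps the isomorphism.\<close>
      have "is_iso (fiber C S \<Phi> (Cod S f)) b"
        using bc Y by (simp add: b_def)
      then have "is_iso C b" by (rule is_iso_if_fiber[OF \<Phi>])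
      then have iso: "is_iso ?H (?N b)" by (rule functor_is_iso[OF cof.N_functor])
      have "cartesian ?H S ?\<pi> (?N a)"
        unfolding a_def using YA A(3) Y by (intro cart_N) simp_all
      moreover have "cocartesian ?H S ?\<pi> (?N d)"
        unfolding d_def a_def[symmetric] using YA A(4,5) a by (intro cocart_N) (simp_all add: a_def)
      moreover have "cocartesian ?H S ?\<pi> (?N e)"
        unfolding e_def using YA AB B(1) Y by (intro cocart_N) simp_all
      moreover have "cartesian ?H S ?\<pi> (?N c)"
        unfolding c_def e_def[symmetric] using YA AB B(2,3) e by (intro cart_N) (simp_all add: e_def)
      moreover have "?N c \<cdot>\<^bsub>?H\<^esub> ?N b \<cdot>\<^bsub>?H\<^esub> ?N d = ?N e \<cdot>\<^bsub>?H\<^esub> ?N a"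
      proof -
        have "?N (c \<cdot>\<^bsub>C\<^esub> b \<cdot>\<^bsub>C\<^esub> d) = ?N (e \<cdot>\<^bsub>C\<^esub> a)" using b(5) by simp
        then show ?thesis using a d e c b(1-4) functor_source[OF \<Phi>] by (simp add: cof.N_Comp)
      qed
      moreover
      have X'': "X \<in> Obj ?H" "FObj ?\<pi> X = Cod S g" using X by simp_all
      define a' d' e' c' b' where "a' = Cart \<kappa>' g X" and "d' = Cocart \<kappa>' f (Dom ?H (Cart \<kappa>' g X))"
        and "e' = Cocart \<kappa>' p X" and "c' = Cart \<kappa>' q (Cod ?H (Cocart \<kappa>' p X))"
        and "b' = beck_chevalley_map ?H S ?\<pi> \<kappa>' (g, f, p, q) X"
      have a': "cartesian ?H S ?\<pi> a'" "a' \<in> Arr ?H" "Cod ?H a' = X" "FArr ?\<pi> a' = g" "FObj \<Phi> (Dom ?H a') = Dom S f"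
        using Cart_simps[OF cof.\<pi>_functor \<kappa>', of g X] X'' by (simp_all add: a'_def)
      have d': "cocartesian ?H S ?\<pi> d'" "Dom ?H d' = Dom ?H a'" "FArr ?\<pi> d' = f"
        using Cocart_simps[OF cof.\<pi>_functor \<kappa>', of f "Dom ?H a'"] Dom_Obj[OF cof.catH a'(2)] a' by (simp_all add: d'_def a'_def[symmetric])
      have e': "cocartesian ?H S ?\<pi> e'" "e' \<in> Arr ?H" "Dom ?H e' = X" "FArr ?\<pi> e' = p" "FObj \<Phi> (Cod ?H e') = Cod S q"
        using Cocart_simps[OF cof.\<pi>_functor \<kappa>', of p X] X'' by (simp_all add: e'_def)
      have c': "cartesian ?H S ?\<pi> c'" "Cod ?H c' = Cod ?H e'" "FArr ?\<pi> c' = q"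
        using Cart_simps[OF cof.\<pi>_functor \<kappa>', of q "Cod ?H e'"] Cod_Obj[OF cof.catH e'(2)] e'
        by (simp_all add: c'_def e'_def[symmetric])
      note b' = beck_chevalley_map[OF cof.\<pi>_functor \<kappa>' com X'', folded a'_def d'_def e'_def c'_def b'_def]
      ultimately have "is_iso ?H b'"
        using a b c d e a' d' e' c' r' iso
        by (intro base_change_iso_transfer[OF cof.\<pi>_functor com, of "?N a" "?N d" "?N e" "?N c" "?N b" a' d' e' c' b' r'])
          simp_all
      then show "is_iso (fiber ?H S ?\<pi> (Cod S f)) (beck_chevalley_map ?H S ?\<pi> \<kappa>' (g, f, p, q) X)"
        using is_iso_fiber[OF cof.\<pi>_functor _ b'(4)] by (simp add: b'_def)
    qed
  qed
  ultimately show ?thesis using cof.Ho_fiber_iso by auto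
qed

end
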